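(* Let $X\sim\mathrm{IP}(\mu;\delta,\beta,\gamma)$ with $\delta\le 0$, fix non-negative integers $m,n$ with $n\ne 0$, and let $g\in\mathcal{H}^{m,n}(X)$. Define \[ S_{m,n}(g)=\sum_{i=1}^{m}a_i\,\mathbb{E}^2\big[q^i(X)g^{(i)}(X)\big]+\sum_{i=1}^{n}(-1)^{i-1}b_i\,\mathbb{E}\big[q^{i}(X)\big(g^{(i)}(X)\big)^2\big], \] where \[ a_i=\frac{\binom{m}{i}\prod_{j=m+i}^{m+n+i-1}(1-j\delta)}{(m+n)_i\,\mathbb{E}[q^i(X)]\Big(\prod_{j=i-1}^{2i-2}(1-j\delta)\Big)\prod_{j=m}^{m+n-1}(1-j\delta)},\qquad b_i=\frac{\binom{n}{i}}{(m+n)_i\prod_{j=m}^{m+i-1}(1-j\delta)} \] are strictly positive constants, and the first sum is zero when $m=0$. Then \[ (-1)^n\big(\mathrm{Var}\,g(X)-S_{m,n}(g)\big)\ge 0, \] and $S_{m,n}(g)=\mathrm{Var}\,g(X)$ if and only if $g$ is a polynomial of degree at most $m+n$ on the support of $X$.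
   Context: A random variable $X$ with density $f$ and finite mean $\mu=\mathbb{E}X$ belongs to the integrated Pearson family, written $X\sim\mathrm{IP}(\mu;\delta,\beta,\gamma)$, if there is a quadratic polynomial $q(x)=\delta x^2+\beta x+\gamma$ (with $|\delta|+|\beta|+|\gamma|>0$) such that $\int_{-\infty}^{x}(\mu-t)f(t)\,dt=q(x)f(x)$ for all $x\in\mathbb{R}$. Let $J(X)=(\alpha,\omega)$ denote the support of $X$. For $x\in\mathbb{R}$ and $k\in\mathbb{N}$, $(x)_k=x(x-1)\cdots(x-k+1)$ with $(x)_0=1$. For non-negative integers $m,n$ with $\ell=\max\{m,n\}$ and $\mathbb{E}|X|^{2\ell}<\infty$, $\mathcal{H}^{m,n}(X)$ is the class of Borel functions $g:(\alpha,\omega)\to\mathbb{R}$ such that: $g\in C^{\ell-1}(\alpha,\omega)$ and $g^{(\ell-1)}$ is absolutely continuous on $(\alpha,\omega)$ with a.s. derivative $g^{(\ell)}$; $\mathbb{E}[q^n(X)(g^{(n)}(X))^2]<\infty$; and $\mathbb{E}[q^i(X)|g^{(i)}(X)|]<\infty$ for $i=n+1,\dots,m$ (if any). Empty products equal $1$, and $\mathbb{E}^2[Y]$ means $(\mathbb{E}Y)^2$. *)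

theory Defs
  imports "HOL-Analysis.Analysis" "HOL-Computational_Algebra.Polynomial"
begin

text \<open>A random variable X is represented by its Lebesgue density f.
  E[h(X)] is the Lebesgue integral of h times f.\<close>

definition is_density :: "(real \<Rightarrow> real) \<Rightarrow> bool" where
  "is_density f \<longleftrightarrow> f \<in> borel_measurable borel \<and> (\<forall>x. 0 \<le> f x)
     \<and> integrable lborel f \<and> (LINT x|lborel. f x) = 1"

definition expect :: "(real \<Rightarrow> real) \<Rightarrow> (real \<Rightarrow> real) \<Rightarrow> real" where
  "expect f h = (LINT x|lborel. h x * f x)"

definition varg :: "(real \<Rightarrow> real) \<Rightarrow> (real \<Rightarrow> real) \<Rightarrow> real" where
  "varg f g = expect f (\<lambda>x. (g x - expect f g)\<^sup>2)"

definition qpoly :: "real \<Rightarrow> real \<Rightarrow> real \<Rightarrow> real \<Rightarrow> real" where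
  "qpoly \<delta> \<beta> \<gamma> x = \<delta> * x\<^sup>2 + \<beta> * x + \<gamma>"

definition IP :: "(real \<Rightarrow> real) \<Rightarrow> real \<Rightarrow> real \<Rightarrow> real \<Rightarrow> real \<Rightarrow> bool" where
  "IP f \<mu> \<delta> \<beta> \<gamma> \<longleftrightarrow> is_density f \<and> integrable lborel (\<lambda>t. t * f t)
     \<and> \<mu> = (LINT t|lborel. t * f t)
     \<and> \<bar>\<delta>\<bar> + \<bar>\<beta>\<bar> + \<bar>\<gamma>\<bar> > 0
     \<and> (\<forall>x. (LINT t:{..x}|lborel. (\<mu> - t) * f t) = qpoly \<delta> \<beta> \<gamma> x * f x)"

definition is_support :: "(real \<Rightarrow> real) \<Rightarrow> real set \<Rightarrow> bool" where
  "is_support f J \<longleftrightarrow> (\<exists>\<alpha> \<omega> :: ereal. J = {x. \<alpha> < ereal x \<and> ereal x < \<omega>})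
     \<and> (AE x in lborel. (x \<in> J) = (0 < f x))"

text \<open>G is the chain of derivatives of g of order l on J:
  G 0 = g on J, G k has derivative G (k+1) on J for k+1 < l (so g is C^(l-1)),
  and G (l-1) is (locally) absolutely continuous on J with a.e. derivative G l,
  i.e. G (l-1) b - G (l-1) a is the Lebesgue integral of G l over [a,b].\<close>
definition deriv_chain :: "real set \<Rightarrow> nat \<Rightarrow> (real \<Rightarrow> real) \<Rightarrow> (nat \<Rightarrow> real \<Rightarrow> real) \<Rightarrow> bool" where
  "deriv_chain J l g G \<longleftrightarrow> 1 \<le> l \<and> (\<forall>x\<in>J. G 0 x = g x)
     \<and> (\<forall>k. k + 1 < l \<longrightarrow> (\<forall>x\<in>J. (G k has_real_derivative G (k + 1) x) (at x)))
     \<and> (\<forall>a\<in>J. \<forall>b\<in>J. a \<le> b \<longrightarrow> set_integrable lborel {a..b} (G l)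
            \<and> G (l - 1) b - G (l - 1) a = (LINT t:{a..b}|lborel. G l t))"

definition Hclass :: "(real \<Rightarrow> real) \<Rightarrow> real \<Rightarrow> real \<Rightarrow> real \<Rightarrow> real set \<Rightarrow> nat \<Rightarrow> nat
     \<Rightarrow> (real \<Rightarrow> real) \<Rightarrow> (nat \<Rightarrow> real \<Rightarrow> real) \<Rightarrow> bool" where
  "Hclass f \<delta> \<beta> \<gamma> J m n g G \<longleftrightarrow>
     integrable lborel (\<lambda>x. \<bar>x\<bar> ^ (2 * max m n) * f x)
     \<and> deriv_chain J (max m n) g G
     \<and> integrable lborel (\<lambda>x. qpoly \<delta> \<beta> \<gamma> x ^ n * (G n x)\<^sup>2 * f x)
     \<and> (\<forall>i\<in>{n+1..m}. integrable lborel (\<lambda>x. qpoly \<delta> \<beta> \<gamma> x ^ i * G i x * f x))"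

definition ffac :: "real \<Rightarrow> nat \<Rightarrow> real" where
  "ffac x k = (\<Prod>j<k. (x - real j))"

definition coef_a :: "(real \<Rightarrow> real) \<Rightarrow> real \<Rightarrow> real \<Rightarrow> real \<Rightarrow> nat \<Rightarrow> nat \<Rightarrow> nat \<Rightarrow> real" where
  "coef_a f \<delta> \<beta> \<gamma> m n i =
     (real (m choose i) * (\<Prod>j\<in>{m+i..m+n+i-1}. (1 - real j * \<delta>))) /
     (ffac (real (m + n)) i * expect f (\<lambda>x. qpoly \<delta> \<beta> \<gamma> x ^ i)
        * (\<Prod>j\<in>{i-1..2*i-2}. (1 - real j * \<delta>)) * (\<Prod>j\<in>{m..m+n-1}. (1 - real j * \<delta>)))"

definition coef_b :: "real \<Rightarrow> nat \<Rightarrow> nat \<Rightarrow> nat \<Rightarrow> real" where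
  "coef_b \<delta> m n i = real (n choose i) /
     (ffac (real (m + n)) i * (\<Prod>j\<in>{m..m+i-1}. (1 - real j * \<delta>)))"

definition Smn :: "(real \<Rightarrow> real) \<Rightarrow> real \<Rightarrow> real \<Rightarrow> real \<Rightarrow> nat \<Rightarrow> nat \<Rightarrow> (nat \<Rightarrow> real \<Rightarrow> real) \<Rightarrow> real" where
  "Smn f \<delta> \<beta> \<gamma> m n G =
     (\<Sum>i=1..m. coef_a f \<delta> \<beta> \<gamma> m n i * (expect f (\<lambda>x. qpoly \<delta> \<beta> \<gamma> x ^ i * G i x))\<^sup>2)
   + (\<Sum>i=1..n. (-1) ^ (i - 1) * coef_b \<delta> m n i * expect f (\<lambda>x. qpoly \<delta> \<beta> \<gamma> x ^ i * (G i x)\<^sup>2))"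

end

theory Submission
  imports Defs
begin

text \<open>
  On its support the density \<open>w\<close> is smooth with \<open>(q w)' = (\<mu> - x) w\<close>, so the operator
  \<open>L r = q r'' + (\<mu> - x) r'\<close> is symmetric in \<open>L\<^sup>2(w)\<close> and has eigenpolynomials \<open>p\<^sub>k\<close> of degree \<open>k\<close>
  for the eigenvalues \<open>-\<lambda>\<^sub>k\<close>, where \<open>\<lambda>\<^sub>k = k (1 - (k - 1) \<delta>)\<close>. The weights \<open>q^i w\<close> are of the same kind,
  and the energies \<open>E[q^i (g^(i))^2]\<close> act on the coefficient of \<open>p\<^sub>k\<close> as the Newton polynomials
  \<open>\<Prod>s<i. (\<lambda>\<^sub>k - \<lambda>\<^sub>s)\<close>. The alternating sum of the \<open>b\<^sub>i\<close> is the Newton expansion of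
  \<open>P(\<lambda>) = \<Prod>j=m+1..m+n. (1 - \<lambda> / \<lambda>\<^sub>j)\<close>, and the terms with \<open>a\<^sub>i\<close> remove the indices \<open>k \<le> m\<close>. What is left
  is a combination of the values \<open>P(\<lambda>\<^sub>k)\<close> with \<open>k > m\<close>, which vanish up to \<open>m + n\<close> and have sign \<open>(-1)^n\<close> beyond.

  Completeness of the \<open>p\<^sub>k\<close> is not needed: after subtracting the projection of \<open>g\<close> to degree \<open>N\<close>, a Poincare
  inequality with constant \<open>\<lambda>\<^bsub>N+1\<^esub> - \<lambda>\<^sub>i\<close> lets the top order energy of the remainder dominate all others.
\<close>

section \<open>Absolutely continuous functions on an interval\<close>

text \<open>The obstacle is the boundary: nothing is assumed about \<open>g\<close> or the density
  at the ends of the support, and above order \<open>n\<close> only \<open>E[q^i |g^(i)|]\<close> is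
  known to be finite. So every integration by parts on the whole support is Fubini against the
  Pearson identity itself. The sign of \<delta> keeps \<open>q\<close> below a linear function on
  the support, which yields all moments, and it makes the eigenvalues strictly increasing and
  unbounded. The squared expectations occur because the \<open>i\<close>-th derivative of the monic
  \<open>p_i\<close> is the constant \<open>i!\<close>: moving derivatives onto \<open>p_i\<close>
  shows that \<open>E[q^i g^(i)]\<close> is a multiple of the coefficient of \<open>g\<close> at
  \<open>p_i\<close>. Index 0 is the mean and turns the second moment into the variance. Stopping at
  a finite degree \<open>N\<close> loses nothing: the alternating sum for \<open>g\<close> is a
  finite spectral sum plus the same alternating sum for the remainder. \<open>N\<close> is chosen
  after the \<open>b_i\<close>, so large that the remainder's sum also has sign
  \<open>(-1)^n\<close> and vanishes only with the remainder. The same bound therefore settles the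
  inequality and the case of equality.\<close>

lemma fubini_kernel:
  fixes h k :: "real \<Rightarrow> real" and \<kappa> :: "real \<Rightarrow> real \<Rightarrow> real"
  assumes [measurable]: "h \<in> borel_measurable borel"
    and k: "integrable lborel k"
    and [measurable]: "(\<lambda>(t, s). \<kappa> t s) \<in> borel_measurable (borel \<Otimes>\<^sub>M borel)"
    and bound: "\<And>t s. \<bar>\<kappa> t s\<bar> \<le> 1"
    and h: "integrable lborel (\<lambda>t. \<bar>h t\<bar> * (LINT s|lborel. \<bar>\<kappa> t s * k s\<bar>))"
  shows "integrable lborel (\<lambda>s. k s * (LINT t|lborel. \<kappa> t s * h t))"
    and "(LINT s|lborel. k s * (LINT t|lborel. \<kappa> t s * h t))
          = (LINT t|lborel. h t * (LINT s|lborel. \<kappa> t s * k s))"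
proof -
  have [measurable]: "k \<in> borel_measurable borel"
    using k by (simp add: borel_measurable_integrable)
  let ?f = "\<lambda>t s. h t * (\<kappa> t s * k s)"
  have int: "integrable lborel (\<lambda>s. \<kappa> t s * k s)" for t
  proof (rule Bochner_Integration.integrable_bound[OF k])
    show "AE s in lborel. norm (\<kappa> t s * k s) \<le> norm (k s)"
      using bound by (auto simp: abs_mult intro!: mult_left_le_one_le)
  qed measurable
  have F: "integrable (lborel \<Otimes>\<^sub>M lborel) (case_prod ?f)"
  proof (rule lborel_pair.Fubini_integrable)
    show "integrable lborel (\<lambda>t. LINT s|lborel. norm (case (t, s) of (t, s) \<Rightarrow> ?f t s))"
      using h by (simp add: abs_mult)
    show "AE t in lborel. integrable lborel (\<lambda>s. case (t, s) of (t, s) \<Rightarrow> ?f t s)"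
      using int by simp
  qed measurable
  have eq: "(LINT t|lborel. ?f t s) = k s * (LINT t|lborel. \<kappa> t s * h t)" for s
    by (subst integral_mult_right_zero[symmetric]) (simp add: mult_ac)
  show "integrable lborel (\<lambda>s. k s * (LINT t|lborel. \<kappa> t s * h t))"
    using lborel_pair.integrable_snd[OF F] unfolding eq .
  show "(LINT s|lborel. k s * (LINT t|lborel. \<kappa> t s * h t))
          = (LINT t|lborel. h t * (LINT s|lborel. \<kappa> t s * k s))"
    using lborel_pair.Fubini_integral[OF F] unfolding eq by simp
qed

text \<open>Local absolute continuity of \<open>u\<close>, expressed through a fixed almost everywhere derivative \<open>u'\<close>.\<close>

definition ac_deriv :: "real set \<Rightarrow> (real \<Rightarrow> real) \<Rightarrow> (real \<Rightarrow> real) \<Rightarrow> bool" where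
  "ac_deriv J u u' \<longleftrightarrow> (\<forall>a\<in>J. \<forall>b\<in>J. a \<le> b \<longrightarrow>
     integrable lborel (\<lambda>x. indicator {a..b} x * u' x)
     \<and> u b - u a = (LINT x|lborel. indicator {a..b} x * u' x))"

lemma ac_derivD:
  assumes "ac_deriv J u u'" "a \<in> J" "b \<in> J" "a \<le> b"
  shows "integrable lborel (\<lambda>x. indicator {a..b} x * u' x)"
    and "(LINT x|lborel. indicator {a..b} x * u' x) = u b - u a"
  using assms unfolding ac_deriv_def by auto

lemma einterval_Icc_subset: "a \<in> einterval \<alpha> \<omega> \<Longrightarrow> b \<in> einterval \<alpha> \<omega> \<Longrightarrow> {a..b} \<subseteq> einterval \<alpha> \<omega>"
  by (auto simp: einterval_iff intro: less_le_trans le_less_trans simp flip: ereal_less_eq(3))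

lemma ac_deriv_C1:
  assumes "\<And>x. x \<in> einterval \<alpha> \<omega> \<Longrightarrow> (u has_real_derivative u' x) (at x)"
    and "continuous_on (einterval \<alpha> \<omega>) u'"
  shows "ac_deriv (einterval \<alpha> \<omega>) u u'"
  unfolding ac_deriv_def
proof (intro ballI impI)
  fix a b assume ab: "a \<in> einterval \<alpha> \<omega>" "b \<in> einterval \<alpha> \<omega>" "a \<le> b"
  then have sub: "{a..b} \<subseteq> einterval \<alpha> \<omega>" by (intro einterval_Icc_subset)
  have "has_bochner_integral lborel (\<lambda>x. indicator {a..b} x *\<^sub>R u' x) (u b - u a)"
  proof (rule has_bochner_integral_FTC_Icc[OF ab(3)])
    show "(u has_vector_derivative u' x) (at x within {a..b})" if "a \<le> x" "x \<le> b" for x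
    proof -
      have "x \<in> einterval \<alpha> \<omega>" using sub that by auto
      then show ?thesis
        using assms(1) has_vector_derivative_at_within
        unfolding has_real_derivative_iff_has_vector_derivative by blast
    qed
    show "continuous_on {a..b} u'" by (rule continuous_on_subset[OF assms(2) sub])
  qed
  then show "integrable lborel (\<lambda>x. indicator {a..b} x * u' x)
     \<and> u b - u a = (LINT x|lborel. indicator {a..b} x * u' x)"
    by (auto simp: has_bochner_integral_iff)
qed

lemma ac_deriv_diff:
  assumes "ac_deriv J u u'" "ac_deriv J v v'"
  shows "ac_deriv J (\<lambda>x. u x - v x) (\<lambda>x. u' x - v' x)"
  unfolding ac_deriv_def
proof (intro ballI impI)
  fix a b assume ab: "a \<in> J" "b \<in> J" "a \<le> b"
  show "integrable lborel (\<lambda>x. indicator {a..b} x * (u' x - v' x)) \<and>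
    u b - v b - (u a - v a) = (LINT x|lborel. indicator {a..b} x * (u' x - v' x))"
    using ac_derivD[OF assms(1) ab] ac_derivD[OF assms(2) ab] by (simp add: right_diff_distrib)
qed

lemma einterval_exhaustion:
  assumes "\<alpha> < \<omega>"
  obtains a b :: "nat \<Rightarrow> real" where "einterval \<alpha> \<omega> = (\<Union>i. {a i..b i})" "incseq (\<lambda>i. {a i..b i})"
    "\<And>i. a i \<in> einterval \<alpha> \<omega>" "\<And>i. b i \<in> einterval \<alpha> \<omega>" "\<And>i. a i \<le> b i"
proof -
  obtain b a :: "nat \<Rightarrow> real" where ab: "einterval \<alpha> \<omega> = (\<Union>i. {a i..b i})" "incseq b" "decseq a" "\<And>i. a i < b i"
    by (rule einterval_Icc_approximation[OF assms]) (rule that; assumption)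
  have "incseq (\<lambda>i. {a i..b i})"
    by (rule incseq_SucI) (use incseq_SucD[OF ab(2)] decseq_SucD[OF ab(3)] in simp)
  moreover have "a i \<in> einterval \<alpha> \<omega>" for i
    unfolding ab(1) by (rule UN_I[of i]) (use ab(4)[of i] in simp_all)
  moreover have "b i \<in> einterval \<alpha> \<omega>" for i
    unfolding ab(1) by (rule UN_I[of i]) (use ab(4)[of i] in simp_all)
  ultimately show ?thesis by (rule that[OF ab(1)]) (use less_imp_le[OF ab(4)] in simp)
qed

text \<open>\<open>ac_deriv\<close> constrains \<open>u'\<close> only on compact pieces of the
  interval, so measurability holds after cutting off; the cut-off function is a pointwise limit
  along a compact exhaustion.\<close>

lemma ac_deriv_measurable:
  assumes "ac_deriv (einterval \<alpha> \<omega>) u u'" "\<alpha> < \<omega>"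
  shows "(\<lambda>x. indicator (einterval \<alpha> \<omega>) x * u' x) \<in> borel_measurable borel"
proof -
  obtain a b :: "nat \<Rightarrow> real" where ab: "einterval \<alpha> \<omega> = (\<Union>i. {a i..b i})" "incseq (\<lambda>i. {a i..b i})"
    "\<And>i. a i \<in> einterval \<alpha> \<omega>" "\<And>i. b i \<in> einterval \<alpha> \<omega>" "\<And>i. a i \<le> b i"
    by (rule einterval_exhaustion[OF assms(2)]) (rule that; assumption)
  show ?thesis
  proof (rule borel_measurable_LIMSEQ_real)
    show "(\<lambda>i. indicator {a i..b i} x * u' x) \<longlonglongrightarrow> indicator (einterval \<alpha> \<omega>) x * u' x" for x
      unfolding ab(1) by (intro tendsto_mult tendsto_const LIMSEQ_indicator_incseq ab(2))
    show "(\<lambda>x. indicator {a i..b i} x * u' x) \<in> borel_measurable borel" for i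
      using ac_derivD(1)[OF assms(1) ab(3,4,5)] by (simp add: borel_measurable_integrable)
  qed
qed

lemma einterval_nbhd:
  assumes "x \<in> einterval \<alpha> \<omega>"
  obtains a b where "a \<in> einterval \<alpha> \<omega>" "b \<in> einterval \<alpha> \<omega>" "a < x" "x < b" "{a..b} \<subseteq> einterval \<alpha> \<omega>"
proof -
  obtain e where e: "e > 0" "cball x e \<subseteq> einterval \<alpha> \<omega>"
    using open_contains_cball[of "einterval \<alpha> \<omega>"] assms by auto
  have "{x - e..x + e} \<subseteq> einterval \<alpha> \<omega>" using e by (auto simp: cball_eq_atLeastAtMost)
  moreover from this have "x - e \<in> einterval \<alpha> \<omega>" "x + e \<in> einterval \<alpha> \<omega>"
    using e(1) by (auto dest: subsetD[where c = "x - e"] subsetD[where c = "x + e"])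
  ultimately show ?thesis using e(1) by (intro that[of "x - e" "x + e"]) simp_all
qed

lemma ac_deriv_continuous:
  assumes "ac_deriv (einterval \<alpha> \<omega>) u u'"
  shows "continuous_on (einterval \<alpha> \<omega>) u"
proof -
  have "isCont u x" if x: "x \<in> einterval \<alpha> \<omega>" for x
  proof -
    obtain a b where ab: "a \<in> einterval \<alpha> \<omega>" "b \<in> einterval \<alpha> \<omega>" "a < x" "x < b"
      "{a..b} \<subseteq> einterval \<alpha> \<omega>" using einterval_nbhd[OF x] by blast
    have "set_integrable lborel {a..b} u'"
      using ac_derivD(1)[OF assms ab(1,2)] ab(3,4) by (simp add: set_integrable_def)
    then have io: "u' integrable_on {a..b}" by (rule set_borel_integral_eq_integral(1))
    have eq: "u y = u a + integral {a..y} u'" if "y \<in> {a..b}" for y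
    proof -
      have y: "y \<in> einterval \<alpha> \<omega>" "a \<le> y" using subsetD[OF ab(5) that] that by auto
      have "set_integrable lborel {a..y} u'"
        using ac_derivD(1)[OF assms ab(1) y] by (auto simp: set_integrable_def)
      from set_borel_integral_eq_integral(2)[OF this]
      show ?thesis using ac_derivD(2)[OF assms ab(1) y] by (simp add: set_lebesgue_integral_def)
    qed
    have "continuous_on {a..b} (\<lambda>y. u a + integral {a..y} u')"
      by (intro continuous_on_add continuous_on_const indefinite_integral_continuous_1 io)
    then have "continuous_on {a..b} u" by (subst continuous_on_cong[OF refl eq])
    then have "continuous_on {a<..<b} u" by (rule continuous_on_subset) auto
    then show ?thesis using ab(3,4) continuous_on_eq_continuous_at[of "{a<..<b}" u] by simp
  qed
  then show ?thesis by (simp add: continuous_at_imp_continuous_on)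
qed

lemma integrable_indicator_continuous:
  assumes "continuous_on (einterval \<alpha> \<omega>) r" "a \<in> einterval \<alpha> \<omega>" "b \<in> einterval \<alpha> \<omega>"
  shows "integrable lborel (\<lambda>x. indicator {a..b} x * r x :: real)"
  using borel_integrable_atLeastAtMost'[of a b r] continuous_on_subset[OF assms(1)]
    einterval_Icc_subset[OF assms(2,3)] by (auto simp: set_integrable_def)

lemma continuous_measurable:
  fixes u :: "real \<Rightarrow> real"
  assumes "continuous_on (einterval \<alpha> \<omega>) u"
  shows "(\<lambda>x. indicator (einterval \<alpha> \<omega>) x * u x) \<in> borel_measurable borel"
  using borel_measurable_continuous_on_indicator[OF _ assms] by simp

lemma integrable_indicator_mult_cont:
  assumes u': "integrable lborel (\<lambda>x. indicator {a..b} x * u' x :: real)"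
    and r: "continuous_on (einterval \<alpha> \<omega>) r" and ab: "a \<in> einterval \<alpha> \<omega>" "b \<in> einterval \<alpha> \<omega>"
  shows "integrable lborel (\<lambda>x. indicator {a..b} x * (u' x * r x))"
proof -
  have sub: "{a..b} \<subseteq> einterval \<alpha> \<omega>" by (rule einterval_Icc_subset[OF ab])
  have "bounded (r ` {a..b})"
    using continuous_on_subset[OF r sub] by (intro compact_imp_bounded compact_continuous_image) auto
  then obtain M where M: "\<And>x. x \<in> {a..b} \<Longrightarrow> \<bar>r x\<bar> \<le> M" unfolding bounded_iff by fastforce
  have mr: "(\<lambda>x. indicator {a..b} x * r x) \<in> borel_measurable borel"
    using borel_measurable_integrable[OF integrable_indicator_continuous[OF r ab]] by simp
  have mu: "(\<lambda>x. indicator {a..b} x * u' x) \<in> borel_measurable borel"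
    using borel_measurable_integrable[OF u'] by simp
  show ?thesis
  proof (rule Bochner_Integration.integrable_bound[OF integrable_mult_right[OF u', of M]])
    have "(\<lambda>x. (indicator {a..b} x * u' x) * (indicator {a..b} x * r x)) \<in> borel_measurable borel"
      using mu mr by measurable
    also have "(\<lambda>x. (indicator {a..b} x * u' x) * (indicator {a..b} x * r x))
        = (\<lambda>x. indicator {a..b} x * (u' x * r x))"
      by (auto simp: fun_eq_iff indicator_def)
    finally show "(\<lambda>x. indicator {a..b} x * (u' x * r x)) \<in> borel_measurable lborel" by simp
    show "AE x in lborel. norm (indicator {a..b} x * (u' x * r x)) \<le> norm (M * (indicator {a..b} x * u' x))"
    proof (intro always_eventually allI)
      fix x
      show "norm (indicator {a..b} x * (u' x * r x)) \<le> norm (M * (indicator {a..b} x * u' x))"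
        using M[of x] by (auto simp: indicator_def abs_mult mult.commute intro!: mult_mono)
    qed
  qed
qed

text \<open>Fubini for \<open>u'(t) r'(s)\<close> on the triangle
  \<open>a \<le> t \<le> s \<le> b\<close>. Both inner integrals are increments, of \<open>u\<close>
  and of \<open>r\<close>, and equating the two iterated integrals is integration by parts. The
  smooth factor \<open>r\<close> will be a polynomial or a dual function.\<close>

lemma ac_deriv_mult:
  assumes u: "ac_deriv (einterval \<alpha> \<omega>) u u'"
    and r: "\<And>x. x \<in> einterval \<alpha> \<omega> \<Longrightarrow> (r has_real_derivative r' x) (at x)"
    and r': "continuous_on (einterval \<alpha> \<omega>) r'"
  shows "ac_deriv (einterval \<alpha> \<omega>) (\<lambda>x. u x * r x) (\<lambda>x. u' x * r x + u x * r' x)"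
  unfolding ac_deriv_def
proof (intro ballI impI)
  fix a b assume ab: "a \<in> einterval \<alpha> \<omega>" "b \<in> einterval \<alpha> \<omega>" "a \<le> b"
  have sub: "{a..b} \<subseteq> einterval \<alpha> \<omega>" using ab by (intro einterval_Icc_subset)
  have acr: "ac_deriv (einterval \<alpha> \<omega>) r r'" by (rule ac_deriv_C1[OF r r'])
  note cr = ac_deriv_continuous[OF acr]
  have i1: "integrable lborel (\<lambda>x. indicator {a..b} x * (u' x * r x))"
    by (rule integrable_indicator_mult_cont[OF ac_derivD(1)[OF u ab] cr ab(1,2)])
  have i2: "integrable lborel (\<lambda>x. indicator {a..b} x * (u x * r' x))"
    by (intro integrable_indicator_continuous[OF _ ab(1,2)] continuous_intros r' ac_deriv_continuous[OF u])
  let ?h = "\<lambda>x. indicator {a..b} x * u' x" and ?k = "\<lambda>x. indicator {a..b} x * r' x"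
  let ?\<kappa> = "\<lambda>t s::real. if t \<le> s then 1 else 0 :: real"
  have hi: "integrable lborel ?h" using ac_derivD(1)[OF u ab] .
  have ki: "integrable lborel ?k" using ac_derivD(1)[OF acr ab] .
  have mh: "?h \<in> borel_measurable borel" using borel_measurable_integrable[OF hi] by simp
  have m\<kappa>: "(\<lambda>(t, s). ?\<kappa> t s) \<in> borel_measurable (borel \<Otimes>\<^sub>M borel)"
    by measurable
  note [measurable] = borel_measurable_integrable[OF hi] borel_measurable_integrable[OF ki]
  have hk: "integrable lborel (\<lambda>t. \<bar>?h t\<bar> * (LINT s|lborel. \<bar>?\<kappa> t s * ?k s\<bar>))"
  proof (rule Bochner_Integration.integrable_bound)
    show "integrable lborel (\<lambda>t. (LINT s|lborel. \<bar>?k s\<bar>) * ?h t)"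
      using hi by simp
    show "(\<lambda>t. \<bar>?h t\<bar> * (LINT s|lborel. \<bar>?\<kappa> t s * ?k s\<bar>)) \<in> borel_measurable lborel"
    proof -
      have "(\<lambda>t. LINT s|lborel. \<bar>?\<kappa> t s * ?k s\<bar>) \<in> borel_measurable lborel"
        by (intro lborel.borel_measurable_lebesgue_integral) measurable
      then show ?thesis using borel_measurable_integrable[OF hi] by measurable
    qed
    have "(LINT s|lborel. \<bar>?\<kappa> t s * ?k s\<bar>) \<le> (LINT s|lborel. \<bar>?k s\<bar>)" for t
    proof (rule integral_mono')
      show "integrable lborel (\<lambda>s. \<bar>?k s\<bar>)" using ki by (rule integrable_abs)
    qed (auto simp: indicator_def)
    then show "AE t in lborel. norm (\<bar>?h t\<bar> * (LINT s|lborel. \<bar>?\<kappa> t s * ?k s\<bar>))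
        \<le> norm ((LINT s|lborel. \<bar>?k s\<bar>) * ?h t)"
      by (intro always_eventually allI) (auto simp add: abs_mult mult.commute intro!: mult_left_mono)
  qed
  have F: "(LINT s|lborel. ?k s * (LINT t|lborel. ?\<kappa> t s * ?h t))
          = (LINT t|lborel. ?h t * (LINT s|lborel. ?\<kappa> t s * ?k s))"
    by (rule fubini_kernel(2)[OF mh ki m\<kappa> _ hk]) auto
  have L: "?k s * (LINT t|lborel. ?\<kappa> t s * ?h t) = indicator {a..b} s * (u s * r' s) - u a * ?k s" for s
  proof (cases "s \<in> {a..b}")
    case True
    then have "(LINT t|lborel. ?\<kappa> t s * ?h t) = (LINT t|lborel. indicator {a..s} t * u' t)"
      by (intro Bochner_Integration.integral_cong) (auto simp: indicator_def)
    also have "\<dots> = u s - u a" using True sub ab by (intro ac_derivD(2)[OF u]) auto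
    finally have I: "(LINT t|lborel. ?\<kappa> t s * ?h t) = u s - u a" .
    show ?thesis unfolding I using True by (simp add: algebra_simps)
  qed auto
  have R: "?h t * (LINT s|lborel. ?\<kappa> t s * ?k s) = r b * ?h t - indicator {a..b} t * (u' t * r t)" for t
  proof (cases "t \<in> {a..b}")
    case True
    then have "(LINT s|lborel. ?\<kappa> t s * ?k s) = (LINT s|lborel. indicator {t..b} s * r' s)"
      by (intro Bochner_Integration.integral_cong) (auto simp: indicator_def)
    also have "\<dots> = r b - r t" using True sub ab by (intro ac_derivD(2)[OF acr]) auto
    finally have I: "(LINT s|lborel. ?\<kappa> t s * ?k s) = r b - r t" .
    show ?thesis unfolding I using True by (simp add: algebra_simps)
  qed auto
  have "(LINT x|lborel. indicator {a..b} x * (u x * r' x)) - u a * (r b - r a)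
      = r b * (u b - u a) - (LINT x|lborel. indicator {a..b} x * (u' x * r x))"
    using F unfolding L R
    by (simp add: i1 i2 hi ki ac_derivD(2)[OF u ab] ac_derivD(2)[OF acr ab])
  then show "integrable lborel (\<lambda>x. indicator {a..b} x * (u' x * r x + u x * r' x)) \<and>
        u b * r b - u a * r a = (LINT x|lborel. indicator {a..b} x * (u' x * r x + u x * r' x))"
    using i1 i2 by (simp add: distrib_left algebra_simps)
qed

text \<open>Finite measures that agree on half-lines are equal. Applied to the measures with
  densities the positive and negative parts of \<open>h\<close>, this makes the two parts equal
  almost everywhere, hence zero.\<close>

lemma interval_integrals_zero_imp_AE_zero:
  fixes h :: "real \<Rightarrow> real"
  assumes h: "integrable lborel h" and z: "\<And>a. (LINT x|lborel. indicator {a<..} x * h x) = 0"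
  shows "AE x in lborel. h x = 0"
proof -
  let ?p = "\<lambda>x. max 0 (h x)" and ?n = "\<lambda>x. max 0 (- h x)"
  have [measurable]: "h \<in> borel_measurable borel"
    using borel_measurable_integrable[OF h] by simp
  have ip: "integrable lborel ?p" and "in": "integrable lborel ?n" using h by auto
  have em: "emeasure (density lborel (\<lambda>x. ennreal (g x))) {a<..}
      = ennreal (LINT x|lborel. indicator {a<..} x * g x)"
    if "integrable lborel g" "\<And>x. 0 \<le> g x" for g :: "real \<Rightarrow> real" and a
  proof -
    have [measurable]: "g \<in> borel_measurable borel"
      using borel_measurable_integrable[OF that(1)] by simp
    have "emeasure (density lborel (\<lambda>x. ennreal (g x))) {a<..}
        = (\<integral>\<^sup>+x. ennreal (indicator {a<..} x * g x) \<partial>lborel)"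
      by (subst emeasure_density) (auto intro!: nn_integral_cong simp: indicator_def)
    also have "\<dots> = ennreal (LINT x|lborel. indicator {a<..} x * g x)"
      using that by (intro nn_integral_eq_integral)
        (auto intro!: integrable_real_mult_indicator simp: mult.commute)
    finally show ?thesis .
  qed
  have eq: "(LINT x|lborel. indicator {a<..} x * ?p x) = (LINT x|lborel. indicator {a<..} x * ?n x)" for a
  proof -
    have i: "integrable lborel (\<lambda>x. indicator {a<..} x * ?p x)" "integrable lborel (\<lambda>x. indicator {a<..} x * ?n x)"
      using integrable_real_mult_indicator[OF _ ip, of "{a<..}"] integrable_real_mult_indicator[OF _ "in", of "{a<..}"]
      by (simp_all add: mult.commute)
    have "(LINT x|lborel. indicator {a<..} x * ?p x) - (LINT x|lborel. indicator {a<..} x * ?n x)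
        = (LINT x|lborel. indicator {a<..} x * ?p x - indicator {a<..} x * ?n x)"
      using i by simp
    also have "\<dots> = (LINT x|lborel. indicator {a<..} x * h x)"
      by (intro Bochner_Integration.integral_cong) (auto simp: indicator_def)
    finally show ?thesis using z by simp
  qed
  have "density lborel (\<lambda>x. ennreal (?p x)) = density lborel (\<lambda>x. ennreal (?n x))"
    by (rule measure_eqI_lessThan) (simp_all only: em[OF ip] em[OF "in"] eq sets_density sets_lborel, auto)
  then have "AE x in lborel. ennreal (?p x) = ennreal (?n x)"
    by (subst (asm) sigma_finite_measure.density_unique_iff[OF sigma_finite_lborel]) auto
  then show ?thesis by eventually_elim (auto simp: max_def split: if_splits)
qed

text \<open>Every integral of \<open>u'\<close> over a subinterval is an increment of
  \<open>u\<close>, hence zero, and countably many compact pieces cover the interval. It carries the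
  vanishing of a function over to a derivative that exists only almost everywhere.\<close>

lemma ac_deriv_zero:
  assumes u: "ac_deriv (einterval \<alpha> \<omega>) u u'" and "\<alpha> < \<omega>" and z: "\<And>x. x \<in> einterval \<alpha> \<omega> \<Longrightarrow> u x = 0"
  shows "AE x in lborel. x \<in> einterval \<alpha> \<omega> \<longrightarrow> u' x = 0"
proof -
  obtain a b :: "nat \<Rightarrow> real" where ab: "einterval \<alpha> \<omega> = (\<Union>i. {a i..b i})" "incseq (\<lambda>i. {a i..b i})"
    and mem: "\<And>i. a i \<in> einterval \<alpha> \<omega>" "\<And>i. b i \<in> einterval \<alpha> \<omega>" and le: "\<And>i. a i \<le> b i"
    by (rule einterval_exhaustion[OF assms(2)]) (rule that; assumption)
  have "AE x in lborel. indicator {a i..b i} x * u' x = 0" for i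
  proof (rule interval_integrals_zero_imp_AE_zero)
    have sub: "{a i..b i} \<subseteq> einterval \<alpha> \<omega>" using mem by (intro einterval_Icc_subset)
    show "integrable lborel (\<lambda>x. indicator {a i..b i} x * u' x)"
      using ac_derivD(1)[OF u mem le] .
    fix c
    show "(LINT x|lborel. indicator {c<..} x * (indicator {a i..b i} x * u' x)) = 0"
    proof (cases "c < b i")
      case True
      let ?d = "max c (a i)"
      have d: "?d \<in> {a i..b i}" using True le[of i] by auto
      have "(LINT x|lborel. indicator {c<..} x * (indicator {a i..b i} x * u' x))
          = (LINT x|lborel. indicator {?d..b i} x * u' x)"
        by (rule integral_discrete_difference[where X="{c}"]) (auto simp: indicator_def)
      also have "\<dots> = u (b i) - u ?d"
        using d by (intro ac_derivD(2)[OF u] subsetD[OF sub d] mem) auto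
      also have "\<dots> = 0" using z[OF subsetD[OF sub d]] z[OF mem(2)] by simp
      finally show ?thesis .
    next
      case False
      then have "(\<lambda>x. indicator {c<..} x * (indicator {a i..b i} x * u' x)) = (\<lambda>x. 0)"
        by (auto simp: indicator_def fun_eq_iff)
      then show ?thesis by simp
    qed
  qed
  then have "AE x in lborel. \<forall>i. indicator {a i..b i} x * u' x = 0"
    unfolding AE_all_countable by blast
  then show ?thesis
    by eventually_elim (force simp: ab(1) indicator_def)
qed

lemma has_real_derivative_cumulative:
  assumes \<phi>: "integrable lborel \<phi>" and c: "continuous_on (einterval \<alpha> \<omega>) \<phi>" and x: "x \<in> einterval \<alpha> \<omega>"
  shows "((\<lambda>x. LINT t|lborel. indicator {..x} t * \<phi> t) has_real_derivative \<phi> x) (at x)"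
proof -
  obtain a b where ab: "a \<in> einterval \<alpha> \<omega>" "b \<in> einterval \<alpha> \<omega>" "a < x" "x < b"
    "{a..b} \<subseteq> einterval \<alpha> \<omega>" using einterval_nbhd[OF x] by blast
  have cab: "continuous_on {a..b} \<phi>" using continuous_on_subset[OF c ab(5)] .
  let ?F = "\<lambda>x. LINT t|lborel. indicator {..x} t * \<phi> t"
  have int: "integrable lborel (\<lambda>t. indicator S t * \<phi> t)" if "S \<in> sets borel" for S
    using integrable_mult_indicator[OF _ \<phi>, of S] that by simp
  have eq: "?F y = (LINT t|lborel. indicator {..<a} t * \<phi> t) + integral {a..y} \<phi>" if "y \<in> {a..b}" for y
  proof -
    have "set_integrable lborel {a..y} \<phi>" using int[of "{a..y}"] by (simp add: set_integrable_def)
    from set_borel_integral_eq_integral(2)[OF this]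
    have "integral {a..y} \<phi> = (LINT t|lborel. indicator {a..y} t * \<phi> t)"
      by (simp add: set_lebesgue_integral_def)
    then have "(LINT t|lborel. indicator {..<a} t * \<phi> t) + integral {a..y} \<phi>
        = (LINT t|lborel. indicator {..<a} t * \<phi> t + indicator {a..y} t * \<phi> t)"
      using int[of "{..<a}"] int[of "{a..y}"] by simp
    also have "\<dots> = ?F y" using that
      by (intro Bochner_Integration.integral_cong) (auto simp: indicator_def)
    finally show ?thesis by simp
  qed
  have "((\<lambda>y. integral {a..y} \<phi>) has_real_derivative \<phi> x) (at x within {a..b})"
    by (rule integral_has_real_derivative[OF cab]) (use ab(3,4) in auto)
  then have "((\<lambda>y. integral {a..y} \<phi>) has_real_derivative \<phi> x) (at x within {a<..<b})"
    by (rule DERIV_subset) auto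
  then have "((\<lambda>y. integral {a..y} \<phi>) has_real_derivative \<phi> x) (at x)"
    using at_within_open[of x "{a<..<b}"] ab(3,4) by simp
  then have D: "((\<lambda>y. (LINT t|lborel. indicator {..<a} t * \<phi> t) + integral {a..y} \<phi>) has_real_derivative \<phi> x) (at x)"
    using DERIV_add[OF DERIV_const[of "LINT t|lborel. indicator {..<a} t * \<phi> t"]] by simp
  show ?thesis
  proof (rule has_field_derivative_transform_within_open[OF D])
    show "open {a<..<b}" "x \<in> {a<..<b}" using ab(3,4) by auto
    fix y assume "y \<in> {a<..<b}"
    then have "y \<in> {a..b}" by auto
    then show "(LINT t|lborel. indicator {..<a} t * \<phi> t) + integral {a..y} \<phi> = ?F y"
      by (rule eq[symmetric])
  qed
qed

text \<open>Monotone convergence along a compact exhaustion. It turns the energy bound of the dual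
  function on compact pieces into one on the whole interval.\<close>

lemma integrable_of_bounded_integrals:
  fixes F :: "real \<Rightarrow> real"
  assumes "\<alpha> < \<omega>" and F: "continuous_on (einterval \<alpha> \<omega>) F" "\<And>x. x \<in> einterval \<alpha> \<omega> \<Longrightarrow> 0 \<le> F x"
    and z: "\<And>x. x \<notin> einterval \<alpha> \<omega> \<Longrightarrow> F x = 0"
    and C: "\<And>a b. a \<in> einterval \<alpha> \<omega> \<Longrightarrow> b \<in> einterval \<alpha> \<omega> \<Longrightarrow> a \<le> b
          \<Longrightarrow> (LINT x|lborel. indicator {a..b} x * F x) \<le> C"
  shows "integrable lborel F" "(LINT x|lborel. F x) \<le> C"
proof -
  obtain a b :: "nat \<Rightarrow> real" where ab: "einterval \<alpha> \<omega> = (\<Union>i. {a i..b i})" "incseq (\<lambda>i. {a i..b i})"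
    and mem: "\<And>i. a i \<in> einterval \<alpha> \<omega>" "\<And>i. b i \<in> einterval \<alpha> \<omega>" and le: "\<And>i. a i \<le> b i"
    by (rule einterval_exhaustion[OF assms(1)]) (rule that; assumption)
  have F0: "0 \<le> F x" for x using F(2) z by (cases "x \<in> einterval \<alpha> \<omega>") auto
  have nest: "{a i..b i} \<subseteq> {a j..b j}" if "i \<le> j" for i j
    using ab(2) that by (auto simp: incseq_def)
  let ?f = "\<lambda>i x. indicator {a i..b i} x * F x"
  have fi: "integrable lborel (?f i)" for i
    by (rule integrable_indicator_continuous[OF F(1) mem])
  have mono: "mono (\<lambda>i. ?f i x)" for x
  proof (rule monoI)
    fix i j :: nat assume "i \<le> j"
    then show "?f i x \<le> ?f j x" using nest[of i j] F0[of x] by (auto simp: indicator_def)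
  qed
  have lim: "(\<lambda>i. ?f i x) \<longlonglongrightarrow> F x" for x
  proof -
    have "(\<lambda>i. ?f i x) \<longlonglongrightarrow> indicator (\<Union>i. {a i..b i}) x * F x"
      by (intro tendsto_mult tendsto_const LIMSEQ_indicator_incseq) (rule ab(2))
    then show ?thesis using z[of x] by (cases "x \<in> einterval \<alpha> \<omega>") (auto simp: ab(1)[symmetric])
  qed
  have bd: "(LINT x|lborel. ?f i x) \<le> C" for i using C[OF mem le] .
  have "incseq (\<lambda>i. LINT x|lborel. ?f i x)"
    using mono by (auto simp: incseq_def mono_def intro!: integral_mono fi)
  then obtain L where L: "(\<lambda>i. LINT x|lborel. ?f i x) \<longlonglongrightarrow> L"
    using bd by (auto elim!: incseq_convergent)
  have mF: "F \<in> borel_measurable lborel"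
  proof -
    have "(\<lambda>x. indicator (einterval \<alpha> \<omega>) x * F x) = F" using z by (auto simp: fun_eq_iff indicator_def)
    then show ?thesis using continuous_measurable[OF F(1)] by simp
  qed
  have mono': "AE x in lborel. mono (\<lambda>i. ?f i x)" and lim': "AE x in lborel. (\<lambda>i. ?f i x) \<longlonglongrightarrow> F x"
    and pos: "AE x in lborel. 0 \<le> ?f i x" for i
    using mono lim F0 by simp_all
  show "integrable lborel F"
    by (rule integral_monotone_convergence_nonneg(1)[OF fi mono' pos lim' L mF])
  have "(LINT x|lborel. F x) = L"
    by (rule integral_monotone_convergence_nonneg(2)[OF fi mono' pos lim' L mF])
  moreover have "L \<le> C" using bd by (intro LIMSEQ_le_const2[OF L]) auto
  ultimately show "(LINT x|lborel. F x) \<le> C" by simp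
qed

lemma ac_deriv_cumulative:
  assumes \<phi>: "integrable lborel \<phi>"
  shows "ac_deriv J (\<lambda>x. LINT t|lborel. indicator {..x} t * \<phi> t) \<phi>"
  unfolding ac_deriv_def
proof (intro ballI impI conjI)
  fix a b :: real assume ab: "a \<le> b"
  have int: "integrable lborel (\<lambda>t. indicator S t * \<phi> t)" if "S \<in> sets borel" for S
    using integrable_mult_indicator[OF _ \<phi>, of S] that by simp
  show i: "integrable lborel (\<lambda>t. indicator {a..b} t * \<phi> t)" using int[of "{a..b}"] by simp
  have "(LINT t|lborel. indicator {..b} t * \<phi> t) - (LINT t|lborel. indicator {..a} t * \<phi> t)
      = (LINT t|lborel. indicator {..b} t * \<phi> t - indicator {..a} t * \<phi> t)"
    using int[of "{..a}"] int[of "{..b}"] by simp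
  also have "\<dots> = (LINT t|lborel. indicator {a..b} t * \<phi> t)"
    by (rule integral_discrete_difference[where X="{a}"]) (use ab in \<open>auto simp: indicator_def\<close>)
  finally show "(LINT t|lborel. indicator {..b} t * \<phi> t) - (LINT t|lborel. indicator {..a} t * \<phi> t)
      = (LINT t|lborel. indicator {a..b} t * \<phi> t)" .
qed

text \<open>Subtracting \<open>u t\<close> makes the truncation at \<open>t\<close> continuous, so
  it stays absolutely continuous. A statement about the whole interval can then be applied to it to
  obtain one about \<open>{..t}\<close>.\<close>

lemma ac_deriv_stop:
  assumes u: "ac_deriv J u u'" and t: "t \<in> J"
  shows "ac_deriv J (\<lambda>x. if x \<le> t then u x - u t else 0) (\<lambda>x. indicator {..t} x * u' x)"
  unfolding ac_deriv_def
proof (intro ballI impI)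
  fix a b assume ab: "a \<in> J" "b \<in> J" "a \<le> b"
  have m: "min b t \<in> J" using ab(2) t by (simp add: min_def)
  have *: "(\<lambda>x. indicator {a..b} x * (indicator {..t} x * u' x)) = (\<lambda>x. indicator {a..min b t} x * u' x)"
    by (auto simp: fun_eq_iff indicator_def)
  show "integrable lborel (\<lambda>x. indicator {a..b} x * (indicator {..t} x * u' x)) \<and>
    (if b \<le> t then u b - u t else 0) - (if a \<le> t then u a - u t else 0) =
      (LINT x|lborel. indicator {a..b} x * (indicator {..t} x * u' x))"
  proof (cases "a \<le> t")
    case True
    then show ?thesis
      unfolding * using ac_derivD[OF u ab(1) m] ab(3) by (simp add: min_def)
  next
    case False
    then show ?thesis unfolding * using ab(3) by simp
  qed
qed

lemma ac_deriv_antiderivative: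
  assumes i: "\<And>a b. a \<in> J \<Longrightarrow> b \<in> J \<Longrightarrow> integrable lborel (\<lambda>x. indicator {a..b} x * \<phi> x :: real)" and c: "c \<in> J"
  obtains s where "ac_deriv J s \<phi>"
proof
  let ?D = "\<lambda>a b. LINT x|lborel. indicator {a..b} x * \<phi> x"
  have add: "?D a d = ?D a b + ?D b d" if "a \<in> J" "b \<in> J" "d \<in> J" "a \<le> b" "b \<le> d" for a b d
  proof -
    have "?D a b + ?D b d = (LINT x|lborel. indicator {a..b} x * \<phi> x + indicator {b..d} x * \<phi> x)"
      using i that by simp
    also have "\<dots> = ?D a d"
      by (rule integral_discrete_difference[where X="{b}"]) (use that in \<open>auto simp: indicator_def\<close>)
    finally show ?thesis by simp
  qed
  show "ac_deriv J (\<lambda>x. if c \<le> x then ?D c x else - ?D x c) \<phi>"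
    unfolding ac_deriv_def
  proof (intro ballI impI conjI i)
    fix a b assume "a \<in> J" "b \<in> J" "a \<le> b"
    then show "(if c \<le> b then ?D c b else - ?D b c) - (if c \<le> a then ?D c a else - ?D a c) = ?D a b"
      using add[of c a b] add[of a c b] add[of a b c] c by auto
  qed
qed

text \<open>Cauchy-Schwarz against the constant 1, read off from the nonnegative integral of
  \<open>(u' - m)^2\<close>, where \<open>m\<close> is the mean slope on
  \<open>{a..b}\<close>.\<close>

lemma ac_deriv_square_le:
  assumes u: "ac_deriv J u u'" and s: "ac_deriv J s (\<lambda>x. (u' x)\<^sup>2)" and ab: "a \<in> J" "b \<in> J" "a \<le> b"
  shows "(u b - u a)\<^sup>2 \<le> (b - a) * (s b - s a)"
proof (cases "a = b")
  case False
  then have l: "0 < b - a" using ab by simp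
  define m where "m = (u b - u a) / (b - a)"
  have i0: "has_bochner_integral lborel (\<lambda>x. indicator {a..b} x * m\<^sup>2) ((b - a) * m\<^sup>2)"
    using ab(3) by (simp add: has_bochner_integral_iff)
  have i1: "has_bochner_integral lborel (\<lambda>x. indicator {a..b} x * u' x) (u b - u a)"
    using ac_derivD[OF u ab] by (simp add: has_bochner_integral_iff)
  have i2: "has_bochner_integral lborel (\<lambda>x. indicator {a..b} x * (u' x)\<^sup>2) (s b - s a)"
    using ac_derivD[OF s ab] by (simp add: has_bochner_integral_iff)
  have "has_bochner_integral lborel
      (\<lambda>x. indicator {a..b} x * (u' x)\<^sup>2 - 2 * m * (indicator {a..b} x * u' x) + indicator {a..b} x * m\<^sup>2)
      ((s b - s a) - 2 * m * (u b - u a) + (b - a) * m\<^sup>2)"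
    by (intro has_bochner_integral_add has_bochner_integral_diff has_bochner_integral_mult_right i0 i1 i2)
  moreover have "(\<lambda>x. indicator {a..b} x * (u' x)\<^sup>2 - 2 * m * (indicator {a..b} x * u' x) + indicator {a..b} x * m\<^sup>2)
      = (\<lambda>x. indicator {a..b} x * (u' x - m)\<^sup>2)"
    by (auto simp: fun_eq_iff power2_eq_square algebra_simps)
  ultimately have "(s b - s a) - 2 * m * (u b - u a) + (b - a) * m\<^sup>2 = (LINT x|lborel. indicator {a..b} x * (u' x - m)\<^sup>2)"
    by (simp add: has_bochner_integral_iff)
  also have "\<dots> \<ge> 0" by (intro integral_nonneg_AE) auto
  finally have "0 \<le> (b - a) * ((s b - s a) - 2 * m * (u b - u a) + (b - a) * m\<^sup>2)" using l by simp
  also have "\<dots> = (b - a) * (s b - s a) - (u b - u a)\<^sup>2"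
  proof -
    have "(b - a) * m = u b - u a" using l by (simp add: m_def)
    then have "(b - a) * (2 * m * (u b - u a)) = 2 * (u b - u a)\<^sup>2" "(b - a) * ((b - a) * m\<^sup>2) = (u b - u a)\<^sup>2"
      by (simp_all add: power2_eq_square) (metis mult.commute mult.left_commute)+
    then show ?thesis by (simp add: algebra_simps)
  qed
  finally show ?thesis by simp
qed simp

definition pearson_op :: "real \<Rightarrow> real \<Rightarrow> real \<Rightarrow> real \<Rightarrow> real \<Rightarrow> real poly \<Rightarrow> real poly" where
  "pearson_op \<delta> \<beta> \<gamma> A B r = [:\<gamma>, \<beta>, \<delta>:] * pderiv (pderiv r) + [:A, - B:] * pderiv r"

lemma poly_qpoly: "poly [:\<gamma>, \<beta>, \<delta>:] x = qpoly \<delta> \<beta> \<gamma> x"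
  by (simp add: qpoly_def power2_eq_square algebra_simps)

lemma integrable_poly_mult:
  fixes h :: "real \<Rightarrow> real"
  assumes "\<And>j. j \<le> degree r \<Longrightarrow> integrable lborel (\<lambda>x. x ^ j * h x)"
  shows "integrable lborel (\<lambda>x. poly r x * h x)"
proof -
  have "integrable lborel (\<lambda>x. \<Sum>j\<le>degree r. coeff r j * (x ^ j * h x))"
    by (intro Bochner_Integration.integrable_sum integrable_mult_right assms) auto
  then show ?thesis by (simp add: poly_altdef sum_distrib_right mult.assoc)
qed

section \<open>Pearson weights\<close>

text \<open>
  The last two assumptions say that \<open>(q w)' = (A - B x) w\<close> and that \<open>q w\<close> vanishes at both ends of the
  interval. The density itself has \<open>A = \<mu>\<close>, \<open>B = 1\<close>; multiplying the weight by \<open>q\<close> turns \<open>(A, B)\<close>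
  into \<open>(A + \<beta>, B - 2 \<delta>)\<close>.
\<close>

locale pearson_weight =
  fixes \<alpha> \<omega> :: ereal and \<delta> \<beta> \<gamma> A B :: real and w :: "real \<Rightarrow> real"
  assumes ivl: "\<alpha> < \<omega>" and \<delta>: "\<delta> \<le> 0" and B: "0 < B"
    and q_pos: "x \<in> einterval \<alpha> \<omega> \<Longrightarrow> 0 < qpoly \<delta> \<beta> \<gamma> x"
    and w_pos: "x \<in> einterval \<alpha> \<omega> \<Longrightarrow> 0 < w x"
    and w_zero: "x \<notin> einterval \<alpha> \<omega> \<Longrightarrow> w x = 0"
    and w_int: "integrable lborel w" and xw_int: "integrable lborel (\<lambda>x. x * w x)"
    and cum: "x \<in> einterval \<alpha> \<omega> \<Longrightarrow>
      (LINT t|lborel. indicator {..x} t * ((A - B * t) * w t)) = qpoly \<delta> \<beta> \<gamma> x * w x"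
    and total: "(LINT t|lborel. (A - B * t) * w t) = 0"
begin

abbreviation "J \<equiv> einterval \<alpha> \<omega>"
abbreviation "q \<equiv> qpoly \<delta> \<beta> \<gamma>"
abbreviation "c \<equiv> A / B"

lemma w_nonneg: "0 \<le> w x"
  using w_pos[of x] w_zero[of x] by (cases "x \<in> J") auto

lemma qw_nonneg: "0 \<le> q x * w x"
  using q_pos[of x] w_nonneg[of x] w_zero[of x] by (cases "x \<in> J") auto

lemma continuous_q: "continuous_on S q"
  unfolding qpoly_def by (intro continuous_intros)

lemma \<tau>w_int: "integrable lborel (\<lambda>t. (A - B * t) * w t)"
proof -
  have "integrable lborel (\<lambda>t. A * w t - B * (t * w t))" using w_int xw_int by simp
  then show ?thesis by (simp add: algebra_simps)
qed

text \<open>The regularity of the weight comes entirely from \<open>cum\<close>: on \<open>J\<close>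
  the product \<open>q w\<close> equals a cumulative integral and is continuous; dividing by
  \<open>q\<close> makes \<open>w\<close> continuous, and then the cumulative integral is
  differentiable.\<close>

lemma continuous_qw: "continuous_on J (\<lambda>x. q x * w x)"
  by (rule continuous_on_cong[THEN iffD1, OF refl _ ac_deriv_continuous[OF ac_deriv_cumulative[OF \<tau>w_int]]])
     (rule cum)

lemma continuous_w: "continuous_on J w"
proof -
  have "continuous_on J (\<lambda>x. q x * w x / q x)"
    using q_pos by (intro continuous_on_divide continuous_qw continuous_q) force
  moreover have "q x * w x / q x = w x" if "x \<in> J" for x using q_pos[OF that] by simp
  ultimately show ?thesis by (simp cong: continuous_on_cong)
qed

lemma qw_deriv: "x \<in> J \<Longrightarrow> ((\<lambda>x. q x * w x) has_real_derivative (A - B * x) * w x) (at x)"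
  by (rule has_field_derivative_transform_within_open[OF has_real_derivative_cumulative[OF \<tau>w_int]])
     (auto intro!: continuous_intros continuous_w simp: cum)

lemma upper_tail:
  fixes h :: "real \<Rightarrow> real"
  assumes h: "integrable lborel h"
  shows "(LINT s|lborel. indicator {t..} s * h s) = (LINT s|lborel. h s) - (LINT s|lborel. indicator {..t} s * h s)"
proof -
  have i: "integrable lborel (\<lambda>t. indicator S t * h t)" if "S \<in> sets borel" for S
    using integrable_mult_indicator[OF _ h, of S] that by simp
  have "(LINT s|lborel. h s) - (LINT s|lborel. indicator {..t} s * h s)
      = (LINT s|lborel. h s - indicator {..t} s * h s)"
    using i[of "{..t}"] h by (subst Bochner_Integration.integral_diff) simp_all
  also have "\<dots> = (LINT s|lborel. indicator {t..} s * h s)"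
    by (rule integral_discrete_difference[where X="{t}"]) (auto simp: indicator_def)
  finally show ?thesis by simp
qed

lemma qw_upper: "t \<in> J \<Longrightarrow> (LINT s|lborel. indicator {t..} s * ((A - B * s) * w s)) = - (q t * w t)"
  using upper_tail[OF \<tau>w_int, of t] total cum[of t] by simp

text \<open>\<open>c\<close> is the mean of the normalised weight. If it lay outside
  \<open>J\<close>, then \<open>A - B x\<close> would have constant sign on \<open>J\<close>, and
  the integral from one of the two ends would have the wrong sign for
  \<open>q w > 0\<close>.\<close>

lemma c_in_J: "c \<in> J"
proof (rule ccontr)
  assume "c \<notin> J"
  obtain x where x: "x \<in> J" using einterval_nonempty[OF ivl] by blast
  have pos: "0 < q x * w x" using q_pos[OF x] w_pos[OF x] by simp
  show False
  proof (cases "c < x")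
    case True
    have "A - B * y \<le> 0" if "y \<in> J" for y
    proof -
      have "\<not> y \<le> c" using subsetD[OF einterval_Icc_subset[OF that x], of c] True \<open>c \<notin> J\<close> by fastforce
      then show ?thesis using B by (simp add: field_simps)
    qed
    then have "(A - B * y) * w y \<le> 0" for y
      using w_nonneg[of y] w_zero[of y] by (cases "y \<in> J") (auto simp: mult_nonpos_nonneg)
    then have "(LINT t|lborel. - (indicator {..x} t * ((A - B * t) * w t))) \<ge> 0"
      by (intro integral_nonneg_AE) (auto simp: indicator_def)
    then show False using cum[OF x] pos by simp
  next
    case False
    have "A - B * y \<ge> 0" if "y \<in> J" for y
    proof -
      have "\<not> y \<ge> c" using subsetD[OF einterval_Icc_subset[OF x that], of c] False \<open>c \<notin> J\<close> by fastforce
      then show ?thesis using B by (simp add: field_simps)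
    qed
    then have "(A - B * y) * w y \<ge> 0" for y
      using w_nonneg[of y] w_zero[of y] by (cases "y \<in> J") auto
    then have "(LINT t|lborel. indicator {x..} t * ((A - B * t) * w t)) \<ge> 0"
      by (intro integral_nonneg_AE) (auto simp: indicator_def)
    then show False using qw_upper[OF x] pos by simp
  qed
qed

text \<open>Fubini for the kernel \<open>\<kappa>\<close> with \<open>u x - u c = \<integral> \<kappa> t x * u' t\<close>: its integral against the other variable
  is the cumulative integral of \<open>(A - B x) w\<close> from the nearer end, so no boundary terms arise.\<close>

lemma stein:
  assumes u: "ac_deriv J u u'" and i: "integrable lborel (\<lambda>x. u' x * (q x * w x))"
  shows "integrable lborel (\<lambda>x. u x * ((A - B * x) * w x))"
    and "(LINT x|lborel. u' x * (q x * w x)) = - (LINT x|lborel. u x * ((A - B * x) * w x))"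
proof -
  let ?h = "\<lambda>t. indicator J t * u' t" and ?k = "\<lambda>s. (A - B * s) * w s"
  let ?\<kappa> = "\<lambda>t s. (if c < t \<and> t \<le> s then 1 else 0) - (if s \<le> t \<and> t \<le> c then 1 else 0) :: real"
  have \<tau>neg: "A - B * s \<le> 0" if "c \<le> s" for s using that B by (simp add: field_simps)
  have \<tau>pos: "A - B * s \<ge> 0" if "s \<le> c" for s using that B by (simp add: field_simps)
  have \<kappa>k: "(LINT s|lborel. ?\<kappa> t s * ?k s) = - (q t * w t)"
    and abs_\<kappa>k: "(LINT s|lborel. \<bar>?\<kappa> t s * ?k s\<bar>) = q t * w t" if t: "t \<in> J" for t
  proof -
    have "(\<lambda>s. ?\<kappa> t s * ?k s) = (if c < t then (\<lambda>s. indicator {t..} s * ?k s) else (\<lambda>s. - (indicator {..t} s * ?k s)))"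
      by (auto simp: fun_eq_iff indicator_def)
    then show "(LINT s|lborel. ?\<kappa> t s * ?k s) = - (q t * w t)"
      using qw_upper[OF t] cum[OF t] by simp
    \<comment> \<open>\<open>?\<kappa>\<close> is positive only for \<open>s > c\<close> and
      negative only for \<open>s \<le> c\<close>, which is opposite to the sign of
      \<open>A - B s\<close>. The product is therefore never positive, and the absolute integral
      that Fubini requires is exactly \<open>q t * w t\<close>.\<close>
    have "\<bar>?\<kappa> t s * ?k s\<bar> = - (?\<kappa> t s * ?k s)" for s
      using \<tau>neg[of s] \<tau>pos[of s] w_nonneg[of s] mult_nonpos_nonneg[of "A - B * s" "w s"]
        mult_nonneg_nonneg[of "A - B * s" "w s"] by auto
    then show "(LINT s|lborel. \<bar>?\<kappa> t s * ?k s\<bar>) = q t * w t"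
      using \<open>(LINT s|lborel. ?\<kappa> t s * ?k s) = - (q t * w t)\<close> by simp
  qed
  have mh: "?h \<in> borel_measurable borel" by (rule ac_deriv_measurable[OF u ivl])
  have m\<kappa>: "(\<lambda>(t, s). ?\<kappa> t s) \<in> borel_measurable (borel \<Otimes>\<^sub>M borel)" by measurable
  have b\<kappa>: "\<bar>?\<kappa> t s\<bar> \<le> 1" for t s by auto
  have "\<bar>?h t\<bar> * (LINT s|lborel. \<bar>?\<kappa> t s * ?k s\<bar>) = \<bar>u' t * (q t * w t)\<bar>" for t
  proof (cases "t \<in> J")
    case True
    then show ?thesis unfolding abs_\<kappa>k[OF True] abs_mult[of "u' t"] abs_of_nonneg[OF qw_nonneg] by simp
  qed (simp add: w_zero)
  then have hk: "integrable lborel (\<lambda>t. \<bar>?h t\<bar> * (LINT s|lborel. \<bar>?\<kappa> t s * ?k s\<bar>))"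
    using i by simp
  note F = fubini_kernel[OF mh \<tau>w_int m\<kappa> b\<kappa> hk]
  have L: "?k s * (LINT t|lborel. ?\<kappa> t s * ?h t) = u s * ?k s - u c * ?k s" for s
  proof (cases "s \<in> J")
    case True
    have I: "(LINT t|lborel. ?\<kappa> t s * ?h t) = u s - u c"
    proof (cases "c < s")
      case cs: True
      have "(LINT t|lborel. ?\<kappa> t s * ?h t) = (LINT t|lborel. indicator {c..s} t * u' t)"
        by (rule integral_discrete_difference[where X="{c}"])
           (use cs einterval_Icc_subset[OF c_in_J True] in \<open>auto simp: indicator_def subset_iff\<close>)
      then show ?thesis using ac_derivD(2)[OF u c_in_J True] cs by simp
    next
      case False
      have "(LINT t|lborel. ?\<kappa> t s * ?h t) = (LINT t|lborel. - (indicator {s..c} t * u' t))"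
        by (rule Bochner_Integration.integral_cong)
           (use False einterval_Icc_subset[OF True c_in_J] in \<open>auto simp: indicator_def subset_iff\<close>)
      then show ?thesis using ac_derivD(2)[OF u True c_in_J] False by simp
    qed
    show ?thesis unfolding I by (simp add: algebra_simps)
  qed (simp add: w_zero)
  have R: "?h t * (LINT s|lborel. ?\<kappa> t s * ?k s) = - (u' t * (q t * w t))" for t
  proof (cases "t \<in> J")
    case True
    then show ?thesis unfolding \<kappa>k[OF True] by simp
  qed (simp add: w_zero)
  have "integrable lborel (\<lambda>s. (u s * ?k s - u c * ?k s) + u c * ?k s)"
    using F(1) \<tau>w_int unfolding L by (intro Bochner_Integration.integrable_add integrable_mult_right)
  then show int: "integrable lborel (\<lambda>x. u x * ((A - B * x) * w x))" by simp
  have "(LINT s|lborel. u s * ?k s - u c * ?k s) = - (LINT t|lborel. u' t * (q t * w t))"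
    using F(2) unfolding L R by simp
  then show "(LINT x|lborel. u' x * (q x * w x)) = - (LINT x|lborel. u x * ((A - B * x) * w x))"
    using int \<tau>w_int total by simp
qed

lemma measurable_times_w:
  assumes "(\<lambda>x. indicator J x * h x) \<in> borel_measurable borel"
  shows "(\<lambda>x. h x * w x) \<in> borel_measurable borel"
proof -
  have [measurable]: "w \<in> borel_measurable borel"
    using borel_measurable_integrable[OF w_int] by simp
  have "(\<lambda>x. (indicator J x * h x) * w x) \<in> borel_measurable borel" using assms by measurable
  moreover have "(\<lambda>x. (indicator J x * h x) * w x) = (\<lambda>x. h x * w x)"
    using w_zero by (auto simp: fun_eq_iff indicator_def)
  ultimately show ?thesis by simp
qed

lemma measurable_J_mult:
  assumes "(\<lambda>x. indicator J x * h x) \<in> borel_measurable borel" "(\<lambda>x. indicator J x * k x) \<in> borel_measurable borel"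
  shows "(\<lambda>x. indicator J x * (h x * k x :: real)) \<in> borel_measurable borel"
proof -
  have "(\<lambda>x. (indicator J x * h x) * (indicator J x * k x)) \<in> borel_measurable borel" using assms by measurable
  moreover have "(\<lambda>x. (indicator J x * h x) * (indicator J x * k x)) = (\<lambda>x. indicator J x * (h x * k x))"
    by (auto simp: fun_eq_iff indicator_def)
  ultimately show ?thesis by simp
qed

section \<open>Moments and integration by parts against polynomials\<close>

lemma q_le: "x \<in> J \<Longrightarrow> q x \<le> \<bar>\<beta>\<bar> * \<bar>x\<bar> + \<bar>\<gamma>\<bar>"
proof -
  have "\<delta> * x\<^sup>2 \<le> 0" using \<delta> by (simp add: mult_nonpos_nonneg)
  moreover have "\<beta> * x \<le> \<bar>\<beta>\<bar> * \<bar>x\<bar>" by (metis abs_ge_self abs_mult)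
  ultimately show ?thesis unfolding qpoly_def by linarith
qed

text \<open>Stein's identity controls \<open>u (A - B x) w\<close>, whose linear factor degenerates
  only at \<open>c\<close>. Near \<open>c\<close> the continuous function \<open>u\<close> is
  bounded by \<open>M\<close>, and away from it \<open>\<bar>A - B x\<bar>\<close> is at least
  \<open>e\<close>.\<close>

lemma integrable_u_w:
  assumes u: "ac_deriv J u u'" and i: "integrable lborel (\<lambda>x. u' x * (q x * w x))"
  shows "integrable lborel (\<lambda>x. u x * w x)"
proof -
  obtain a b where ab: "a \<in> J" "b \<in> J" "a < c" "c < b" "{a..b} \<subseteq> J"
    using einterval_nbhd[OF c_in_J] by blast
  note cu = ac_deriv_continuous[OF u]
  have "bounded (u ` {a..b})"
    by (intro compact_imp_bounded compact_continuous_image continuous_on_subset[OF cu ab(5)]) auto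
  then obtain M where M: "\<And>x. x \<in> {a..b} \<Longrightarrow> \<bar>u x\<bar> \<le> M" unfolding bounded_iff by fastforce
  have M0: "0 \<le> M" using M[of c] ab(3,4) by auto
  define e where "e = min (A - B * a) (B * b - A)"
  have e: "0 < e" using ab(3,4) B by (simp add: e_def field_simps)
  have bound: "\<bar>u x\<bar> \<le> M + \<bar>u x * (A - B * x)\<bar> / e" for x
  proof (cases "x \<in> {a..b}")
    case True
    then show ?thesis using M[OF True] e by (intro order_trans[OF M[OF True]]) auto
  next
    case False
    then have "e \<le> \<bar>A - B * x\<bar>"
    proof (cases "x < a")
      case True
      then have "B * x \<le> B * a" using B by simp
      then show ?thesis unfolding e_def by linarith
    next
      case False
      then have "B * b \<le> B * x" using B \<open>x \<notin> {a..b}\<close> by simp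
      then show ?thesis unfolding e_def by linarith
    qed
    then have "\<bar>u x\<bar> * e \<le> \<bar>u x * (A - B * x)\<bar>" by (simp add: abs_mult mult_left_mono)
    then have "\<bar>u x\<bar> \<le> \<bar>u x * (A - B * x)\<bar> / e" using e by (simp add: field_simps)
    then show ?thesis using M0 by linarith
  qed
  show ?thesis
  proof (rule Bochner_Integration.integrable_bound)
    show "integrable lborel (\<lambda>x. M * w x + \<bar>u x * ((A - B * x) * w x)\<bar> / e)"
      using w_int stein(1)[OF u i] by simp
    show "(\<lambda>x. u x * w x) \<in> borel_measurable lborel"
      using measurable_times_w[OF continuous_measurable[OF cu]] by simp
    have le: "\<bar>u x\<bar> * w x \<le> M * w x + \<bar>u x * ((A - B * x) * w x)\<bar> / e" for x
      using mult_right_mono[OF bound[of x] w_nonneg[of x]] w_nonneg[of x]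
      by (simp add: abs_mult distrib_left mult_ac)
    then have "norm (u x * w x) \<le> norm (M * w x + \<bar>u x * ((A - B * x) * w x)\<bar> / e)" for x
      using order_trans[OF le[of x] abs_ge_self] w_nonneg[of x] by (simp add: abs_mult[of "u x" "w x"])
    then show "AE x in lborel. norm (u x * w x) \<le> norm (M * w x + \<bar>u x * ((A - B * x) * w x)\<bar> / e)"
      by simp
  qed
qed

text \<open>Descending one order gains one power of \<open>x\<close>. Stein's identity for
  \<open>u x^n\<close> controls \<open>u x^(n+1) w\<close> up to lower powers, and the extra term
  \<open>n x^(n-1) u q w\<close> from the product rule is bounded by lower powers as well, since
  \<open>q\<close> grows at most linearly on \<open>J\<close>.\<close>

lemma moments_step:
  assumes u: "ac_deriv J u u'" and i: "\<And>j. j \<le> k \<Longrightarrow> integrable lborel (\<lambda>x. x ^ j * (u' x * (q x * w x)))"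
  shows "j \<le> Suc k \<Longrightarrow> integrable lborel (\<lambda>x. x ^ j * (u x * w x))"
proof (induction j rule: less_induct)
  case (less j)
  note cu = ac_deriv_continuous[OF u]
  show ?case
  proof (cases j)
    case 0
    then show ?thesis using integrable_u_w[OF u] i[of 0] by simp
  next
    case (Suc n)
    have ac: "ac_deriv J (\<lambda>x. u x * x ^ n) (\<lambda>x. u' x * x ^ n + u x * (real n * x ^ (n - 1)))"
      by (rule ac_deriv_mult[OF u]) (auto intro!: derivative_eq_intros continuous_intros)
    have "integrable lborel (\<lambda>x. u x * (real n * x ^ (n - 1)) * (q x * w x))"
    proof (cases n)
      case (Suc p)
      have ib: "integrable lborel (\<lambda>x. real n * (\<bar>\<beta>\<bar> * \<bar>x ^ n * (u x * w x)\<bar> + \<bar>\<gamma>\<bar> * \<bar>x ^ p * (u x * w x)\<bar>))"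
        using less.IH[of n] less.IH[of p] less.prems \<open>j = Suc n\<close> Suc by simp
      show ?thesis
      proof (rule Bochner_Integration.integrable_bound[OF ib])
        have "(\<lambda>x. u x * (real n * x ^ (n - 1)) * q x * w x) \<in> borel_measurable borel"
          by (intro measurable_times_w continuous_measurable continuous_intros cu continuous_q)
        then show "(\<lambda>x. u x * (real n * x ^ (n - 1)) * (q x * w x)) \<in> borel_measurable lborel"
          by (simp add: mult.assoc)
        have "norm (u x * (real n * x ^ (n - 1)) * (q x * w x))
          \<le> norm (real n * (\<bar>\<beta>\<bar> * \<bar>x ^ n * (u x * w x)\<bar> + \<bar>\<gamma>\<bar> * \<bar>x ^ p * (u x * w x)\<bar>))" for x
        proof (cases "x \<in> J")
          case True
          let ?y = "real n * \<bar>x ^ p * (u x * w x)\<bar>"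
          have "norm (u x * (real n * x ^ (n - 1)) * (q x * w x)) = ?y * q x"
            using q_pos[OF True] Suc by (simp add: abs_mult mult_ac)
          also have "\<dots> \<le> ?y * (\<bar>\<beta>\<bar> * \<bar>x\<bar> + \<bar>\<gamma>\<bar>)"
            using q_le[OF True] by (intro mult_left_mono) auto
          also have "\<dots> = norm (real n * (\<bar>\<beta>\<bar> * \<bar>x ^ n * (u x * w x)\<bar> + \<bar>\<gamma>\<bar> * \<bar>x ^ p * (u x * w x)\<bar>))"
            using Suc by (simp add: abs_mult algebra_simps)
          finally show ?thesis .
        qed (simp add: w_zero)
        then show "AE x in lborel. norm (u x * (real n * x ^ (n - 1)) * (q x * w x))
          \<le> norm (real n * (\<bar>\<beta>\<bar> * \<bar>x ^ n * (u x * w x)\<bar> + \<bar>\<gamma>\<bar> * \<bar>x ^ p * (u x * w x)\<bar>))"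
          by simp
      qed
    qed simp
    then have "integrable lborel (\<lambda>x. x ^ n * (u' x * (q x * w x)) + u x * (real n * x ^ (n - 1)) * (q x * w x))"
      using i[of n] less.prems Suc by (intro Bochner_Integration.integrable_add) auto
    also have "(\<lambda>x. x ^ n * (u' x * (q x * w x)) + u x * (real n * x ^ (n - 1)) * (q x * w x))
        = (\<lambda>x. (u' x * x ^ n + u x * (real n * x ^ (n - 1))) * (q x * w x))"
      by (simp add: fun_eq_iff algebra_simps)
    finally have st: "integrable lborel (\<lambda>x. u x * x ^ n * ((A - B * x) * w x))"
      by (rule stein(1)[OF ac])
    have "integrable lborel (\<lambda>x. (A * (x ^ n * (u x * w x)) - u x * x ^ n * ((A - B * x) * w x)) / B)"
      using st less.IH[of n] less.prems Suc by simp
    moreover have "(A * (x ^ n * (u x * w x)) - u x * x ^ n * ((A - B * x) * w x)) / B = x ^ j * (u x * w x)" for x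
      using B Suc by (simp add: field_simps)
    ultimately show ?thesis by simp
  qed
qed

text \<open>For \<open>u = 1\<close> and \<open>u' = 0\<close> the integrability hypothesis of
  \<open>moments_step\<close> is trivial for every \<open>k\<close>.\<close>

lemma moments: "integrable lborel (\<lambda>x. x ^ j * w x)"
proof -
  have "ac_deriv J (\<lambda>x. 1) (\<lambda>x. 0)" by (simp add: ac_deriv_def)
  from moments_step[OF this, of j j] show ?thesis by simp
qed

lemma poly_moments: "integrable lborel (\<lambda>x. poly r x * w x)"
  by (intro integrable_poly_mult moments)

text \<open>Stein's identity for \<open>u\<close> times the derivative of \<open>r\<close>. It asks
  only for absolute moments of \<open>u'\<close> up to order \<open>k\<close>, which is what remains
  available for derivatives of \<open>g\<close> beyond order \<open>n\<close>.\<close>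

lemma adjoint_poly:
  assumes u: "ac_deriv J u u'" and i: "\<And>j. j \<le> k \<Longrightarrow> integrable lborel (\<lambda>x. x ^ j * (u' x * (q x * w x)))"
    and r: "degree r \<le> Suc k"
  shows "(LINT x|lborel. u' x * poly (pderiv r) x * (q x * w x))
    = - (LINT x|lborel. u x * poly (pearson_op \<delta> \<beta> \<gamma> A B r) x * w x)"
proof -
  note uw = moments_step[OF u i]
  have ac: "ac_deriv J (\<lambda>x. u x * poly (pderiv r) x) (\<lambda>x. u' x * poly (pderiv r) x + u x * poly (pderiv (pderiv r)) x)"
    by (rule ac_deriv_mult[OF u]) (auto intro!: poly_DERIV continuous_intros)
  have i1: "integrable lborel (\<lambda>x. poly (pderiv r) x * (u' x * (q x * w x)))"
    using r by (intro integrable_poly_mult i) (auto simp: degree_pderiv)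
  have "degree ([:\<gamma>, \<beta>, \<delta>:] * pderiv (pderiv r)) \<le> Suc k"
  proof (cases "pderiv (pderiv r) = 0")
    case False
    then have "degree r \<ge> 2" using pderiv_eq_0_iff[of "pderiv r"] degree_pderiv[of r] by auto
    then show ?thesis
      using r degree_mult_le[of "[:\<gamma>, \<beta>, \<delta>:]" "pderiv (pderiv r)"] degree_pCons_le[of \<gamma> "[:\<beta>, \<delta>:]"]
        degree_pCons_le[of \<beta> "[:\<delta>:]"] by (simp add: degree_pderiv)
  qed simp
  then have i2: "integrable lborel (\<lambda>x. poly ([:\<gamma>, \<beta>, \<delta>:] * pderiv (pderiv r)) x * (u x * w x))"
    by (intro integrable_poly_mult uw) auto
  have "integrable lborel (\<lambda>x. poly (pderiv r) x * (u' x * (q x * w x)) + poly ([:\<gamma>, \<beta>, \<delta>:] * pderiv (pderiv r)) x * (u x * w x))"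
    using i1 i2 by simp
  moreover have eq1: "poly (pderiv r) x * (u' x * (q x * w x)) + poly ([:\<gamma>, \<beta>, \<delta>:] * pderiv (pderiv r)) x * (u x * w x)
      = (u' x * poly (pderiv r) x + u x * poly (pderiv (pderiv r)) x) * (q x * w x)" for x
    unfolding poly_mult poly_qpoly by (simp add: algebra_simps)
  ultimately have i3: "integrable lborel (\<lambda>x. (u' x * poly (pderiv r) x + u x * poly (pderiv (pderiv r)) x) * (q x * w x))"
    by simp
  note st = stein[OF ac i3]
  have "(LINT x|lborel. poly (pderiv r) x * (u' x * (q x * w x))) + (LINT x|lborel. poly ([:\<gamma>, \<beta>, \<delta>:] * pderiv (pderiv r)) x * (u x * w x))
      = - (LINT x|lborel. u x * poly (pderiv r) x * ((A - B * x) * w x))"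
    using st(2) unfolding eq1[symmetric] using i1 i2 by simp
  moreover have "(LINT x|lborel. u x * poly (pearson_op \<delta> \<beta> \<gamma> A B r) x * w x)
      = (LINT x|lborel. poly ([:\<gamma>, \<beta>, \<delta>:] * pderiv (pderiv r)) x * (u x * w x) + u x * poly (pderiv r) x * ((A - B * x) * w x))"
    by (intro Bochner_Integration.integral_cong) (auto simp: pearson_op_def algebra_simps)
  ultimately show ?thesis using i2 st(1) by (simp add: mult_ac)
qed


text \<open>The cumulative identity up to \<open>t\<close> is Stein's identity for \<open>q\<close> stopped at \<open>t\<close>.\<close>

lemma next_weight:
  "pearson_weight \<alpha> \<omega> \<delta> \<beta> \<gamma> (A + \<beta>) (B - 2 * \<delta>) (\<lambda>x. q x * w x)"
proof
  show "\<alpha> < \<omega>" "\<delta> \<le> 0" by (fact ivl \<delta>)+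
  show "0 < B - 2 * \<delta>" using B \<delta> by simp
  show "0 < q x" if "x \<in> J" for x by (rule q_pos[OF that])
  show "0 < q x * w x" if "x \<in> J" for x using q_pos[OF that] w_pos[OF that] by simp
  show "q x * w x = 0" if "x \<notin> J" for x using w_zero[OF that] by simp
  have int: "integrable lborel (\<lambda>x. poly r x * (q x * w x))" for r
    using poly_moments[of "r * [:\<gamma>, \<beta>, \<delta>:]"] by (simp only: poly_mult poly_qpoly mult.assoc)
  show "integrable lborel (\<lambda>x. q x * w x)" using int[of 1] by simp
  show "integrable lborel (\<lambda>x. x * (q x * w x))" using int[of "[:0, 1:]"] by simp
  let ?q' = "\<lambda>x. 2 * \<delta> * x + \<beta>"
  have acq: "ac_deriv J q ?q'"
    unfolding qpoly_def
    by (rule ac_deriv_C1) (auto intro!: derivative_eq_intros continuous_intros)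
  have iq': "integrable lborel (\<lambda>x. ?q' x * (q x * w x))"
    using int[of "[:\<beta>, 2 * \<delta>:]"] by (simp add: algebra_simps)
  have i\<tau>: "integrable lborel (\<lambda>x. q x * ((A - B * x) * w x))"
    using stein(1)[OF acq iq'] .
  have eq: "(A + \<beta> - (B - 2 * \<delta>) * x) * (q x * w x) = ?q' x * (q x * w x) + q x * ((A - B * x) * w x)" for x
    by (simp add: algebra_simps)
  show "(LINT x|lborel. (A + \<beta> - (B - 2 * \<delta>) * x) * (q x * w x)) = 0"
    unfolding eq using iq' i\<tau> stein(2)[OF acq iq'] by simp
  fix t assume t: "t \<in> J"
  have ind: "integrable lborel (\<lambda>x. indicator {..t} x * h x)" if "integrable lborel h" for h :: "real \<Rightarrow> real"
    using integrable_mult_indicator[OF _ that, of "{..t}"] by simp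
  have i1: "integrable lborel (\<lambda>x. indicator {..t} x * ?q' x * (q x * w x))"
    using ind[OF iq'] by (simp add: mult.assoc)
  note ac = ac_deriv_stop[OF acq t]
  have "(\<lambda>x. (if x \<le> t then q x - q t else 0) * ((A - B * x) * w x))
      = (\<lambda>x. indicator {..t} x * (q x * ((A - B * x) * w x)) - q t * (indicator {..t} x * ((A - B * x) * w x)))"
    by (auto simp: fun_eq_iff algebra_simps)
  then have "(LINT x|lborel. indicator {..t} x * ?q' x * (q x * w x))
      = - ((LINT x|lborel. indicator {..t} x * (q x * ((A - B * x) * w x))) - q t * (q t * w t))"
    using stein(2)[OF ac i1] ind[OF i\<tau>] ind[OF \<tau>w_int] cum[OF t] by simp
  moreover have "(LINT x|lborel. indicator {..t} x * ((A + \<beta> - (B - 2 * \<delta>) * x) * (q x * w x)))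
      = (LINT x|lborel. indicator {..t} x * ?q' x * (q x * w x)) + (LINT x|lborel. indicator {..t} x * (q x * ((A - B * x) * w x)))"
    unfolding eq using i1 ind[OF i\<tau>]
    by (subst Bochner_Integration.integral_add[symmetric]) (auto simp: algebra_simps)
  ultimately show "(LINT x|lborel. indicator {..t} x * ((A + \<beta> - (B - 2 * \<delta>) * x) * (q x * w x))) = q t * (q t * w t)"
    by simp
qed

text \<open>Stein's identity for an antiderivative of \<open>u'\<^sup>2\<close>, which dominates \<open>(u x - u c)\<^sup>2 / \<bar>x - c\<bar>\<close>.\<close>

lemma hardy:
  assumes u: "ac_deriv J u u'" and i: "integrable lborel (\<lambda>x. (u' x)\<^sup>2 * (q x * w x))"
  shows "integrable lborel (\<lambda>x. (u x)\<^sup>2 * w x)"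
proof -
  \<comment> \<open>\<open>1 / (q w)\<close> is continuous on \<open>J\<close>, so the weighted
    hypothesis makes \<open>u'^2\<close> integrable on compact pieces, as its antiderivative
    \<open>s\<close> requires.\<close>
  have "integrable lborel (\<lambda>x. indicator {a..b} x * (u' x)\<^sup>2)" if ab: "a \<in> J" "b \<in> J" for a b
  proof -
    have sub: "{a..b} \<subseteq> J" using einterval_Icc_subset[OF ab] .
    have "integrable lborel (\<lambda>x. indicator {a..b} x * ((u' x)\<^sup>2 * (q x * w x)))"
      using integrable_mult_indicator[OF _ i, of "{a..b}"] by simp
    moreover have nz: "q x * w x \<noteq> 0" if "x \<in> J" for x
      using q_pos[OF that] w_pos[OF that] by simp
    then have "continuous_on J (\<lambda>x. 1 / (q x * w x))"
      by (intro continuous_on_divide continuous_on_const continuous_qw) auto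
    ultimately have "integrable lborel (\<lambda>x. indicator {a..b} x * ((u' x)\<^sup>2 * (q x * w x) * (1 / (q x * w x))))"
      using ab by (rule integrable_indicator_mult_cont)
    moreover have "(\<lambda>x. indicator {a..b} x * ((u' x)\<^sup>2 * (q x * w x) * (1 / (q x * w x)))) = (\<lambda>x. indicator {a..b} x * (u' x)\<^sup>2)"
    proof
      fix x show "indicator {a..b} x * ((u' x)\<^sup>2 * (q x * w x) * (1 / (q x * w x))) = indicator {a..b} x * (u' x)\<^sup>2"
        using nz[of x] sub by (cases "x \<in> {a..b}") auto
    qed
    ultimately show ?thesis by simp
  qed
  then obtain s where s: "ac_deriv J s (\<lambda>x. (u' x)\<^sup>2)"
    using ac_deriv_antiderivative[of J "\<lambda>x. (u' x)\<^sup>2" c] c_in_J by blast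
  let ?s = "\<lambda>x. s x - s c"
  have "ac_deriv J ?s (\<lambda>x. (u' x)\<^sup>2 - 0)"
    by (rule ac_deriv_diff[OF s]) (simp add: ac_deriv_def)
  then have s\<tau>: "integrable lborel (\<lambda>x. ?s x * ((A - B * x) * w x))"
    using stein(1)[of ?s "\<lambda>x. (u' x)\<^sup>2"] i by simp
  have bound: "(u x)\<^sup>2 * w x \<le> 2 * \<bar>?s x * ((A - B * x) * w x)\<bar> / B + 2 * (u c)\<^sup>2 * w x" for x
  proof (cases "x \<in> J")
    case True
    have "(u x - u c)\<^sup>2 \<le> \<bar>(x - c) * ?s x\<bar>"
    proof (cases "c \<le> x")
      case cx: True
      show ?thesis using ac_deriv_square_le[OF u s c_in_J True cx] abs_ge_self order_trans by blast
    next
      case False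
      then have "(u c - u x)\<^sup>2 \<le> (c - x) * (s c - s x)"
        using ac_deriv_square_le[OF u s True c_in_J] by simp
      also have "\<dots> = (x - c) * ?s x" by (simp add: algebra_simps)
      finally show ?thesis using abs_ge_self[of "(x - c) * ?s x"] power2_commute[of "u x" "u c"] by linarith
    qed
    also have "(x - c) * ?s x = - (?s x * (A - B * x)) / B"
      using B by (simp add: field_simps)
    finally have 1: "(u x - u c)\<^sup>2 \<le> \<bar>?s x * (A - B * x)\<bar> / B" using B by simp
    have "(u x)\<^sup>2 \<le> 2 * (u x - u c)\<^sup>2 + 2 * (u c)\<^sup>2"
      using zero_le_power2[of "u x - 2 * u c"] by (simp add: power2_eq_square algebra_simps)
    with 1 have "(u x)\<^sup>2 \<le> 2 * (\<bar>?s x * (A - B * x)\<bar> / B) + 2 * (u c)\<^sup>2" by linarith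
    from mult_right_mono[OF this w_nonneg[of x]]
    show ?thesis using w_nonneg[of x] by (simp add: abs_mult distrib_left mult_ac)
  qed (simp add: w_zero)
  show ?thesis
  proof (rule Bochner_Integration.integrable_bound)
    show "integrable lborel (\<lambda>x. 2 * \<bar>?s x * ((A - B * x) * w x)\<bar> / B + 2 * (u c)\<^sup>2 * w x)"
      using s\<tau> w_int by simp
    show "(\<lambda>x. (u x)\<^sup>2 * w x) \<in> borel_measurable lborel"
      using measurable_times_w[OF continuous_measurable[of \<alpha> \<omega> "\<lambda>x. (u x)\<^sup>2"]] ac_deriv_continuous[OF u]
      by (simp add: continuous_on_power)
    have "norm ((u x)\<^sup>2 * w x) \<le> norm (2 * \<bar>?s x * ((A - B * x) * w x)\<bar> / B + 2 * (u c)\<^sup>2 * w x)" for x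
      using order_trans[OF bound[of x] abs_ge_self] w_nonneg[of x] by simp
    then show "AE x in lborel. norm ((u x)\<^sup>2 * w x) \<le> norm (2 * \<bar>?s x * ((A - B * x) * w x)\<bar> / B + 2 * (u c)\<^sup>2 * w x)"
      by simp
  qed
qed

lemma integrable_mult_w:
  assumes h: "integrable lborel (\<lambda>x. (h x)\<^sup>2 * w x)" and k: "integrable lborel (\<lambda>x. (k x)\<^sup>2 * w x)"
    and m: "(\<lambda>x. indicator J x * h x) \<in> borel_measurable borel" "(\<lambda>x. indicator J x * k x) \<in> borel_measurable borel"
  shows "integrable lborel (\<lambda>x. h x * k x * w x)"
proof (rule Bochner_Integration.integrable_bound)
  show "integrable lborel (\<lambda>x. (h x)\<^sup>2 * w x + (k x)\<^sup>2 * w x)" using h k by simp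
  show "(\<lambda>x. h x * k x * w x) \<in> borel_measurable lborel"
    using measurable_times_w[OF measurable_J_mult[OF m]] by simp
  have "norm (h x * k x * w x) \<le> norm ((h x)\<^sup>2 * w x + (k x)\<^sup>2 * w x)" for x
  proof -
    have "2 * \<bar>h x * k x\<bar> \<le> (h x)\<^sup>2 + (k x)\<^sup>2"
      using zero_le_power2[of "\<bar>h x\<bar> - \<bar>k x\<bar>"] by (simp add: power2_eq_square algebra_simps abs_mult)
    then have "\<bar>h x * k x\<bar> \<le> (h x)\<^sup>2 + (k x)\<^sup>2" by linarith
    from mult_right_mono[OF this w_nonneg[of x]]
    have "\<bar>h x * k x * w x\<bar> \<le> (h x)\<^sup>2 * w x + (k x)\<^sup>2 * w x"
      using w_nonneg[of x] by (simp add: abs_mult distrib_right)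
    then show ?thesis by simp
  qed
  then show "AE x in lborel. norm (h x * k x * w x) \<le> norm ((h x)\<^sup>2 * w x + (k x)\<^sup>2 * w x)" by simp
qed

lemma integrable_power_times_w:
  assumes h: "integrable lborel (\<lambda>x. (h x)\<^sup>2 * w x)" "(\<lambda>x. indicator J x * h x) \<in> borel_measurable borel"
  shows "integrable lborel (\<lambda>x. x ^ j * (h x * w x))"
proof -
  have "integrable lborel (\<lambda>x. (x ^ j)\<^sup>2 * w x)"
    using moments[of "j * 2"] by (simp add: power_mult)
  from integrable_mult_w[OF this h(1) _ h(2)] show ?thesis by (simp add: mult.assoc)
qed

lemma integrable_poly_times_w:
  assumes h: "integrable lborel (\<lambda>x. (h x)\<^sup>2 * w x)" "(\<lambda>x. indicator J x * h x) \<in> borel_measurable borel"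
  shows "integrable lborel (\<lambda>x. poly r x * h x * w x)"
  using integrable_poly_mult[of r "\<lambda>x. h x * w x"] integrable_power_times_w[OF h] by (simp add: mult.assoc)

text \<open>The companion of \<open>adjoint_poly\<close> for a non-polynomial factor. The
  product-rule term \<open>u y' q w\<close> is integrable because the weight \<open>q^2 w\<close> in
  the hypothesis on \<open>y'\<close> says that \<open>y' q\<close> is square integrable for
  \<open>w\<close>, where it can be paired with \<open>u\<close>.\<close>

lemma adjoint_L2:
  assumes u: "ac_deriv J u u'" "integrable lborel (\<lambda>x. (u x)\<^sup>2 * w x)" "integrable lborel (\<lambda>x. (u' x)\<^sup>2 * (q x * w x))"
    and y: "\<And>x. x \<in> J \<Longrightarrow> (y has_real_derivative y' x) (at x)" "continuous_on J y'"
    and i: "integrable lborel (\<lambda>x. (y x)\<^sup>2 * (q x * w x))" "integrable lborel (\<lambda>x. (y' x)\<^sup>2 * (q x * (q x * w x)))"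
  shows "integrable lborel (\<lambda>x. u' x * y x * (q x * w x))"
    and "integrable lborel (\<lambda>x. u x * (y' x * (q x * w x) + y x * ((A - B * x) * w x)))"
    and "(LINT x|lborel. u' x * y x * (q x * w x)) = - (LINT x|lborel. u x * (y' x * (q x * w x) + y x * ((A - B * x) * w x)))"
proof -
  interpret nx: pearson_weight \<alpha> \<omega> \<delta> \<beta> \<gamma> "A + \<beta>" "B - 2 * \<delta>" "\<lambda>x. q x * w x" by (rule next_weight)
  have cy: "continuous_on J y" by (rule ac_deriv_continuous[OF ac_deriv_C1[OF y]])
  note my = continuous_measurable[OF cy] continuous_measurable[OF y(2)]
  note mu = continuous_measurable[OF ac_deriv_continuous[OF u(1)]] ac_deriv_measurable[OF u(1) ivl]
  show i1: "integrable lborel (\<lambda>x. u' x * y x * (q x * w x))"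
    by (rule nx.integrable_mult_w[OF u(3) i(1) mu(2) my(1)])
  have "integrable lborel (\<lambda>x. (y' x * q x)\<^sup>2 * w x)"
    using i(2) by (simp add: power2_eq_square mult_ac)
  from integrable_mult_w[OF u(2) this mu(1) measurable_J_mult[OF my(2) continuous_measurable[OF continuous_q]]]
  have i2: "integrable lborel (\<lambda>x. u x * y' x * (q x * w x))" by (simp add: mult.assoc)
  note ac = ac_deriv_mult[OF u(1) y]
  have i3: "integrable lborel (\<lambda>x. (u' x * y x + u x * y' x) * (q x * w x))"
    using i1 i2 by (simp add: distrib_right)
  note st = stein[OF ac i3]
  have eq: "u x * (y' x * (q x * w x) + y x * ((A - B * x) * w x)) = u x * y' x * (q x * w x) + u x * y x * ((A - B * x) * w x)" for x
    by (simp add: algebra_simps)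
  show "integrable lborel (\<lambda>x. u x * (y' x * (q x * w x) + y x * ((A - B * x) * w x)))"
    unfolding eq using i2 st(1) by simp
  show "(LINT x|lborel. u' x * y x * (q x * w x)) = - (LINT x|lborel. u x * (y' x * (q x * w x) + y x * ((A - B * x) * w x)))"
    unfolding eq using st(2) i1 i2 st(1) by (simp add: distrib_right)
qed


section \<open>Duality and the Poincare inequality\<close>

text \<open>
  The function \<open>y\<close> solves \<open>(q w y)' = u w\<close>, that is, the adjoint of differentiation maps it to \<open>u\<close>.
  The energy bound follows from the derivative of the boundary term \<open>Z = (A - B x) q w y\<^sup>2\<close>, which is bounded by
  the tails of the integral of \<open>u\<^sup>2 w\<close>. It drives the induction for the Poincare inequality: orthogonality
  of \<open>u\<close> to degree \<open>N\<close> makes \<open>y\<close> orthogonal to degree \<open>N - 1\<close> for the next weight.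
\<close>

lemma dual_function:
  assumes cu: "continuous_on J u" and u2: "integrable lborel (\<lambda>x. (u x)\<^sup>2 * w x)"
    and mean: "(LINT x|lborel. u x * w x) = 0"
  obtains y y' where "\<And>x. x \<in> J \<Longrightarrow> (y has_real_derivative y' x) (at x)" "continuous_on J y'"
    "integrable lborel (\<lambda>x. (y x)\<^sup>2 * (q x * w x))" "integrable lborel (\<lambda>x. (y' x)\<^sup>2 * (q x * (q x * w x)))"
    "B * (LINT x|lborel. (y x)\<^sup>2 * (q x * w x)) + (LINT x|lborel. (y' x)\<^sup>2 * (q x * (q x * w x)))
      \<le> (LINT x|lborel. (u x)\<^sup>2 * w x)"
    "\<And>x. y' x * (q x * w x) + y x * ((A - B * x) * w x) = u x * w x"
proof -
  define V where "V x = (LINT t|lborel. indicator {..x} t * (u t * w t))" for x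
  \<comment> \<open>\<open>s t\<close> is the value of \<open>d\<close> used in \<open>tail\<close>
    at the cut point \<open>t\<close>. It satisfies \<open>s t * V t = ?Z t\<close>, and
    \<open>(s t)^2\<close> times the mass of the relevant tail is at most
    \<open>\<bar>?Z t\<bar>\<close>, so completing the square leaves exactly the bound on the
    boundary term.\<close>
  define s where "s x = (A - B * x) * V x / (q x * w x)" for x
  let ?y = "\<lambda>x. V x / (q x * w x)"
  let ?y' = "\<lambda>x. (u x - ?y x * (A - B * x)) / q x"
  let ?Z = "\<lambda>x. (A - B * x) * (V x)\<^sup>2 / (q x * w x)"
  let ?E = "\<lambda>x. B * ((?y x)\<^sup>2 * (q x * w x)) + (?y' x)\<^sup>2 * (q x * (q x * w x))"
  have uw: "integrable lborel (\<lambda>x. u x * w x)"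
    using integrable_power_times_w[OF u2 continuous_measurable[OF cu], of 0] by simp
  have cuw: "continuous_on J (\<lambda>x. u x * w x)" by (intro continuous_intros cu continuous_w)
  have nz: "w x \<noteq> 0" "q x \<noteq> 0" if "x \<in> J" for x using q_pos[OF that] w_pos[OF that] by auto
  have V': "(V has_real_derivative u x * w x) (at x)" if "x \<in> J" for x
    unfolding V_def by (rule has_real_derivative_cumulative[OF uw cuw that])
  have cV: "continuous_on J V"
    unfolding V_def by (rule ac_deriv_continuous[OF ac_deriv_cumulative[OF uw]])
  have y: "(?y has_real_derivative ?y' x) (at x)" if "x \<in> J" for x
  proof -
    have "(u x * w x * (q x * w x) - V x * ((A - B * x) * w x)) / ((q x * w x) * (q x * w x)) = ?y' x"
      using nz[OF that] by (simp add: field_simps)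
    then show ?thesis using DERIV_divide[OF V'[OF that] qw_deriv[OF that]] nz[OF that] by simp
  qed
  have cy: "continuous_on J ?y"
    using nz by (intro continuous_on_divide cV continuous_qw) auto
  have cy': "continuous_on J ?y'"
    using nz by (intro continuous_on_divide continuous_on_diff continuous_on_mult cu cy continuous_q continuous_intros) auto
  have cE: "continuous_on J ?E"
    by (intro continuous_on_add continuous_on_mult continuous_on_power cy cy' continuous_q continuous_w continuous_on_const)
  have dual: "?y' x * (q x * w x) + ?y x * ((A - B * x) * w x) = u x * w x" for x
  proof (cases "x \<in> J")
    case True
    then show ?thesis using nz[OF True] by (simp add: field_simps)
  qed (simp add: w_zero)
  have Z': "(?Z has_real_derivative (u x)\<^sup>2 * w x - ?E x) (at x)" if x: "x \<in> J" for x
  proof -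
    have "((\<lambda>x. (A - B * x) * (V x)\<^sup>2) has_real_derivative (- B) * (V x)\<^sup>2 + 2 * V x * (u x * w x) * (A - B * x)) (at x)"
      using V'[OF x] by (auto intro!: derivative_eq_intros)
    from DERIV_divide[OF this qw_deriv[OF x]] nz[OF x]
    have "(?Z has_real_derivative (((- B) * (V x)\<^sup>2 + 2 * V x * (u x * w x) * (A - B * x)) * (q x * w x)
        - (A - B * x) * (V x)\<^sup>2 * ((A - B * x) * w x)) / ((q x * w x) * (q x * w x))) (at x)"
      by simp
    also have "(((- B) * (V x)\<^sup>2 + 2 * V x * (u x * w x) * (A - B * x)) * (q x * w x)
        - (A - B * x) * (V x)\<^sup>2 * ((A - B * x) * w x)) / ((q x * w x) * (q x * w x)) = (u x)\<^sup>2 * w x - ?E x"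
      using nz[OF x] by (simp add: field_simps power2_eq_square)
    finally show ?thesis .
  qed
  have ind: "integrable lborel (\<lambda>x. indicator S x * h x)" if "integrable lborel h" "S \<in> sets borel" for S and h :: "real \<Rightarrow> real"
    using integrable_mult_indicator[OF _ that(1), of S] that(2) by simp
  have tail: "0 \<le> (LINT x|lborel. indicator S x * ((u x)\<^sup>2 * w x)) - 2 * d * (LINT x|lborel. indicator S x * (u x * w x))
      + d\<^sup>2 * (LINT x|lborel. indicator S x * w x)" if "S \<in> sets borel" for S d
  proof -
    note ii = ind[OF u2 that] ind[OF uw that] ind[OF w_int that]
    have "(LINT x|lborel. indicator S x * ((u x)\<^sup>2 * w x)) - 2 * d * (LINT x|lborel. indicator S x * (u x * w x))
      + d\<^sup>2 * (LINT x|lborel. indicator S x * w x)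
      = (LINT x|lborel. indicator S x * ((u x)\<^sup>2 * w x) - 2 * d * (indicator S x * (u x * w x)) + d\<^sup>2 * (indicator S x * w x))"
      using ii by simp
    also have "\<dots> = (LINT x|lborel. indicator S x * ((u x - d)\<^sup>2 * w x))"
      by (intro Bochner_Integration.integral_cong) (auto simp: power2_eq_square algebra_simps)
    also have "\<dots> \<ge> 0" using w_nonneg by (intro integral_nonneg_AE) auto
    finally show ?thesis .
  qed
  \<comment> \<open>Only \<open>A - B t > 0\<close> needs work. There \<open>A - B x\<close> is at
    least \<open>A - B t\<close> on the lower tail, so \<open>cum\<close> bounds the mass of this
    tail by \<open>q t * w t / (A - B t)\<close>.\<close>
  have lower: "?Z t \<le> (LINT x|lborel. indicator {..t} x * ((u x)\<^sup>2 * w x))" if t: "t \<in> J" for t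
  proof (cases "A - B * t \<le> 0")
    case True
    then have "?Z t \<le> 0" using qw_nonneg[of t] by (simp add: divide_nonpos_nonneg mult_nonpos_nonneg)
    also have "0 \<le> (LINT x|lborel. indicator {..t} x * ((u x)\<^sup>2 * w x))"
      using w_nonneg by (intro integral_nonneg_AE) auto
    finally show ?thesis .
  next
    case False
    let ?I = "LINT x|lborel. indicator {..t} x * w x"
    have "(A - B * t) * ?I = (LINT x|lborel. (A - B * t) * (indicator {..t} x * w x))" by simp
    also have "\<dots> \<le> (LINT x|lborel. indicator {..t} x * ((A - B * x) * w x))"
    proof (rule integral_mono)
      show "integrable lborel (\<lambda>x. (A - B * t) * (indicator {..t} x * w x))" using ind[OF w_int, of "{..t}"] by simp
      show "integrable lborel (\<lambda>x. indicator {..t} x * ((A - B * x) * w x))" using ind[OF \<tau>w_int, of "{..t}"] by simp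
      show "(A - B * t) * (indicator {..t} x * w x) \<le> indicator {..t} x * ((A - B * x) * w x)" for x
        using w_nonneg[of x] B by (auto simp: indicator_def intro!: mult_right_mono)
    qed
    also have "\<dots> = q t * w t" by (rule cum[OF t])
    finally have le: "(A - B * t) * ?I \<le> q t * w t" .
    have "(s t)\<^sup>2 * ?I = (A - B * t) * (V t / (q t * w t))\<^sup>2 * ((A - B * t) * ?I)"
      by (simp add: s_def power2_eq_square mult_ac)
    also have "\<dots> \<le> (A - B * t) * (V t / (q t * w t))\<^sup>2 * (q t * w t)"
      using False by (intro mult_left_mono le) auto
    also have "\<dots> = ?Z t" using nz[OF t] by (simp add: power2_eq_square)
    finally have "(s t)\<^sup>2 * ?I \<le> ?Z t" .
    moreover have "s t * V t = ?Z t" by (simp add: s_def power2_eq_square)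
    ultimately show ?thesis using tail[of "{..t}" "s t"] by (simp add: V_def[symmetric])
  qed
  have upper: "- ?Z t \<le> (LINT x|lborel. indicator {t..} x * ((u x)\<^sup>2 * w x))" if t: "t \<in> J" for t
  proof (cases "A - B * t \<ge> 0")
    case True
    then have "- ?Z t \<le> 0" using qw_nonneg[of t] by simp
    also have "0 \<le> (LINT x|lborel. indicator {t..} x * ((u x)\<^sup>2 * w x))"
      using w_nonneg by (intro integral_nonneg_AE) auto
    finally show ?thesis .
  next
    case False
    let ?I = "LINT x|lborel. indicator {t..} x * w x"
    have "(B * t - A) * ?I = (LINT x|lborel. (B * t - A) * (indicator {t..} x * w x))" by simp
    also have "\<dots> \<le> (LINT x|lborel. - (indicator {t..} x * ((A - B * x) * w x)))"
    proof (rule integral_mono)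
      show "integrable lborel (\<lambda>x. (B * t - A) * (indicator {t..} x * w x))" using ind[OF w_int, of "{t..}"] by simp
      show "integrable lborel (\<lambda>x. - (indicator {t..} x * ((A - B * x) * w x)))" using ind[OF \<tau>w_int, of "{t..}"] by simp
      show "(B * t - A) * (indicator {t..} x * w x) \<le> - (indicator {t..} x * ((A - B * x) * w x))" for x
        using mult_right_mono[of "B * t - A" "B * x - A" "w x"] w_nonneg[of x] B
        by (auto simp: indicator_def algebra_simps)
    qed
    also have "\<dots> = q t * w t" using qw_upper[OF t] by simp
    finally have le: "(B * t - A) * ?I \<le> q t * w t" .
    have "(s t)\<^sup>2 * ?I = (B * t - A) * (V t / (q t * w t))\<^sup>2 * ((B * t - A) * ?I)"
      by (simp add: s_def power2_eq_square algebra_simps)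
    also have "\<dots> \<le> (B * t - A) * (V t / (q t * w t))\<^sup>2 * (q t * w t)"
      using False by (intro mult_left_mono le) auto
    also have "\<dots> = - ?Z t" using nz[OF t] by (simp add: power2_eq_square field_simps)
    finally have "(s t)\<^sup>2 * ?I \<le> - ?Z t" .
    moreover have "s t * V t = ?Z t" by (simp add: s_def power2_eq_square)
    \<comment> \<open>The mean zero of \<open>u\<close> enters here: \<open>V\<close>, which was
      integrated from the lower end, is up to sign also the integral from the upper end.\<close>
    moreover have "(LINT x|lborel. indicator {t..} x * (u x * w x)) = - V t"
      using upper_tail[OF uw, of t] mean by (simp add: V_def)
    ultimately show ?thesis using tail[of "{t..}" "s t"] by simp
  qed
  have E0: "0 \<le> ?E x" for x
    using B qw_nonneg[of x] q_pos[of x] w_nonneg[of x] w_zero[of x]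
    by (cases "x \<in> J") (auto intro!: add_nonneg_nonneg mult_nonneg_nonneg)
  have Ez: "?E x = 0" if "x \<notin> J" for x using w_zero[OF that] by simp
  have "continuous_on J (\<lambda>x. (u x)\<^sup>2 * w x - ?E x)"
    by (intro continuous_on_diff cE continuous_on_mult continuous_on_power cu continuous_w)
  note acZ = ac_deriv_C1[OF Z' this]
  have Eint: "(LINT x|lborel. indicator {a..b} x * ?E x) \<le> (LINT x|lborel. (u x)\<^sup>2 * w x)"
    if ab: "a \<in> J" "b \<in> J" "a \<le> b" for a b
  proof -
    have iE: "integrable lborel (\<lambda>x. indicator {a..b} x * ?E x)"
      by (rule integrable_indicator_continuous[OF cE ab(1,2)])
    note iu = ind[OF u2, of "{a..b}"] ind[OF u2, of "{..a}"] ind[OF u2, of "{b..}"]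
    have "?Z b - ?Z a = (LINT x|lborel. indicator {a..b} x * ((u x)\<^sup>2 * w x)) - (LINT x|lborel. indicator {a..b} x * ?E x)"
      using ac_derivD(2)[OF acZ ab] iE iu(1) by (simp add: right_diff_distrib)
    then have "(LINT x|lborel. indicator {a..b} x * ?E x)
        \<le> (LINT x|lborel. indicator {a..b} x * ((u x)\<^sup>2 * w x)) + (LINT x|lborel. indicator {..a} x * ((u x)\<^sup>2 * w x))
          + (LINT x|lborel. indicator {b..} x * ((u x)\<^sup>2 * w x))"
      using lower[OF ab(1)] upper[OF ab(2)] by linarith
    also have "\<dots> = (LINT x|lborel. indicator {a..b} x * ((u x)\<^sup>2 * w x) + indicator {..a} x * ((u x)\<^sup>2 * w x)
          + indicator {b..} x * ((u x)\<^sup>2 * w x))"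
      using iu by simp
    also have "\<dots> = (LINT x|lborel. (u x)\<^sup>2 * w x)"
      by (rule integral_discrete_difference[where X="{a, b}"]) (use ab in \<open>auto simp: indicator_def\<close>)
    finally show ?thesis .
  qed
  note Ei = integrable_of_bounded_integrals[OF ivl cE E0 Ez Eint]
  have meas: "(\<lambda>x. h x * w x) \<in> borel_measurable lborel" if "continuous_on J h" for h
    using measurable_times_w[OF continuous_measurable[OF that]] by simp
  have i1: "integrable lborel (\<lambda>x. B * ((?y x)\<^sup>2 * (q x * w x)))"
  proof (rule Bochner_Integration.integrable_bound[OF Ei(1)])
    show "(\<lambda>x. B * ((?y x)\<^sup>2 * (q x * w x))) \<in> borel_measurable lborel"
      using meas[of "\<lambda>x. B * ((?y x)\<^sup>2 * q x)"] cy continuous_q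
      by (simp add: mult.assoc continuous_on_mult continuous_on_power)
    have "norm (B * ((?y x)\<^sup>2 * (q x * w x))) \<le> norm (?E x)" for x
    proof -
      have "0 \<le> B * ((?y x)\<^sup>2 * (q x * w x))"
        by (intro mult_nonneg_nonneg[OF less_imp_le[OF B]] mult_nonneg_nonneg[OF zero_le_power2] qw_nonneg)
      moreover have "0 \<le> (?y' x)\<^sup>2 * (q x * (q x * w x))"
        using q_pos[of x] qw_nonneg[of x] w_zero[of x]
        by (cases "x \<in> J") (auto intro!: mult_nonneg_nonneg[OF zero_le_power2])
      ultimately show ?thesis unfolding real_norm_def by linarith
    qed
    then show "AE x in lborel. norm (B * ((?y x)\<^sup>2 * (q x * w x))) \<le> norm (?E x)" by (rule AE_I2)
  qed
  have i2: "integrable lborel (\<lambda>x. (?y' x)\<^sup>2 * (q x * (q x * w x)))"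
  proof -
    have "integrable lborel (\<lambda>x. ?E x - B * ((?y x)\<^sup>2 * (q x * w x)))"
      by (intro Bochner_Integration.integrable_diff Ei(1) i1)
    then show ?thesis by simp
  qed
  have i1': "integrable lborel (\<lambda>x. (?y x)\<^sup>2 * (q x * w x))"
    using integrable_mult_right[OF i1, of "1 / B"] B by simp
  have "B * (LINT x|lborel. (?y x)\<^sup>2 * (q x * w x)) + (LINT x|lborel. (?y' x)\<^sup>2 * (q x * (q x * w x)))
      = (LINT x|lborel. ?E x)"
    using i1' i2 by (subst Bochner_Integration.integral_add) auto
  also have "\<dots> \<le> (LINT x|lborel. (u x)\<^sup>2 * w x)" by (rule Ei(2))
  finally show ?thesis
    by (intro that[of ?y ?y'] y cy' i1' i2 dual)
qed

text \<open>Expand the nonnegative integral of \<open>(u' + l y)^2 q w\<close>. By duality the cross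
  term contains minus the integral of \<open>u^2 w\<close>, and the assumed bound replaces
  \<open>l^2\<close> times the energy of \<open>y\<close> by \<open>l\<close> times that of
  \<open>u\<close>. The constant passes from \<open>y\<close> to \<open>u\<close> unchanged.\<close>

lemma poincare_of_dual:
  assumes u: "ac_deriv J u u'" "integrable lborel (\<lambda>x. (u x)\<^sup>2 * w x)" "integrable lborel (\<lambda>x. (u' x)\<^sup>2 * (q x * w x))"
    and y: "\<And>x. x \<in> J \<Longrightarrow> (y has_real_derivative y' x) (at x)" "continuous_on J y'"
      "integrable lborel (\<lambda>x. (y x)\<^sup>2 * (q x * w x))" "integrable lborel (\<lambda>x. (y' x)\<^sup>2 * (q x * (q x * w x)))"
    and dual: "\<And>x. y' x * (q x * w x) + y x * ((A - B * x) * w x) = u x * w x"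
    and l: "0 \<le> l" "l * (LINT x|lborel. (y x)\<^sup>2 * (q x * w x)) \<le> (LINT x|lborel. (u x)\<^sup>2 * w x)"
  shows "l * (LINT x|lborel. (u x)\<^sup>2 * w x) \<le> (LINT x|lborel. (u' x)\<^sup>2 * (q x * w x))"
proof -
  let ?U = "LINT x|lborel. (u x)\<^sup>2 * w x" and ?U' = "LINT x|lborel. (u' x)\<^sup>2 * (q x * w x)"
    and ?Y = "LINT x|lborel. (y x)\<^sup>2 * (q x * w x)"
  note adj = adjoint_L2[OF u y]
  have "(LINT x|lborel. u' x * y x * (q x * w x)) = - (LINT x|lborel. u x * (u x * w x))"
    using adj(3) unfolding dual .
  then have uy: "(LINT x|lborel. u' x * y x * (q x * w x)) = - ?U" by (simp add: power2_eq_square mult.assoc)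
  have "0 \<le> (LINT x|lborel. (u' x + l * y x)\<^sup>2 * (q x * w x))"
    by (intro integral_nonneg_AE AE_I2 mult_nonneg_nonneg[OF zero_le_power2] qw_nonneg)
  also have "\<dots> = (LINT x|lborel. (u' x)\<^sup>2 * (q x * w x) + 2 * l * (u' x * y x * (q x * w x)) + l\<^sup>2 * ((y x)\<^sup>2 * (q x * w x)))"
    by (intro Bochner_Integration.integral_cong) (auto simp: power2_eq_square algebra_simps)
  also have "\<dots> = ?U' + 2 * l * (- ?U) + l\<^sup>2 * ?Y"
    using u(3) adj(1) y(3) uy by simp
  finally have "2 * l * ?U \<le> ?U' + l * (l * ?Y)" by (simp add: power2_eq_square mult.assoc)
  also have "l * (l * ?Y) \<le> l * ?U" by (rule mult_left_mono[OF l(2,1)])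
  finally show ?thesis by simp
qed

lemma dual_orthogonal:
  assumes y: "\<And>x. x \<in> J \<Longrightarrow> (y has_real_derivative y' x) (at x)" "continuous_on J y'"
      "integrable lborel (\<lambda>x. (y x)\<^sup>2 * (q x * w x))" "integrable lborel (\<lambda>x. (y' x)\<^sup>2 * (q x * (q x * w x)))"
    and dual: "\<And>x. y' x * (q x * w x) + y x * ((A - B * x) * w x) = u x * w x"
  shows "(LINT x|lborel. poly (pderiv r) x * y x * (q x * w x)) = - (LINT x|lborel. poly r x * u x * w x)"
proof -
  interpret nx: pearson_weight \<alpha> \<omega> \<delta> \<beta> \<gamma> "A + \<beta>" "B - 2 * \<delta>" "\<lambda>x. q x * w x" by (rule next_weight)
  have ac: "ac_deriv J (poly r) (poly (pderiv r))"
    by (rule ac_deriv_C1) (auto intro!: poly_DERIV continuous_intros)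
  have "integrable lborel (\<lambda>x. (poly r x)\<^sup>2 * w x)" "integrable lborel (\<lambda>x. (poly (pderiv r) x)\<^sup>2 * (q x * w x))"
    using poly_moments[of "r\<^sup>2"] nx.poly_moments[of "(pderiv r)\<^sup>2"] by simp_all
  from adjoint_L2(3)[OF ac this y] show ?thesis unfolding dual by (simp add: mult.assoc)
qed

end

lemma poly_antiderivative:
  fixes r :: "real poly"
  obtains R where "pderiv R = r" "degree R \<le> Suc (degree r)"
proof
  let ?R = "\<Sum>i\<le>degree r. monom (coeff r i / real (Suc i)) (Suc i)"
  have "pderiv ?R = (\<Sum>i\<le>degree r. pderiv (monom (coeff r i / real (Suc i)) (Suc i)))"
    using higher_pderiv_sum[of 1] by simp
  also have "\<dots> = (\<Sum>i\<le>degree r. monom (coeff r i) i)"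
    by (intro sum.cong) (auto simp: pderiv_monom simp del: of_nat_Suc)
  also have "\<dots> = r" by (rule poly_as_sum_of_monoms)
  finally show "pderiv ?R = r" .
  show "degree ?R \<le> Suc (degree r)"
    by (intro degree_sum_le) (auto intro: order_trans[OF degree_monom_le])
qed

text \<open>The constant is \<open>eigval \<delta> B (N + 1)\<close>. In the induction step the
  summand \<open>B\<close> comes from the energy bound of the dual function; the rest is the
  constant of the next weight, with \<open>B - 2 * \<delta>\<close> for \<open>B\<close> and the
  degree lowered by one.\<close>

lemma poincare:
  assumes "pearson_weight \<alpha> \<omega> \<delta> \<beta> \<gamma> A B w"
    and "ac_deriv (einterval \<alpha> \<omega>) u u'"
    and "integrable lborel (\<lambda>x. (u' x)\<^sup>2 * (qpoly \<delta> \<beta> \<gamma> x * w x))"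
    and "\<And>r. degree r \<le> N \<Longrightarrow> (LINT x|lborel. poly r x * u x * w x) = 0"
  shows "real (N + 1) * (B - real N * \<delta>) * (LINT x|lborel. (u x)\<^sup>2 * w x)
    \<le> (LINT x|lborel. (u' x)\<^sup>2 * (qpoly \<delta> \<beta> \<gamma> x * w x))"
  using assms
proof (induction N arbitrary: A B w u u')
  case (0 A B w u u')
  interpret pearson_weight \<alpha> \<omega> \<delta> \<beta> \<gamma> A B w by (rule 0)
  note u2 = hardy[OF 0(2,3)]
  have "(LINT x|lborel. u x * w x) = 0" using 0(4)[of 1] by simp
  from dual_function[OF ac_deriv_continuous[OF 0(2)] u2 this]
  obtain y y' where y: "\<And>x. x \<in> J \<Longrightarrow> (y has_real_derivative y' x) (at x)" "continuous_on J y'"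
    "integrable lborel (\<lambda>x. (y x)\<^sup>2 * (q x * w x))" "integrable lborel (\<lambda>x. (y' x)\<^sup>2 * (q x * (q x * w x)))"
    and le: "B * (LINT x|lborel. (y x)\<^sup>2 * (q x * w x)) + (LINT x|lborel. (y' x)\<^sup>2 * (q x * (q x * w x)))
      \<le> (LINT x|lborel. (u x)\<^sup>2 * w x)"
    and dual: "\<And>x. y' x * (q x * w x) + y x * ((A - B * x) * w x) = u x * w x"
    by blast
  have "0 \<le> (LINT x|lborel. (y' x)\<^sup>2 * (q x * (q x * w x)))"
    using q_pos qw_nonneg w_zero by (intro integral_nonneg_AE AE_I2) (metis less_imp_le mult_nonneg_nonneg mult_zero_right zero_le_power2)
  with le B show ?case
    using poincare_of_dual[OF 0(2) u2 0(3) y dual, of B] by simp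
next
  case (Suc N A B w u u')
  interpret pearson_weight \<alpha> \<omega> \<delta> \<beta> \<gamma> A B w by (rule Suc)
  note u2 = hardy[OF Suc.prems(2,3)]
  have "(LINT x|lborel. u x * w x) = 0" using Suc.prems(4)[of 1] by simp
  from dual_function[OF ac_deriv_continuous[OF Suc.prems(2)] u2 this]
  obtain y y' where y: "\<And>x. x \<in> J \<Longrightarrow> (y has_real_derivative y' x) (at x)" "continuous_on J y'"
    "integrable lborel (\<lambda>x. (y x)\<^sup>2 * (q x * w x))" "integrable lborel (\<lambda>x. (y' x)\<^sup>2 * (q x * (q x * w x)))"
    and le: "B * (LINT x|lborel. (y x)\<^sup>2 * (q x * w x)) + (LINT x|lborel. (y' x)\<^sup>2 * (q x * (q x * w x)))
      \<le> (LINT x|lborel. (u x)\<^sup>2 * w x)"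
    and dual: "\<And>x. y' x * (q x * w x) + y x * ((A - B * x) * w x) = u x * w x"
    by blast
  have "(LINT x|lborel. poly r x * y x * (q x * w x)) = 0" if "degree r \<le> N" for r
  proof -
    obtain R where R: "pderiv R = r" "degree R \<le> Suc (degree r)" by (rule poly_antiderivative)
    show ?thesis using dual_orthogonal[OF y dual, of R] Suc.prems(4)[of R] R that by simp
  qed
  from Suc.IH[OF next_weight ac_deriv_C1[OF y(1,2)] y(4) this]
  have "real (N + 1) * (B - 2 * \<delta> - real N * \<delta>) * (LINT x|lborel. (y x)\<^sup>2 * (q x * w x))
      \<le> (LINT x|lborel. (y' x)\<^sup>2 * (q x * (q x * w x)))" by simp
  with le have "(B + real (N + 1) * (B - 2 * \<delta> - real N * \<delta>)) * (LINT x|lborel. (y x)\<^sup>2 * (q x * w x))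
      \<le> (LINT x|lborel. (u x)\<^sup>2 * w x)" unfolding distrib_right[of B] by linarith
  also have "B + real (N + 1) * (B - 2 * \<delta> - real N * \<delta>) = real (Suc N + 1) * (B - real (Suc N) * \<delta>)"
    by (simp add: algebra_simps)
  finally have le': "real (Suc N + 1) * (B - real (Suc N) * \<delta>) * (LINT x|lborel. (y x)\<^sup>2 * (q x * w x))
      \<le> (LINT x|lborel. (u x)\<^sup>2 * w x)" .
  have "real (Suc N) * \<delta> \<le> 0" using \<delta> by (intro mult_nonneg_nonpos) auto
  then have "0 \<le> real (Suc N + 1) * (B - real (Suc N) * \<delta>)" using B by simp
  from poincare_of_dual[OF Suc.prems(2) u2 Suc.prems(3) y dual this le'] show ?case .
qed

section \<open>Eigenpolynomials and Newton expansions\<close>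

definition eigval :: "real \<Rightarrow> real \<Rightarrow> nat \<Rightarrow> real" where
  "eigval \<delta> B k = real k * (B - (real k - 1) * \<delta>)"

lemma eigval_0 [simp]: "eigval \<delta> B 0 = 0"
  by (simp add: eigval_def)

lemma eigval_diff: "eigval \<delta> B k - eigval \<delta> B j = (real k - real j) * (B - (real k + real j - 1) * \<delta>)"
  by (simp add: eigval_def algebra_simps)

lemma eigval_strict_mono:
  assumes "\<delta> \<le> 0" "0 < B" "j < k"
  shows "eigval \<delta> B j < eigval \<delta> B k"
proof -
  have "(real k + real j - 1) * \<delta> \<le> 0" using assms by (intro mult_nonneg_nonpos) auto
  then have "0 < (real k - real j) * (B - (real k + real j - 1) * \<delta>)"
    using assms by (intro mult_pos_pos) auto
  then show ?thesis using eigval_diff[of \<delta> B k j] by simp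
qed

lemma eigval_pos: "\<delta> \<le> 0 \<Longrightarrow> 0 < B \<Longrightarrow> 0 < k \<Longrightarrow> 0 < eigval \<delta> B k"
  using eigval_strict_mono[of \<delta> B 0 k] by simp

lemma pearson_op_add: "pearson_op \<delta> \<beta> \<gamma> A B (p + r) = pearson_op \<delta> \<beta> \<gamma> A B p + pearson_op \<delta> \<beta> \<gamma> A B r"
  by (simp only: pearson_op_def pderiv_add distrib_left add_ac)

lemma pearson_op_diff: "pearson_op \<delta> \<beta> \<gamma> A B (p - r) = pearson_op \<delta> \<beta> \<gamma> A B p - pearson_op \<delta> \<beta> \<gamma> A B r"
  by (simp only: pearson_op_def pderiv_diff right_diff_distrib add_diff_add)

text \<open>Truncated subtraction in the exponents is harmless: the coefficient at
  \<open>k - 2\<close> vanishes for \<open>k < 2\<close> and the one at \<open>k - 1\<close> for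
  \<open>k = 0\<close>.\<close>

lemma pearson_op_monom:
  "pearson_op \<delta> \<beta> \<gamma> A B (monom a k) =
    monom (\<gamma> * (real k * (real k - 1) * a)) (k - 2)
    + monom (\<beta> * (real k * (real k - 1) * a) + A * (real k * a)) (k - 1)
    + monom (\<delta> * (real k * (real k - 1) * a) - B * (real k * a)) k"
proof -
  have "poly (pearson_op \<delta> \<beta> \<gamma> A B (monom a k)) x = poly (monom (\<gamma> * (real k * (real k - 1) * a)) (k - 2)
    + monom (\<beta> * (real k * (real k - 1) * a) + A * (real k * a)) (k - 1)
    + monom (\<delta> * (real k * (real k - 1) * a) - B * (real k * a)) k) x" for x
  proof (cases k)
    case (Suc j)
    then show ?thesis
      by (cases j) (simp_all add: pearson_op_def pderiv_monom poly_monom algebra_simps)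
  qed (simp add: pearson_op_def pderiv_monom)
  then show ?thesis by (metis poly_eq_poly_eq_iff ext)
qed

lemma coeff_pearson_op_monom:
  "coeff (pearson_op \<delta> \<beta> \<gamma> A B (monom a k)) k = - eigval \<delta> B k * a"
  "k < i \<Longrightarrow> coeff (pearson_op \<delta> \<beta> \<gamma> A B (monom a k)) i = 0"
  unfolding pearson_op_monom by (cases "k = 0"; auto simp: eigval_def algebra_simps)+

text \<open>In the basis of monomials the operator is triangular with diagonal entries
  \<open>- eigval \<delta> B d\<close>. As long as \<open>l\<close> avoids these eigenvalues, the
  equation is solved from the top coefficient downwards.\<close>

lemma pearson_op_solvable:
  assumes "\<And>d. d < k \<Longrightarrow> l \<noteq> eigval \<delta> B d" and "\<And>i. k \<le> i \<Longrightarrow> coeff r i = 0"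
  shows "\<exists>s. (\<forall>i\<ge>k. coeff s i = 0) \<and> pearson_op \<delta> \<beta> \<gamma> A B s + smult l s = r"
  using assms
proof (induction k arbitrary: r)
  case 0
  then have "r = 0" by (simp add: poly_eq_iff)
  then show ?case by (intro exI[of _ 0]) (simp add: pearson_op_def)
next
  case (Suc k)
  define a where "a = coeff r k / (l - eigval \<delta> B k)"
  have a: "a * (l - eigval \<delta> B k) = coeff r k" using Suc.prems(1)[of k] by (simp add: a_def)
  let ?t = "pearson_op \<delta> \<beta> \<gamma> A B (monom a k) + smult l (monom a k)"
  have "coeff (r - ?t) i = 0" if "k \<le> i" for i
    using that Suc.prems(2)[of i] a by (cases "i = k") (auto simp: coeff_pearson_op_monom algebra_simps)
  from Suc.IH[OF _ this] Suc.prems(1) obtain s where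
    s: "\<forall>i\<ge>k. coeff s i = 0" "pearson_op \<delta> \<beta> \<gamma> A B s + smult l s = r - ?t" by force
  show ?case
  proof (intro exI[of _ "s + monom a k"] conjI)
    show "\<forall>i\<ge>Suc k. coeff (s + monom a k) i = 0" using s(1) by auto
    show "pearson_op \<delta> \<beta> \<gamma> A B (s + monom a k) + smult l (s + monom a k) = r"
      using s(2) by (simp add: pearson_op_add smult_add_right algebra_simps)
  qed
qed

text \<open>Applied to \<open>x^k\<close>, the operator plus \<open>eigval \<delta> B k\<close>
  cancels the leading term. The error has degree below \<open>k\<close>, where the smaller
  eigenvalues differ from \<open>eigval \<delta> B k\<close>, so a lower-order correction of
  \<open>x^k\<close> removes it.\<close>

lemma eigenpoly_exists:
  assumes "\<delta> \<le> 0" "0 < B"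
  shows "\<exists>p. degree p = k \<and> coeff p k = 1 \<and> pearson_op \<delta> \<beta> \<gamma> A B p = smult (- eigval \<delta> B k) p"
proof -
  let ?l = "eigval \<delta> B k" and ?m = "monom 1 k :: real poly"
  let ?r = "pearson_op \<delta> \<beta> \<gamma> A B ?m + smult ?l ?m"
  have "coeff ?r i = 0" if "k \<le> i" for i
    using that by (cases "i = k") (auto simp: coeff_pearson_op_monom)
  moreover have "?l \<noteq> eigval \<delta> B d" if "d < k" for d
    using eigval_strict_mono[OF assms that] by simp
  ultimately obtain s where s: "\<forall>i\<ge>k. coeff s i = 0" "pearson_op \<delta> \<beta> \<gamma> A B s + smult ?l s = ?r"
    using pearson_op_solvable[of k ?l \<delta> B ?r \<beta> \<gamma> A] by blast
  have "coeff (?m - s) k = 1" using s(1) by simp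
  moreover have "degree (?m - s) \<le> k" using s(1) by (intro degree_le) auto
  then have "degree (?m - s) = k"
    using le_degree[of "?m - s" k] calculation by simp
  moreover have "pearson_op \<delta> \<beta> \<gamma> A B (?m - s) = smult (- ?l) (?m - s)"
    using s(2) by (simp add: pearson_op_diff smult_diff_right algebra_simps)
  ultimately show ?thesis by blast
qed

text \<open>For an actual Pearson weight these are, up to an affine change of variable, the monic
  Hermite, Laguerre or Jacobi polynomials, according as \<open>q\<close> is constant, linear or
  quadratic.\<close>

definition eigenpoly :: "real \<Rightarrow> real \<Rightarrow> real \<Rightarrow> real \<Rightarrow> real \<Rightarrow> nat \<Rightarrow> real poly" where
  "eigenpoly \<delta> \<beta> \<gamma> A B k = (SOME p. degree p = k \<and> coeff p k = 1
     \<and> pearson_op \<delta> \<beta> \<gamma> A B p = smult (- eigval \<delta> B k) p)"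

lemma eigenpoly:
  assumes "\<delta> \<le> 0" "0 < B"
  shows "degree (eigenpoly \<delta> \<beta> \<gamma> A B k) = k" "coeff (eigenpoly \<delta> \<beta> \<gamma> A B k) k = 1"
    "pearson_op \<delta> \<beta> \<gamma> A B (eigenpoly \<delta> \<beta> \<gamma> A B k) = smult (- eigval \<delta> B k) (eigenpoly \<delta> \<beta> \<gamma> A B k)"
  using someI_ex[OF eigenpoly_exists[OF assms, of k \<beta> \<gamma> A]] unfolding eigenpoly_def by blast+

lemma eigenpoly_span:
  assumes "\<delta> \<le> 0" "0 < B" "degree r \<le> N"
  obtains d where "r = (\<Sum>k\<le>N. smult (d k) (eigenpoly \<delta> \<beta> \<gamma> A B k))"
proof -
  have "\<exists>d. r = (\<Sum>k\<le>N. smult (d k) (eigenpoly \<delta> \<beta> \<gamma> A B k))"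
    using assms(3)
  proof (induction N arbitrary: r)
    case 0
    have "eigenpoly \<delta> \<beta> \<gamma> A B 0 = [:1:]"
      using eigenpoly(1,2)[OF assms(1,2), of \<beta> \<gamma> A 0] by (metis degree_eq_zeroE coeff_pCons_0)
    moreover obtain a where "r = [:a:]" using 0 degree_eq_zeroE[of r] by auto
    ultimately show ?case by (intro exI[of _ "\<lambda>_. a"]) simp
  next
    case (Suc N)
    let ?e = "eigenpoly \<delta> \<beta> \<gamma> A B (Suc N)"
    have "degree (r - smult (coeff r (Suc N)) ?e) \<le> N"
    proof (rule degree_le, intro allI impI)
      fix i assume "N < i"
      then show "coeff (r - smult (coeff r (Suc N)) ?e) i = 0"
        using Suc.prems eigenpoly(1,2)[OF assms(1,2), of \<beta> \<gamma> A "Suc N"]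
        by (cases "i = Suc N") (auto simp: coeff_eq_0)
    qed
    from Suc.IH[OF this] obtain d where
      "r - smult (coeff r (Suc N)) ?e = (\<Sum>k\<le>N. smult (d k) (eigenpoly \<delta> \<beta> \<gamma> A B k))" by blast
    then have "r = (\<Sum>k\<le>N. smult (d k) (eigenpoly \<delta> \<beta> \<gamma> A B k)) + smult (coeff r (Suc N)) ?e"
      by (simp add: algebra_simps)
    also have "\<dots> = (\<Sum>k\<le>Suc N. smult ((d(Suc N := coeff r (Suc N))) k) (eigenpoly \<delta> \<beta> \<gamma> A B k))"
      by simp
    finally show ?case by blast
  qed
  then show ?thesis using that by blast
qed

text \<open>Differentiating \<open>L p = - l p\<close>: the derivative intertwines the operator with
  that of the next weight, and the derivative of the first-order coefficient contributes
  \<open>- B\<close>. So derivatives of eigenpolynomials are eigenpolynomials for the weight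
  multiplied by \<open>q\<close>.\<close>

lemma pearson_op_pderiv:
  assumes "pearson_op \<delta> \<beta> \<gamma> A B p = smult (- l) p"
  shows "pearson_op \<delta> \<beta> \<gamma> (A + \<beta>) (B - 2 * \<delta>) (pderiv p) = smult (- (l - B)) (pderiv p)"
proof -
  have "pderiv (pearson_op \<delta> \<beta> \<gamma> A B p) = pearson_op \<delta> \<beta> \<gamma> (A + \<beta>) (B - 2 * \<delta>) (pderiv p) - smult B (pderiv p)"
  proof -
    have "pderiv [:\<gamma>, \<beta>, \<delta>:] = [:\<beta>, 2 * \<delta>:]" "pderiv [:A, - B:] = [:- B:]"
      by (simp_all add: pderiv_pCons)
    moreover have "[:A + \<beta>, - (B - 2 * \<delta>):] = [:A, - B:] + [:\<beta>, 2 * \<delta>:]" by simp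
    ultimately show ?thesis
      unfolding pearson_op_def pderiv_add pderiv_mult by (simp only: distrib_left distrib_right) (simp add: algebra_simps)
  qed
  then have "pearson_op \<delta> \<beta> \<gamma> (A + \<beta>) (B - 2 * \<delta>) (pderiv p) = pderiv (smult (- l) p) + smult B (pderiv p)"
    unfolding assms by (simp add: algebra_simps)
  also have "\<dots> = smult (- (l - B)) (pderiv p)"
    unfolding pderiv_smult smult_add_left[symmetric] by simp
  finally show ?thesis .
qed

text \<open>The shifts \<open>B - 2 j \<delta>\<close> collected over \<open>j < i\<close> add up to
  \<open>eigval \<delta> B i\<close>. This is the origin of the Newton factors.\<close>

lemma pearson_op_higher_pderiv:
  assumes "pearson_op \<delta> \<beta> \<gamma> A B p = smult (- l) p"
  shows "pearson_op \<delta> \<beta> \<gamma> (A + real i * \<beta>) (B - 2 * real i * \<delta>) ((pderiv ^^ i) p)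
    = smult (- (l - eigval \<delta> B i)) ((pderiv ^^ i) p)"
proof (induction i)
  case 0
  then show ?case using assms by simp
next
  case (Suc i)
  have e: "A + real (Suc i) * \<beta> = A + real i * \<beta> + \<beta>" "B - 2 * real (Suc i) * \<delta> = B - 2 * real i * \<delta> - 2 * \<delta>"
    "eigval \<delta> B (Suc i) = eigval \<delta> B i + (B - 2 * real i * \<delta>)"
    by (simp_all add: eigval_def algebra_simps)
  show ?case unfolding e using pearson_op_pderiv[OF Suc] by (simp add: diff_diff_add)
qed

section \<open>Newton basis and the coefficients of the inequality\<close>

definition newton_basis :: "real \<Rightarrow> real \<Rightarrow> nat \<Rightarrow> real \<Rightarrow> real" where
  "newton_basis \<delta> B i x = (\<Prod>s<i. (x - eigval \<delta> B s))"

lemma newton_basis_0 [simp]: "newton_basis \<delta> B 0 x = 1"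
  by (simp add: newton_basis_def)

lemma newton_basis_Suc: "newton_basis \<delta> B (Suc i) x = newton_basis \<delta> B i x * (x - eigval \<delta> B i)"
  by (simp add: newton_basis_def)

lemma ffac_0 [simp]: "ffac x 0 = 1"
  by (simp add: ffac_def)

lemma ffac_Suc: "ffac x (Suc k) = ffac x k * (x - real k)"
  by (simp add: ffac_def)

lemma ffac_Suc_shift: "ffac (x + 1) (Suc k) = (x + 1) * ffac x k"
  by (induction k) (simp_all add: ffac_Suc algebra_simps)

lemma ffac_pos: "k \<le> m \<Longrightarrow> 0 < ffac (real m) k"
  unfolding ffac_def by (intro prod_pos) auto

lemma one_minus_pos: "\<delta> \<le> 0 \<Longrightarrow> 0 < 1 - real j * \<delta>"
  using mult_nonneg_nonpos[of "real j" \<delta>] by simp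

lemma prod_one_minus_pos: "\<delta> \<le> 0 \<Longrightarrow> 0 < (\<Prod>j\<in>S. (1 - real j * \<delta>))"
  by (intro prod_pos ballI one_minus_pos)

lemma coef_b_alt: "coef_b \<delta> m n i = real (n choose i) / (ffac (real (m + n)) i * (\<Prod>t<i. (1 - real (m + t) * \<delta>)))"
proof (cases i)
  case 0
  \<comment> \<open>For \<open>m = 0\<close> truncated subtraction makes the range
    \<open>{0}\<close>, but its only factor is \<open>1 - 0 * \<delta> = 1\<close>.\<close>
  have "(\<Prod>j\<in>{m..m - 1}. (1 - real j * \<delta>)) = 1" by (cases m) auto
  with 0 show ?thesis by (simp add: coef_b_def)
next
  case (Suc k)
  have "(\<Prod>j\<in>{m..m + i - 1}. (1 - real j * \<delta>)) = (\<Prod>t<i. (1 - real (m + t) * \<delta>))"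
    using Suc by (intro prod.reindex_bij_witness[of _ "\<lambda>t. m + t" "\<lambda>j. j - m"]) auto
  then show ?thesis by (simp add: coef_b_def)
qed

lemma coef_b_0 [simp]: "coef_b \<delta> m n 0 = 1"
  by (simp add: coef_b_alt)

lemma coef_b_pos:
  assumes "\<delta> \<le> 0" "i \<le> n"
  shows "0 < coef_b \<delta> m n i"
  unfolding coef_b_def
  using assms by (intro divide_pos_pos mult_pos_pos ffac_pos prod_one_minus_pos) (auto simp: zero_less_binomial)

text \<open>Raising \<open>n\<close> by one multiplies the product polynomial by
  \<open>1 - x / L\<close>. Writing \<open>x\<close> times the \<open>i\<close>-th Newton polynomial
  as the next one plus \<open>eigval \<delta> 1 i\<close> times itself gives this recursion for the
  coefficients with their signs removed.\<close>

lemma coef_b_rec: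
  fixes m n i :: nat
  assumes \<delta>: "\<delta> \<le> 0" and i: "i \<le> n"
  defines "L \<equiv> eigval \<delta> 1 (m + Suc n)"
  shows "coef_b \<delta> m (Suc n) (Suc i) = coef_b \<delta> m n (Suc i) * (1 - eigval \<delta> 1 (Suc i) / L) + coef_b \<delta> m n i / L"
proof -
  define M where "M = real m + real n"
  define F where "F = ffac M i"
  define R where "R = (\<Prod>t<i. (1 - real (m + t) * \<delta>))"
  define p where "p = 1 - (real m + real i) * \<delta>"
  define s where "s = 1 - M * \<delta>"
  define C0 where "C0 = real (n choose i)"
  define C1 where "C1 = real (n choose Suc i)"
  have F: "F \<noteq> 0" using ffac_pos[of i "m + n"] i by (simp add: F_def M_def)
  have R: "R \<noteq> 0" unfolding R_def using \<delta> one_minus_pos[of \<delta>] by (simp add: prod_zero_iff) (metis less_irrefl of_nat_add)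
  have p: "p \<noteq> 0" using one_minus_pos[OF \<delta>, of "m + i"] by (simp add: p_def)
  have s: "s \<noteq> 0" using one_minus_pos[OF \<delta>, of "m + n"] by (simp add: s_def M_def)
  have M1: "M + 1 \<noteq> 0" by (simp add: M_def add_nonneg_pos order_less_imp_not_eq2)
  have L: "L = (M + 1) * s" by (simp add: L_def eigval_def M_def s_def algebra_simps)
  have absorb: "(real n - real i) * C0 = (real i + 1) * C1"
  proof -
    have "Suc i * (n choose Suc i) = (n - i) * (n choose i)" using i
      by (metis binomial_absorb_comp binomial_absorption mult.commute Suc_times_binomial_add le_add_diff_inverse)
    then have "real (Suc i * (n choose Suc i)) = real ((n - i) * (n choose i))" by simp
    then show ?thesis using i by (simp add: C0_def C1_def of_nat_diff algebra_simps)
  qed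
  have b': "coef_b \<delta> m (Suc n) (Suc i) = (C0 + C1) / ((M + 1) * F * (R * p))"
    using ffac_Suc_shift[of M i]
    by (simp add: coef_b_alt C0_def C1_def F_def R_def p_def M_def add_ac)
  have b0: "coef_b \<delta> m n i = C0 / (F * R)"
    by (simp add: coef_b_alt C0_def F_def R_def M_def)
  have b1: "coef_b \<delta> m n (Suc i) * (1 - eigval \<delta> 1 (Suc i) / L) = C1 * (1 - (M + real i + 1) * \<delta>) / (F * R * p * L)"
  \<comment> \<open>Since \<open>i \<le> n\<close>, the equation forces \<open>m = 0\<close> and
    \<open>i = n\<close>. Then the falling factorial contains the factor 0 and cannot be cancelled,
    but the binomial coefficient vanishes on both sides.\<close>
  proof (cases "M = real i")
    case True
    then have "n choose Suc i = 0" by (simp add: M_def)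
    then show ?thesis unfolding coef_b_alt C1_def by (simp only: of_nat_0 div_0 mult_zero_left)
  next
    case False
    have "1 - eigval \<delta> 1 (Suc i) / L = (L - eigval \<delta> 1 (Suc i)) / L"
      using L M1 s by (simp add: diff_divide_distrib)
    also have "L - eigval \<delta> 1 (Suc i) = (M - real i) * (1 - (M + real i + 1) * \<delta>)"
      unfolding L_def eigval_diff by (simp add: M_def algebra_simps)
    finally have e: "1 - eigval \<delta> 1 (Suc i) / L = (M - real i) * (1 - (M + real i + 1) * \<delta>) / L" .
    have "coef_b \<delta> m n (Suc i) = C1 / (F * (M - real i) * (R * p))"
      by (simp add: coef_b_alt C1_def F_def R_def M_def p_def ffac_Suc)
    then show ?thesis unfolding e using False by simp
  qed
  have key: "(C0 + C1) * s = C1 * (1 - (M + real i + 1) * \<delta>) + C0 * p"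
  proof -
    have "C1 * (1 - (M + real i + 1) * \<delta>) + C0 * p - (C0 + C1) * s
        = \<delta> * ((real n - real i) * C0 - (real i + 1) * C1)"
      by (simp add: s_def p_def M_def algebra_simps)
    then show ?thesis using absorb by simp
  qed
  have "coef_b \<delta> m n (Suc i) * (1 - eigval \<delta> 1 (Suc i) / L) + coef_b \<delta> m n i / L
      = (C1 * (1 - (M + real i + 1) * \<delta>) + C0 * p) / (F * R * p * L)"
    unfolding b1 b0 using p F R by (simp add: add_divide_distrib)
  also have "\<dots> = coef_b \<delta> m (Suc n) (Suc i)"
    unfolding key[symmetric] b' L using s by (simp add: mult_ac)
  finally show ?thesis by simp
qed

lemma newton_expansion:
  assumes \<delta>: "\<delta> \<le> 0"
  shows "(\<Sum>i\<le>n. (-1) ^ i * coef_b \<delta> m n i * newton_basis \<delta> 1 i x)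
    = (\<Prod>j\<in>{m + 1..m + n}. (1 - x / eigval \<delta> 1 j))"
proof (induction n)
  case 0
  then show ?case by simp
next
  case (Suc n)
  let ?L = "eigval \<delta> 1 (m + Suc n)" and ?b = "coef_b \<delta> m n" and ?w = "\<lambda>i. newton_basis \<delta> 1 i x"
    and ?e = "eigval \<delta> 1"
  have L: "?L \<noteq> 0" using eigval_pos[OF \<delta>, of 1 "m + Suc n"] by simp
  have bn: "?b (Suc n) = 0" by (simp add: coef_b_def)
  have "(\<Sum>i\<le>Suc n. (-1) ^ i * coef_b \<delta> m (Suc n) i * ?w i)
      = 1 + (\<Sum>i\<le>n. (-1) ^ Suc i * coef_b \<delta> m (Suc n) (Suc i) * ?w (Suc i))"
    by (subst sum.atMost_Suc_shift) simp
  also have "(\<Sum>i\<le>n. (-1) ^ Suc i * coef_b \<delta> m (Suc n) (Suc i) * ?w (Suc i))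
      = (\<Sum>i\<le>n. (-1) ^ Suc i * (?b (Suc i) * (1 - ?e (Suc i) / ?L)) * ?w (Suc i)) + (\<Sum>i\<le>n. (-1) ^ Suc i * (?b i / ?L) * ?w (Suc i))"
    unfolding sum.distrib[symmetric]
    by (intro sum.cong refl) (simp add: coef_b_rec[OF \<delta>] algebra_simps)
  also have "1 + ((\<Sum>i\<le>n. (-1) ^ Suc i * (?b (Suc i) * (1 - ?e (Suc i) / ?L)) * ?w (Suc i)) + (\<Sum>i\<le>n. (-1) ^ Suc i * (?b i / ?L) * ?w (Suc i)))
      = (\<Sum>i\<le>Suc n. (-1) ^ i * (?b i * (1 - ?e i / ?L)) * ?w i) + (\<Sum>i\<le>n. (-1) ^ Suc i * (?b i / ?L) * ?w (Suc i))"
    by (subst sum.atMost_Suc_shift[where g = "\<lambda>i. (-1) ^ i * (?b i * (1 - ?e i / ?L)) * ?w i"]) simp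
  also have "\<dots> = (\<Sum>i\<le>n. (-1) ^ i * (?b i * (1 - ?e i / ?L)) * ?w i) + (\<Sum>i\<le>n. (-1) ^ Suc i * (?b i / ?L) * ?w (Suc i))"
    by (simp add: bn)
  also have "\<dots> = (\<Sum>i\<le>n. (-1) ^ i * ?b i * ?w i) * (1 - x / ?L)"
    unfolding sum.distrib[symmetric] sum_distrib_right
    by (intro sum.cong refl) (use L in \<open>simp add: newton_basis_Suc field_simps\<close>)
  also have "\<dots> = (\<Prod>j\<in>{m + 1..m + Suc n}. (1 - x / ?e j))"
    unfolding Suc.IH by simp
  finally show ?case .
qed

text \<open>Each difference of eigenvalues splits as
  \<open>(i - s) (1 - (i + s - 1) \<delta>)\<close>; the second factors form the product over
  \<open>{i - 1..2 * i - 2}\<close> in the denominator of \<open>coef_a\<close>.\<close>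

lemma newton_basis_diag:
  assumes "0 < i"
  shows "newton_basis \<delta> 1 i (eigval \<delta> 1 i) = fact i * (\<Prod>j\<in>{i - 1..2 * i - 2}. (1 - real j * \<delta>))"
proof -
  have "newton_basis \<delta> 1 i (eigval \<delta> 1 i) = (\<Prod>s<i. (real i - real s)) * (\<Prod>s<i. (1 - (real i + real s - 1) * \<delta>))"
    unfolding newton_basis_def eigval_diff by (rule prod.distrib)
  also have "(\<Prod>s<i. (real i - real s)) = fact i"
    unfolding fact_prod_rev by (auto simp: of_nat_diff lessThan_atLeast0 intro!: prod.cong)
  also have "(\<Prod>s<i. (1 - (real i + real s - 1) * \<delta>)) = (\<Prod>j\<in>{i - 1..2 * i - 2}. (1 - real j * \<delta>))"
    using assms by (intro prod.reindex_bij_witness[of _ "\<lambda>j. j - (i - 1)" "\<lambda>s. i - 1 + s"])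
      (auto simp: of_nat_diff algebra_simps)
  finally show ?thesis .
qed

text \<open>For \<open>i \<le> m\<close> both sides are \<open>(m + n)! / (m - i)!\<close>. The
  induction on \<open>n\<close> rests on the two ways of splitting a factor off a falling
  factorial.\<close>

lemma ffac_shift_prod:
  "ffac (real m) i * (\<Prod>t<n. (real m + 1 + real t)) = ffac (real (m + n)) i * (\<Prod>t<n. (real m + 1 + real t - real i))"
proof (induction n)
  case (Suc n)
  have e: "ffac (real (m + n)) i * (real m + 1 + real n) = ffac (real (m + Suc n)) i * (real m + 1 + real n - real i)"
    using ffac_Suc_shift[of "real (m + n)" i] ffac_Suc[of "real (m + n) + 1" i] by (simp add: algebra_simps)
  have "F0 * (P * c) = F2 * (P' * d)" if "F0 * P = F1 * P'" "F1 * c = F2 * d" for F0 F1 F2 P P' c d :: real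
  proof -
    have "F0 * (P * c) = (F1 * c) * P'" using that(1) by (simp add: mult.assoc[symmetric])
    also have "\<dots> = F2 * (P' * d)" unfolding that(2) by simp
    finally show ?thesis .
  qed
  from this[OF Suc e] show ?case unfolding prod.lessThan_Suc .
qed simp

lemma ffac_eq_binomial: "i \<le> m \<Longrightarrow> ffac (real m) i = real (m choose i) * fact i"
  unfolding ffac_def using gbinomial_mult_fact'[of "real m" i] by (simp add: binomial_gbinomial atLeast0LessThan)

text \<open>Explains the shape of \<open>coef_a\<close>: it is the product polynomial at the
  \<open>i\<close>-th eigenvalue, divided by the constants that relate the squared expectation to
  the squared coefficient at \<open>p_i\<close>. Hence its term cancels the contribution of index
  \<open>i\<close> to the Newton sum.\<close>

lemma coef_a_newton:
  assumes \<delta>: "\<delta> \<le> 0" and i: "0 < i" "i \<le> m" and n: "0 < n" and e: "expect f (\<lambda>x. qpoly \<delta> \<beta> \<gamma> x ^ i) \<noteq> 0"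
  shows "coef_a f \<delta> \<beta> \<gamma> m n i * newton_basis \<delta> 1 i (eigval \<delta> 1 i) * expect f (\<lambda>x. qpoly \<delta> \<beta> \<gamma> x ^ i)
    = (\<Prod>j\<in>{m + 1..m + n}. (1 - eigval \<delta> 1 i / eigval \<delta> 1 j))"
proof -
  let ?P = "\<Prod>t<n. (real m + 1 + real t)" and ?P' = "\<Prod>t<n. (real m + 1 + real t - real i)"
  let ?Q = "\<Prod>t<n. (1 - real (m + t) * \<delta>)" and ?Q' = "\<Prod>t<n. (1 - real (m + i + t) * \<delta>)"
  have r1: "(\<Prod>j\<in>{m+i..m+n+i-1}. (1 - real j * \<delta>)) = ?Q'"
    using n by (intro prod.reindex_bij_witness[of _ "\<lambda>t. m + i + t" "\<lambda>j. j - (m + i)"]) auto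
  have r2: "(\<Prod>j\<in>{m..m+n-1}. (1 - real j * \<delta>)) = ?Q"
    using n by (intro prod.reindex_bij_witness[of _ "\<lambda>t. m + t" "\<lambda>j. j - m"]) auto
  have P: "?P > 0" by (intro prod_pos) (auto intro: add_nonneg_pos)
  have Q: "?Q > 0" by (intro prod_pos ballI one_minus_pos \<delta>)
  have F: "ffac (real (m + n)) i > 0" using i by (intro ffac_pos) auto
  have D: "(\<Prod>j\<in>{i-1..2*i-2}. (1 - real j * \<delta>)) > 0" by (rule prod_one_minus_pos[OF \<delta>])
  have "(\<Prod>j\<in>{m + 1..m + n}. (1 - eigval \<delta> 1 i / eigval \<delta> 1 j))
      = (\<Prod>t<n. (1 - eigval \<delta> 1 i / eigval \<delta> 1 (m + 1 + t)))"
    by (intro prod.reindex_bij_witness[of _ "\<lambda>t. m + 1 + t" "\<lambda>j. j - (m + 1)"]) auto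
  also have "\<dots> = (\<Prod>t<n. ((real m + 1 + real t - real i) * (1 - real (m + i + t) * \<delta>))
      / ((real m + 1 + real t) * (1 - real (m + t) * \<delta>)))"
  proof (intro prod.cong refl)
    fix t
    have "eigval \<delta> 1 (m + 1 + t) \<noteq> 0" using eigval_pos[OF \<delta>, of 1 "m + 1 + t"] by simp
    then have "1 - eigval \<delta> 1 i / eigval \<delta> 1 (m + 1 + t) = (eigval \<delta> 1 (m + 1 + t) - eigval \<delta> 1 i) / eigval \<delta> 1 (m + 1 + t)"
      by (simp add: diff_divide_distrib)
    also have "\<dots> = ((real m + 1 + real t - real i) * (1 - real (m + i + t) * \<delta>))
      / ((real m + 1 + real t) * (1 - real (m + t) * \<delta>))"
    proof -
      have "eigval \<delta> 1 (m + 1 + t) - eigval \<delta> 1 i = (real m + 1 + real t - real i) * (1 - real (m + i + t) * \<delta>)"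
        unfolding eigval_diff by (simp add: algebra_simps)
      moreover have "eigval \<delta> 1 (m + 1 + t) = (real m + 1 + real t) * (1 - real (m + t) * \<delta>)"
        by (simp add: eigval_def algebra_simps)
      ultimately show ?thesis by simp
    qed
    finally show "1 - eigval \<delta> 1 i / eigval \<delta> 1 (m + 1 + t) = ((real m + 1 + real t - real i) * (1 - real (m + i + t) * \<delta>))
      / ((real m + 1 + real t) * (1 - real (m + t) * \<delta>))" .
  qed
  also have "\<dots> = (?P' * ?Q') / (?P * ?Q)" by (simp only: prod_dividef prod.distrib)
  also have "?P' / ?P = ffac (real m) i / ffac (real (m + n)) i"
    using ffac_shift_prod[of m i n] P F by (simp add: field_simps)
  then have "(?P' * ?Q') / (?P * ?Q) = ffac (real m) i / ffac (real (m + n)) i * (?Q' / ?Q)"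
    by (simp only: times_divide_times_eq[symmetric])
  also have "\<dots> = coef_a f \<delta> \<beta> \<gamma> m n i * newton_basis \<delta> 1 i (eigval \<delta> 1 i) * expect f (\<lambda>x. qpoly \<delta> \<beta> \<gamma> x ^ i)"
  proof -
    have "C * a / F * (Q' / Q) = C * Q' / (F * E * D * Q) * (a * D) * E"
      if "F > 0" "E \<noteq> 0" "D > 0" "Q > 0" for C a F Q' Q E D :: real
      using that by (simp add: field_simps)
    from this[OF F e D Q] show ?thesis
      unfolding coef_a_def r1 r2 newton_basis_diag[OF i(1)] ffac_eq_binomial[OF i(2)] .
  qed
  finally show ?thesis by simp
qed

section \<open>Expansion of the energies\<close>

context pearson_weight
begin

lemma iterated_weight:
  "pearson_weight \<alpha> \<omega> \<delta> \<beta> \<gamma> (A + real i * \<beta>) (B - 2 * real i * \<delta>) (\<lambda>x. q x ^ i * w x)"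
proof (induction i)
  case 0
  show ?case using pearson_weight_axioms by simp
next
  case (Suc i)
  interpret W: pearson_weight \<alpha> \<omega> \<delta> \<beta> \<gamma> "A + real i * \<beta>" "B - 2 * real i * \<delta>" "\<lambda>x. q x ^ i * w x" by (rule Suc)
  have e: "A + real (Suc i) * \<beta> = A + real i * \<beta> + \<beta>" "B - 2 * real (Suc i) * \<delta> = B - 2 * real i * \<delta> - 2 * \<delta>"
    by (simp_all add: algebra_simps)
  show ?case unfolding e using W.next_weight by (simp add: mult.assoc)
qed

lemma zero_of_integral_zero:
  assumes h: "continuous_on J h" and i: "integrable lborel (\<lambda>x. (h x)\<^sup>2 * w x)"
    and z: "(LINT x|lborel. (h x)\<^sup>2 * w x) = 0" and x: "x \<in> J"
  shows "h x = 0"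
proof -
  have "AE x in lborel. (h x)\<^sup>2 * w x = 0"
    using z w_nonneg by (subst (asm) integral_nonneg_eq_0_iff_AE[OF i]) auto
  then have z': "(LINT t|lborel. indicator {..y} t * ((h t)\<^sup>2 * w t)) = 0" for y
    by (intro integral_eq_zero_AE) auto
  have "continuous_on J (\<lambda>x. (h x)\<^sup>2 * w x)"
    by (intro continuous_on_mult continuous_on_power h continuous_w)
  from has_real_derivative_cumulative[OF i this x]
  have "((\<lambda>x. 0) has_real_derivative (h x)\<^sup>2 * w x) (at x)" unfolding z' .
  then have "(h x)\<^sup>2 * w x = 0" using DERIV_const DERIV_unique by blast
  then show ?thesis using w_pos[OF x] by simp
qed

lemma poly_sq_integral_pos:
  assumes "p \<noteq> 0"
  shows "0 < (LINT x|lborel. (poly p x)\<^sup>2 * w x)"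
proof -
  have i: "integrable lborel (\<lambda>x. (poly p x)\<^sup>2 * w x)" using poly_moments[of "p\<^sup>2"] by simp
  have "(LINT x|lborel. (poly p x)\<^sup>2 * w x) \<noteq> 0"
  proof
    assume z: "(LINT x|lborel. (poly p x)\<^sup>2 * w x) = 0"
    have "continuous_on J (poly p)" by (intro continuous_intros)
    then have "J \<subseteq> {x. poly p x = 0}" using zero_of_integral_zero[OF _ i z] by auto
    then have "finite J" using poly_roots_finite[OF assms] finite_subset by blast
    moreover have "infinite J" using einterval_nonempty[OF ivl] finite_imp_not_open[of J] by auto
    ultimately show False by simp
  qed
  moreover have "0 \<le> (LINT x|lborel. (poly p x)\<^sup>2 * w x)"
    using w_nonneg by (intro integral_nonneg_AE) auto
  ultimately show ?thesis by simp
qed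

lemma chain_measurable:
  assumes "\<And>i. i < n \<Longrightarrow> ac_deriv J (G i) (G (Suc i))" "0 < n" "i \<le> n"
  shows "(\<lambda>x. indicator J x * G i x) \<in> borel_measurable borel"
proof (cases "i < n")
  case True
  then show ?thesis by (intro continuous_measurable ac_deriv_continuous[OF assms(1)])
next
  case False
  then obtain k where "i = Suc k" "k < n" using assms(2,3) by (cases i) auto
  then show ?thesis using ac_deriv_measurable[OF assms(1) ivl, of k] by simp
qed

text \<open>\<open>Hclass\<close> requires square integrability of order \<open>n\<close> only;
  \<open>hardy\<close> for the weights \<open>q^k w\<close> brings it down to every lower
  order.\<close>

lemma chain_square_integrable:
  assumes ac: "\<And>i. i < n \<Longrightarrow> ac_deriv J (G i) (G (Suc i))"
    and top: "integrable lborel (\<lambda>x. (G n x)\<^sup>2 * (q x ^ n * w x))" and i: "i \<le> n"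
  shows "integrable lborel (\<lambda>x. (G i x)\<^sup>2 * (q x ^ i * w x))"
  using i
proof (induction rule: inc_induct)
  case base
  show ?case by (rule top)
next
  case (step k)
  interpret W: pearson_weight \<alpha> \<omega> \<delta> \<beta> \<gamma> "A + real k * \<beta>" "B - 2 * real k * \<delta>" "\<lambda>x. q x ^ k * w x"
    by (rule iterated_weight)
  show ?case using W.hardy[OF ac[OF step.hyps(2)]] step.IH by (simp add: mult.assoc)
qed

text \<open>One integration by parts for the weight \<open>q^i w\<close>, for which the
  \<open>i\<close>-th derivative of \<open>p\<close> is again an eigenpolynomial; its eigenvalue
  supplies the next Newton factor.\<close>

lemma eigen_step:
  assumes ac: "ac_deriv J (G i) (G (Suc i))"
    and int: "\<And>j. j \<le> d \<Longrightarrow> integrable lborel (\<lambda>x. x ^ j * (G (Suc i) x * (q x ^ Suc i * w x)))"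
    and p: "degree ((pderiv ^^ i) p) \<le> Suc d" "pearson_op \<delta> \<beta> \<gamma> A B p = smult (- l) p"
  shows "(LINT x|lborel. G (Suc i) x * poly ((pderiv ^^ Suc i) p) x * (q x ^ Suc i * w x))
    = (l - eigval \<delta> B i) * (LINT x|lborel. G i x * poly ((pderiv ^^ i) p) x * (q x ^ i * w x))"
proof -
  interpret W: pearson_weight \<alpha> \<omega> \<delta> \<beta> \<gamma> "A + real i * \<beta>" "B - 2 * real i * \<delta>" "\<lambda>x. q x ^ i * w x"
    by (rule iterated_weight)
  let ?r = "(pderiv ^^ i) p"
  have "integrable lborel (\<lambda>x. x ^ j * (G (Suc i) x * (q x * (q x ^ i * w x))))" if "j \<le> d" for j
    using int[OF that] by (simp add: mult.assoc)
  from W.adjoint_poly[OF ac this p(1)]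
  have "(LINT x|lborel. G (Suc i) x * poly (pderiv ?r) x * (q x * (q x ^ i * w x)))
    = - (LINT x|lborel. (- (l - eigval \<delta> B i)) * (G i x * poly ?r x * (q x ^ i * w x)))"
    unfolding pearson_op_higher_pderiv[OF p(2)] by (simp add: mult_ac)
  also have "\<dots> = (l - eigval \<delta> B i) * (LINT x|lborel. G i x * poly ?r x * (q x ^ i * w x))"
    by (subst integral_mult_right_zero) (simp add: algebra_simps)
  finally show ?thesis by (simp add: mult.assoc)
qed

lemma eigen_moment_L2:
  assumes ac: "\<And>i. i < n \<Longrightarrow> ac_deriv J (G i) (G (Suc i))" and n: "0 < n"
    and sq: "\<And>i. i \<le> n \<Longrightarrow> integrable lborel (\<lambda>x. (G i x)\<^sup>2 * (q x ^ i * w x))"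
    and p: "pearson_op \<delta> \<beta> \<gamma> A B p = smult (- l) p" and i: "i \<le> n"
  shows "(LINT x|lborel. G i x * poly ((pderiv ^^ i) p) x * (q x ^ i * w x))
    = newton_basis \<delta> B i l * (LINT x|lborel. G 0 x * poly p x * w x)"
  using i
proof (induction i)
  case (Suc i)
  interpret W: pearson_weight \<alpha> \<omega> \<delta> \<beta> \<gamma> "A + real (Suc i) * \<beta>" "B - 2 * real (Suc i) * \<delta>" "\<lambda>x. q x ^ Suc i * w x"
    by (rule iterated_weight)
  have "integrable lborel (\<lambda>x. x ^ j * (G (Suc i) x * (q x ^ Suc i * w x)))" for j
    by (rule W.integrable_power_times_w[OF sq[OF Suc.prems] chain_measurable[of n G "Suc i", OF ac n Suc.prems]])
  from eigen_step[of G i "degree ((pderiv ^^ i) p)" p l, OF ac this _ p] Suc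
  show ?case by (simp add: newton_basis_Suc mult_ac)
qed simp

text \<open>For orders above \<open>n\<close> square integrability may fail. Descending from order
  \<open>k\<close> to order \<open>i\<close> gains \<open>k - i\<close> powers of \<open>x\<close>,
  while the \<open>i\<close>-th derivative of \<open>p\<close> has degree at most
  \<open>k - i\<close>; the two counts match, so every pairing on the way is integrable.\<close>

lemma eigen_moment_L1:
  assumes ac: "\<And>i. i < k \<Longrightarrow> ac_deriv J (G i) (G (Suc i))"
    and top: "integrable lborel (\<lambda>x. G k x * (q x ^ k * w x))"
    and p: "pearson_op \<delta> \<beta> \<gamma> A B p = smult (- l) p" "degree p \<le> k"
  shows "(LINT x|lborel. G k x * poly ((pderiv ^^ k) p) x * (q x ^ k * w x))
    = newton_basis \<delta> B k l * (LINT x|lborel. G 0 x * poly p x * w x)"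
proof -
  have int: "\<forall>j\<le>k - i. integrable lborel (\<lambda>x. x ^ j * (G i x * (q x ^ i * w x)))" if "i \<le> k" for i
    using that
  proof (induction rule: inc_induct)
    case base
    show ?case using top by simp
  next
    case (step i)
    interpret W: pearson_weight \<alpha> \<omega> \<delta> \<beta> \<gamma> "A + real i * \<beta>" "B - 2 * real i * \<delta>" "\<lambda>x. q x ^ i * w x"
      by (rule iterated_weight)
    have "integrable lborel (\<lambda>x. x ^ j * (G (Suc i) x * (q x * (q x ^ i * w x))))" if "j \<le> k - Suc i" for j
      using step.IH that by (simp add: mult.assoc)
    from W.moments_step[OF ac[OF step.hyps(2)] this] show ?case
      using step.hyps(2) by (auto simp: Suc_diff_Suc)
  qed
  have deg: "degree ((pderiv ^^ i) p) \<le> k - i" for i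
    using p(2) by (induction i) (auto simp: degree_pderiv)
  have "(LINT x|lborel. G i x * poly ((pderiv ^^ i) p) x * (q x ^ i * w x))
    = newton_basis \<delta> B i l * (LINT x|lborel. G 0 x * poly p x * w x)" if "i \<le> k" for i
    using that
  proof (induction i)
    case (Suc i)
    have "(LINT x|lborel. G (Suc i) x * poly ((pderiv ^^ Suc i) p) x * (q x ^ Suc i * w x))
      = (l - eigval \<delta> B i) * (LINT x|lborel. G i x * poly ((pderiv ^^ i) p) x * (q x ^ i * w x))"
      by (rule eigen_step[of G i "k - Suc i" p l, OF ac _ _ p(1)])
         (use Suc.prems int[OF Suc.prems] deg[of i] in \<open>auto simp: Suc_diff_Suc\<close>)
    then show ?case using Suc by (simp add: newton_basis_Suc mult_ac)
  qed simp
  then show ?thesis by simp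
qed

lemma poly_chain:
  "ac_deriv J (poly ((pderiv ^^ i) p)) (poly ((pderiv ^^ Suc i) p))"
  "integrable lborel (\<lambda>x. (poly ((pderiv ^^ i) p) x)\<^sup>2 * (q x ^ i * w x))"
proof -
  interpret W: pearson_weight \<alpha> \<omega> \<delta> \<beta> \<gamma> "A + real i * \<beta>" "B - 2 * real i * \<delta>" "\<lambda>x. q x ^ i * w x"
    by (rule iterated_weight)
  show "ac_deriv J (poly ((pderiv ^^ i) p)) (poly ((pderiv ^^ Suc i) p))"
    by (rule ac_deriv_C1) (auto intro!: poly_DERIV continuous_intros)
  show "integrable lborel (\<lambda>x. (poly ((pderiv ^^ i) p) x)\<^sup>2 * (q x ^ i * w x))"
    using W.poly_moments[of "((pderiv ^^ i) p)\<^sup>2"] by simp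
qed

section \<open>Projection onto eigenpolynomials and the remainder\<close>

abbreviation "p \<equiv> eigenpoly \<delta> \<beta> \<gamma> A B"
abbreviation "lam \<equiv> eigval \<delta> B"
abbreviation "sqnorm k \<equiv> (LINT x|lborel. (poly (p k) x)\<^sup>2 * w x)"

lemmas p_degree = eigenpoly(1)[OF \<delta> B, of \<beta> \<gamma> A]
  and p_lead = eigenpoly(2)[OF \<delta> B, of \<beta> \<gamma> A]
  and p_eigen = eigenpoly(3)[OF \<delta> B, of \<beta> \<gamma> A]

lemma sqnorm_pos: "0 < sqnorm k"
  using p_lead[of k] by (intro poly_sq_integral_pos) auto

lemma eigenpoly_orthogonal:
  assumes "j \<noteq> k"
  shows "(LINT x|lborel. poly (p j) x * poly (p k) x * w x) = 0"
proof -
  let ?I = "\<lambda>j k. LINT x|lborel. poly (p j) x * poly (p k) x * w x"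
  have "(LINT x|lborel. poly (pderiv (p j)) x * poly (pderiv (p k)) x * (q x * w x)) = lam k * ?I j k" for j k
    using eigen_moment_L2[of 1 "\<lambda>i. poly ((pderiv ^^ i) (p j))" "p k" "lam k" 1, OF poly_chain(1) _ poly_chain(2) p_eigen]
    by (simp add: newton_basis_def)
  from this[of j k] this[of k j] have "lam k * ?I j k = lam j * ?I k j" by (simp add: mult_ac)
  moreover have "?I k j = ?I j k" by (simp add: mult_ac)
  moreover have "lam k \<noteq> lam j"
    using eigval_strict_mono[OF \<delta> B, of j k] eigval_strict_mono[OF \<delta> B, of k j] assms by (cases "j < k") auto
  ultimately show ?thesis by simp
qed

lemma pderiv_chain_eigen:
  assumes "i \<le> n" "0 < n"
  shows "(LINT x|lborel. poly ((pderiv ^^ i) r) x * poly ((pderiv ^^ i) (p k)) x * (q x ^ i * w x))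
    = newton_basis \<delta> B i (lam k) * (LINT x|lborel. poly r x * poly (p k) x * w x)"
  using eigen_moment_L2[of n "\<lambda>i. poly ((pderiv ^^ i) r)" "p k" "lam k" i, OF poly_chain(1) _ poly_chain(2) p_eigen] assms
  by simp


definition fcoef :: "(real \<Rightarrow> real) \<Rightarrow> nat \<Rightarrow> real" where
  "fcoef g k = (LINT x|lborel. g x * poly (p k) x * w x) / sqnorm k"

definition proj :: "(real \<Rightarrow> real) \<Rightarrow> nat \<Rightarrow> real poly" where
  "proj g N = (\<Sum>k\<le>N. smult (fcoef g k) (p k))"

definition energy :: "(nat \<Rightarrow> real \<Rightarrow> real) \<Rightarrow> nat \<Rightarrow> real" where
  "energy G i = (LINT x|lborel. (G i x)\<^sup>2 * (q x ^ i * w x))"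

abbreviation "rest G N \<equiv> (\<lambda>i x. G i x - poly ((pderiv ^^ i) (proj (G 0) N)) x)"

lemma energy_nonneg: "0 \<le> energy G i"
proof -
  have "0 \<le> q x ^ i * w x" for x
    using q_pos[of x] w_nonneg[of x] w_zero[of x] by (cases "x \<in> J") auto
  then show ?thesis unfolding energy_def by (intro integral_nonneg_AE) auto
qed

lemma fcoef_sqnorm: "(LINT x|lborel. g x * poly (p k) x * w x) = fcoef g k * sqnorm k"
  using sqnorm_pos[of k] by (simp add: fcoef_def)

lemma combination_inner:
  "(LINT x|lborel. poly (\<Sum>j\<le>N. smult (f j) (p j)) x * poly (p k) x * w x) = (if k \<le> N then f k * sqnorm k else 0)"
proof -
  have i: "integrable lborel (\<lambda>x. poly (p j) x * poly (p k) x * w x)" for j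
    using poly_moments[of "p j * p k"] by simp
  have "(LINT x|lborel. poly (\<Sum>j\<le>N. smult (f j) (p j)) x * poly (p k) x * w x)
      = (LINT x|lborel. (\<Sum>j\<le>N. f j * (poly (p j) x * poly (p k) x * w x)))"
    by (intro Bochner_Integration.integral_cong refl) (simp add: poly_sum sum_distrib_right mult.assoc)
  also have "\<dots> = (\<Sum>j\<le>N. f j * (LINT x|lborel. poly (p j) x * poly (p k) x * w x))"
    using i by (subst Bochner_Integration.integral_sum) auto
  also have "\<dots> = (\<Sum>j\<le>N. if j = k then f k * sqnorm k else 0)"
    by (intro sum.cong refl) (auto simp: eigenpoly_orthogonal power2_eq_square)
  finally show ?thesis by simp
qed

lemma fcoef_proj: "fcoef (poly (\<Sum>j\<le>N. smult (f j) (p j))) k = (if k \<le> N then f k else 0)"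
  unfolding fcoef_def combination_inner using sqnorm_pos[of k] by simp

context
  fixes G :: "nat \<Rightarrow> real \<Rightarrow> real" and n :: nat
  assumes ac: "\<And>i. i < n \<Longrightarrow> ac_deriv J (G i) (G (Suc i))" and n: "0 < n"
    and top: "integrable lborel (\<lambda>x. (G n x)\<^sup>2 * (q x ^ n * w x))"
begin

lemma rest_ac: "i < n \<Longrightarrow> ac_deriv J (rest G N i) (rest G N (Suc i))"
  by (rule ac_deriv_diff[OF ac poly_chain(1)])

lemma cross_integrable:
  assumes "i \<le> n"
  shows "integrable lborel (\<lambda>x. poly ((pderiv ^^ i) r) x * G i x * (q x ^ i * w x))"
proof -
  interpret W: pearson_weight \<alpha> \<omega> \<delta> \<beta> \<gamma> "A + real i * \<beta>" "B - 2 * real i * \<delta>" "\<lambda>x. q x ^ i * w x"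
    by (rule iterated_weight)
  show ?thesis
    by (rule W.integrable_poly_times_w[OF chain_square_integrable[OF ac top assms] chain_measurable[of n G i, OF ac n assms]])
qed

lemma rest_square_integrable:
  assumes "i \<le> n"
  shows "integrable lborel (\<lambda>x. (rest G N i x)\<^sup>2 * (q x ^ i * w x))"
proof -
  let ?T = "poly ((pderiv ^^ i) (proj (G 0) N))"
  have "integrable lborel (\<lambda>x. (G i x)\<^sup>2 * (q x ^ i * w x) - 2 * (?T x * G i x * (q x ^ i * w x)) + (?T x)\<^sup>2 * (q x ^ i * w x))"
    by (intro Bochner_Integration.integrable_add Bochner_Integration.integrable_diff integrable_mult_right
        chain_square_integrable[OF ac top assms] cross_integrable[OF assms] poly_chain(2))
  then show ?thesis by (simp add: power2_eq_square algebra_simps)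
qed

text \<open>At order 0 this is the definition of the projection. Passing to order \<open>i\<close>
  multiplies the pairing with an eigenpolynomial by a Newton factor, so it stays zero, and the
  eigenpolynomials up to \<open>N\<close> span all degrees up to \<open>N\<close>.\<close>

lemma rest_orthogonal:
  assumes i: "i \<le> n" and r: "degree r \<le> N"
  shows "(LINT x|lborel. poly ((pderiv ^^ i) r) x * rest G N i x * (q x ^ i * w x)) = 0"
    and "integrable lborel (\<lambda>x. poly ((pderiv ^^ i) r) x * rest G N i x * (q x ^ i * w x))"
proof -
  interpret W: pearson_weight \<alpha> \<omega> \<delta> \<beta> \<gamma> "A + real i * \<beta>" "B - 2 * real i * \<delta>" "\<lambda>x. q x ^ i * w x"
    by (rule iterated_weight)
  have int: "integrable lborel (\<lambda>x. poly s x * rest G N i x * (q x ^ i * w x))" for s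
    by (rule W.integrable_poly_times_w[OF rest_square_integrable[OF i] chain_measurable[of n "rest G N" i, OF rest_ac n i]])
  then show "integrable lborel (\<lambda>x. poly ((pderiv ^^ i) r) x * rest G N i x * (q x ^ i * w x))" .
  have zero: "(LINT x|lborel. rest G N i x * poly ((pderiv ^^ i) (p k)) x * (q x ^ i * w x)) = 0" if "k \<le> N" for k
  proof -
    have iG: "integrable lborel (\<lambda>x. G 0 x * poly (p k) x * w x)"
      using cross_integrable[of 0 "p k"] by (simp add: mult_ac)
    have iT: "integrable lborel (\<lambda>x. poly (proj (G 0) N) x * poly (p k) x * w x)"
      using poly_moments[of "proj (G 0) N * p k"] by simp
    have "(LINT x|lborel. rest G N 0 x * poly (p k) x * w x)
        = (LINT x|lborel. G 0 x * poly (p k) x * w x - poly (proj (G 0) N) x * poly (p k) x * w x)"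
      by (simp add: left_diff_distrib)
    also have "\<dots> = 0"
      unfolding Bochner_Integration.integral_diff[OF iG iT]
      unfolding proj_def combination_inner unfolding fcoef_sqnorm[of "G 0"] using that by simp
    finally show ?thesis
      using eigen_moment_L2[of n "rest G N" "p k" "lam k" i, OF rest_ac n rest_square_integrable p_eigen i] by simp
  qed
  obtain f where f: "r = (\<Sum>k\<le>N. smult (f k) (p k))" by (rule eigenpoly_span[OF \<delta> B r])
  have "(LINT x|lborel. poly ((pderiv ^^ i) r) x * rest G N i x * (q x ^ i * w x))
      = (LINT x|lborel. (\<Sum>k\<le>N. f k * (poly ((pderiv ^^ i) (p k)) x * rest G N i x * (q x ^ i * w x))))"
    unfolding f higher_pderiv_sum higher_pderiv_smult
    by (intro Bochner_Integration.integral_cong refl) (simp add: poly_sum sum_distrib_right mult.assoc)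
  also have "\<dots> = (\<Sum>k\<le>N. f k * (LINT x|lborel. poly ((pderiv ^^ i) (p k)) x * rest G N i x * (q x ^ i * w x)))"
    using int by (subst Bochner_Integration.integral_sum) auto
  also have "\<dots> = 0"
    using zero by (intro sum.neutral) (simp add: mult.commute)
  finally show "(LINT x|lborel. poly ((pderiv ^^ i) r) x * rest G N i x * (q x ^ i * w x)) = 0" .
qed

text \<open>The derivatives of the projection and of the remainder are orthogonal at each order, so
  the energies add without a cross term and the finite expansion is exact.\<close>

lemma energy_split:
  assumes i: "i \<le> n"
  shows "energy G i = (\<Sum>k\<le>N. (fcoef (G 0) k)\<^sup>2 * sqnorm k * newton_basis \<delta> B i (lam k)) + energy (rest G N) i"
proof -
  interpret W: pearson_weight \<alpha> \<omega> \<delta> \<beta> \<gamma> "A + real i * \<beta>" "B - 2 * real i * \<delta>" "\<lambda>x. q x ^ i * w x"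
    by (rule iterated_weight)
  let ?P = "proj (G 0) N" and ?D = "pderiv ^^ i"
  let ?T = "poly (?D ?P)"
  have deg: "degree ?P \<le> N"
    unfolding proj_def using p_degree by (intro degree_sum_le) (auto intro: order_trans[OF degree_smult_le])
  have "energy G i = (LINT x|lborel. (?T x)\<^sup>2 * (q x ^ i * w x) + 2 * (?T x * rest G N i x * (q x ^ i * w x))
      + (rest G N i x)\<^sup>2 * (q x ^ i * w x))"
    unfolding energy_def by (intro Bochner_Integration.integral_cong refl) (simp add: power2_eq_square algebra_simps)
  also have "\<dots> = (LINT x|lborel. (?T x)\<^sup>2 * (q x ^ i * w x)) + energy (rest G N) i"
    using poly_chain(2)[of i ?P] rest_orthogonal[OF i deg] rest_square_integrable[OF i, of N] unfolding energy_def by simp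
  also have "(LINT x|lborel. (?T x)\<^sup>2 * (q x ^ i * w x))
      = (LINT x|lborel. (\<Sum>k\<le>N. fcoef (G 0) k * (?T x * poly (?D (p k)) x * (q x ^ i * w x))))"
  proof (intro Bochner_Integration.integral_cong refl)
    fix x
    have "?T x = (\<Sum>k\<le>N. fcoef (G 0) k * poly (?D (p k)) x)"
      unfolding proj_def higher_pderiv_sum higher_pderiv_smult by (simp add: poly_sum)
    then have "?T x * (?T x * (q x ^ i * w x)) = (\<Sum>k\<le>N. fcoef (G 0) k * poly (?D (p k)) x) * (?T x * (q x ^ i * w x))"
      by (rule arg_cong)
    then show "(?T x)\<^sup>2 * (q x ^ i * w x) = (\<Sum>k\<le>N. fcoef (G 0) k * (?T x * poly (?D (p k)) x * (q x ^ i * w x)))"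
      unfolding sum_distrib_right by (simp add: power2_eq_square mult_ac)
  qed
  also have "\<dots> = (\<Sum>k\<le>N. fcoef (G 0) k * (LINT x|lborel. ?T x * poly (?D (p k)) x * (q x ^ i * w x)))"
  proof -
    have "integrable lborel (\<lambda>x. ?T x * poly (?D (p k)) x * (q x ^ i * w x))" for k
      using W.poly_moments[of "?D ?P * ?D (p k)"] by simp
    then show ?thesis by (subst Bochner_Integration.integral_sum) auto
  qed
  also have "\<dots> = (\<Sum>k\<le>N. (fcoef (G 0) k)\<^sup>2 * sqnorm k * newton_basis \<delta> B i (lam k))"
  proof (intro sum.cong refl)
    fix k assume "k \<in> {..N}"
    then have "(LINT x|lborel. poly ?P x * poly (p k) x * w x) = fcoef (G 0) k * sqnorm k"
      unfolding proj_def combination_inner by simp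
    then show "fcoef (G 0) k * (LINT x|lborel. ?T x * poly (?D (p k)) x * (q x ^ i * w x))
        = (fcoef (G 0) k)\<^sup>2 * sqnorm k * newton_basis \<delta> B i (lam k)"
      unfolding pderiv_chain_eigen[OF i n] by (simp add: power2_eq_square)
  qed
  finally show ?thesis .
qed

text \<open>A polynomial of degree at most \<open>N - i\<close> is the \<open>i\<close>-th
  derivative of one of degree at most \<open>N\<close>, so the remainder of order \<open>i\<close>
  is orthogonal to all of these. \<open>poincare\<close> for \<open>q^i w\<close> then has a
  constant equal to \<open>lam (Suc N) - lam i\<close>.\<close>

lemma rest_poincare:
  assumes i: "i < n" and N: "n \<le> N"
  shows "(lam (Suc N) - lam i) * energy (rest G N) i \<le> energy (rest G N) (Suc i)"
proof -
  interpret W: pearson_weight \<alpha> \<omega> \<delta> \<beta> \<gamma> "A + real i * \<beta>" "B - 2 * real i * \<delta>" "\<lambda>x. q x ^ i * w x"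
    by (rule iterated_weight)
  have orth: "(LINT x|lborel. poly r x * rest G N i x * (q x ^ i * w x)) = 0" if "degree r \<le> N - i" for r
  proof -
    have "\<exists>R. (pderiv ^^ k) R = r \<and> degree R \<le> degree r + k" for k
    proof (induction k)
      case (Suc k)
      then obtain R where R: "(pderiv ^^ k) R = r" "degree R \<le> degree r + k" by blast
      obtain R' where "pderiv R' = R" "degree R' \<le> Suc (degree R)" by (rule poly_antiderivative)
      with R show ?case by (intro exI[of _ R']) (auto simp: funpow_Suc_right simp del: funpow.simps)
    qed (auto intro: exI[of _ r])
    then obtain R where R: "(pderiv ^^ i) R = r" "degree R \<le> degree r + i" by blast
    then show ?thesis using rest_orthogonal(1)[of i R N] that i N by simp
  qed
  have "integrable lborel (\<lambda>x. (rest G N (Suc i) x)\<^sup>2 * (q x * (q x ^ i * w x)))"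
    using rest_square_integrable[of "Suc i" N] i by (simp add: mult.assoc)
  from poincare[OF W.pearson_weight_axioms rest_ac[OF i] this orth]
  have "real (N - i + 1) * (B - 2 * real i * \<delta> - real (N - i) * \<delta>) * energy (rest G N) i
      \<le> energy (rest G N) (Suc i)" unfolding energy_def by (simp add: mult.assoc)
  moreover have "real (N - i + 1) * (B - 2 * real i * \<delta> - real (N - i) * \<delta>) = lam (Suc N) - lam i"
    unfolding eigval_diff using i N by (simp add: of_nat_diff algebra_simps)
  ultimately show ?thesis by simp
qed

text \<open>The hypothesis concerns order 0 alone. Vanishing climbs the chain: zero energy and
  continuity give pointwise zero, which makes the next derivative zero almost everywhere.\<close>

lemma rest_energy_zero:
  assumes z: "\<And>x. x \<in> J \<Longrightarrow> rest G N 0 x = 0" and i: "i \<le> n"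
  shows "energy (rest G N) i = 0"
  using i
proof (induction i)
  case 0
  have "(\<lambda>x. (rest G N 0 x)\<^sup>2 * w x) = (\<lambda>x. 0)"
  proof
    fix x show "(rest G N 0 x)\<^sup>2 * w x = 0" using z[of x] w_zero[of x] by (cases "x \<in> J") simp_all
  qed
  then show ?case by (simp add: energy_def)
next
  case (Suc i)
  interpret W: pearson_weight \<alpha> \<omega> \<delta> \<beta> \<gamma> "A + real i * \<beta>" "B - 2 * real i * \<delta>" "\<lambda>x. q x ^ i * w x"
    by (rule iterated_weight)
  have i: "i < n" using Suc.prems by simp
  have z: "rest G N i x = 0" if "x \<in> J" for x
    using W.zero_of_integral_zero[OF ac_deriv_continuous[OF rest_ac[OF i]] rest_square_integrable _ that] Suc i
    by (simp add: energy_def)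
  have "AE x in lborel. x \<in> J \<longrightarrow> rest G N (Suc i) x = 0"
    by (rule ac_deriv_zero[OF rest_ac[OF i] ivl z])
  then have "AE x in lborel. (rest G N (Suc i) x)\<^sup>2 * (q x ^ Suc i * w x) = 0"
  proof eventually_elim
    case (elim x)
    then show ?case using w_zero[of x] by (cases "x \<in> J") simp_all
  qed
  then show ?case unfolding energy_def by (rule integral_eq_zero_AE)
qed

end

end

section \<open>Signs of the spectral factors and the inequality for energies\<close>

lemma sgn_prod_one_minus:
  "(-1) ^ card S * (\<Prod>j\<in>S. (1 - f j)) = (\<Prod>j\<in>S. (f j - 1 :: real))"
  using prod_uminus[of "\<lambda>j. 1 - f j" S] by simp

lemma spectral_factor_zero:
  assumes "\<delta> \<le> 0" "m < k" "k \<le> m + n"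
  shows "(\<Prod>j\<in>{m + 1..m + n}. (1 - eigval \<delta> 1 k / eigval \<delta> 1 j)) = 0"
  using assms eigval_pos[OF assms(1), of 1 k] by (intro prod_zero bexI[of _ k]) auto

lemma spectral_factor_sign:
  assumes "\<delta> \<le> 0" "m + n < k"
  shows "0 < (-1) ^ n * (\<Prod>j\<in>{m + 1..m + n}. (1 - eigval \<delta> 1 k / eigval \<delta> 1 j))"
proof -
  have "0 < (\<Prod>j\<in>{m + 1..m + n}. (eigval \<delta> 1 k / eigval \<delta> 1 j - 1))"
  proof (rule prod_pos)
    fix j assume j: "j \<in> {m + 1..m + n}"
    then have "0 < eigval \<delta> 1 j" "eigval \<delta> 1 j < eigval \<delta> 1 k"
      using assms eigval_pos[OF assms(1), of 1 j] eigval_strict_mono[OF assms(1), of 1 j k] by auto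
    then show "0 < eigval \<delta> 1 k / eigval \<delta> 1 j - 1" by simp
  qed
  then show ?thesis
    using sgn_prod_one_minus[of "{m + 1..m + n}" "\<lambda>j. eigval \<delta> 1 k / eigval \<delta> 1 j"] by simp
qed

text \<open>If each energy exceeds its predecessor by the factor \<open>K\<close>, then all terms
  below the top together amount to at most half of the top term. The sum has the sign of its last
  term, and half of that term survives.\<close>

lemma alternating_sum_bound:
  fixes a b :: "nat \<Rightarrow> real"
  assumes n: "0 < n" and a: "\<And>i. 0 \<le> a i" and b: "\<And>i. i \<le> n \<Longrightarrow> 0 < b i"
    and K: "1 \<le> K" "2 * (\<Sum>i<n. b i) \<le> K * b n" and growth: "\<And>i. i < n \<Longrightarrow> K * a i \<le> a (Suc i)"
  shows "b n / 2 * a n \<le> (-1) ^ n * (\<Sum>i\<le>n. (-1) ^ i * b i * a i)" and "a 0 \<le> a n"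
proof -
  have mono: "a i \<le> a n" if "i \<le> n" for i
    using that
  proof (induction rule: inc_induct)
    case (step i)
    have "a i \<le> K * a i" using K(1) a[of i] mult_right_mono[of 1 K "a i"] by simp
    then show ?case using growth[of i] step by simp
  qed simp
  then show "a 0 \<le> a n" by simp
  have Ka: "K * a i \<le> a n" if "i < n" for i
    using growth[OF that] mono[of "Suc i"] that by simp
  have "- (\<Sum>i<n. b i * a i) \<le> (\<Sum>i<n. (-1) ^ (n + i) * (b i * a i))"
    unfolding sum_negf[symmetric]
  proof (rule sum_mono)
    fix i assume "i \<in> {..<n}"
    then have "0 \<le> b i * a i" using a b[of i] by (intro mult_nonneg_nonneg) (auto intro: less_imp_le)
    then show "- (b i * a i) \<le> (-1) ^ (n + i) * (b i * a i)"
      by (cases "even (n + i)") simp_all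
  qed
  moreover have "K * (\<Sum>i<n. b i * a i) \<le> (\<Sum>i<n. b i) * a n"
    unfolding sum_distrib_left sum_distrib_right
  proof (rule sum_mono)
    fix i assume "i \<in> {..<n}"
    then show "K * (b i * a i) \<le> b i * a n"
      using mult_left_mono[OF Ka[of i], of "b i"] b[of i] by (simp add: mult_ac)
  qed
  then have "2 * (K * (\<Sum>i<n. b i * a i)) \<le> K * b n * a n"
    using mult_right_mono[OF K(2) a[of n]] by simp
  then have "2 * (\<Sum>i<n. b i * a i) \<le> b n * a n"
    using K(1) mult_le_cancel_left_pos[of K "2 * (\<Sum>i<n. b i * a i)" "b n * a n"] by (simp add: mult_ac)
  moreover have "(-1) ^ n * (\<Sum>i\<le>n. (-1) ^ i * b i * a i) = (\<Sum>i<n. (-1) ^ (n + i) * (b i * a i)) + b n * a n"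
    by (simp add: lessThan_Suc_atMost[symmetric] distrib_left sum_distrib_left power_add mult_ac flip: power_mult_distrib)
  ultimately show "b n / 2 * a n \<le> (-1) ^ n * (\<Sum>i\<le>n. (-1) ^ i * b i * a i)"
    unfolding times_divide_eq_left by linarith
qed

context pearson_weight
begin

lemma energy_sum_bound:
  fixes G :: "nat \<Rightarrow> real \<Rightarrow> real" and m n :: nat
  assumes B1: "B = 1" and ac: "\<And>i. i < n \<Longrightarrow> ac_deriv J (G i) (G (Suc i))" and n: "0 < n"
    and top: "integrable lborel (\<lambda>x. (G n x)\<^sup>2 * (q x ^ n * w x))"
  defines "D \<equiv> (\<Sum>i\<le>n. (-1) ^ i * coef_b \<delta> m n i * energy G i)
      - (\<Sum>k\<le>m. (fcoef (G 0) k)\<^sup>2 * sqnorm k * (\<Prod>j\<in>{m + 1..m + n}. (1 - lam k / lam j)))"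
  shows "0 \<le> (-1) ^ n * D"
    and "D = 0 \<longleftrightarrow> (\<exists>r. degree r \<le> m + n \<and> (\<forall>x\<in>J. G 0 x = poly r x))"
proof -
  let ?b = "coef_b \<delta> m n"
  let ?P = "\<lambda>k. \<Prod>j\<in>{m + 1..m + n}. (1 - lam k / lam j)"
  let ?t = "\<lambda>k. (fcoef (G 0) k)\<^sup>2 * sqnorm k * ?P k"
  define K where "K = max 1 (2 * (\<Sum>i<n. ?b i) / ?b n)"
  \<comment> \<open>Since \<open>lam (Suc N) \<ge> N \<ge> K + lam n\<close>, every Poincare
    constant \<open>lam (Suc N) - lam i\<close> with \<open>i < n\<close> is at least
    \<open>K\<close>.\<close>
  define N where "N = max (m + n) (nat \<lceil>K + lam n\<rceil>)"
  have b: "0 < ?b i" if "i \<le> n" for i using coef_b_pos[OF \<delta> that] .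
  have N: "m + n \<le> N" by (simp add: N_def)
  have K: "1 \<le> K" "2 * (\<Sum>i<n. ?b i) \<le> K * ?b n"
  proof -
    have "2 * (\<Sum>i<n. ?b i) / ?b n \<le> K" by (simp add: K_def)
    then show "2 * (\<Sum>i<n. ?b i) \<le> K * ?b n" using b[of n] by (simp add: pos_divide_le_eq)
  qed (simp add: K_def)
  have growth: "K * energy (rest G N) i \<le> energy (rest G N) (Suc i)" if i: "i < n" for i
  proof -
    have "K + lam n \<le> real N" 
      unfolding N_def by (rule order_trans[OF real_nat_ceiling_ge]) simp
    also have "real N \<le> lam (Suc N)"
    proof -
      have "real N * \<delta> \<le> 0" using \<delta> by (intro mult_nonneg_nonpos) auto
      then have "real (Suc N) * 1 \<le> real (Suc N) * (1 - real N * \<delta>)" by (intro mult_left_mono) auto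
      also have "\<dots> = lam (Suc N)" by (simp add: eigval_def B1)
      finally show ?thesis by simp
    qed
    finally have "K \<le> lam (Suc N) - lam i"
      using eigval_strict_mono[OF \<delta> B i] by simp
    then have "K * energy (rest G N) i \<le> (lam (Suc N) - lam i) * energy (rest G N) i"
      by (intro mult_right_mono energy_nonneg)
    also have "\<dots> \<le> energy (rest G N) (Suc i)"
      using N by (intro rest_poincare[OF ac n top i]) auto
    finally show ?thesis .
  qed
  define R where "R = (\<Sum>i\<le>n. (-1) ^ i * ?b i * energy (rest G N) i)"
  have R: "?b n / 2 * energy (rest G N) n \<le> (-1) ^ n * R" and low: "energy (rest G N) 0 \<le> energy (rest G N) n"
    unfolding R_def
    by (rule alternating_sum_bound[of n "energy (rest G N)" ?b K, OF n energy_nonneg b K growth]; assumption)+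
  have split: "(\<Sum>i\<le>n. (-1) ^ i * ?b i * energy G i) = (\<Sum>k\<le>N. ?t k) + R"
  proof -
    have "(\<Sum>i\<le>n. (-1) ^ i * ?b i * energy G i)
        = (\<Sum>i\<le>n. (\<Sum>k\<le>N. (-1) ^ i * ?b i * ((fcoef (G 0) k)\<^sup>2 * sqnorm k * newton_basis \<delta> B i (lam k)))) + R"
      unfolding R_def sum.distrib[symmetric]
    proof (intro sum.cong refl)
      fix i assume "i \<in> {..n}"
      then show "(-1) ^ i * ?b i * energy G i = (\<Sum>k\<le>N. (-1) ^ i * ?b i * ((fcoef (G 0) k)\<^sup>2 * sqnorm k * newton_basis \<delta> B i (lam k)))
        + (-1) ^ i * ?b i * energy (rest G N) i"
        using energy_split[OF ac n top, of i N] by (simp add: distrib_left sum_distrib_left)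
    qed
    also have "(\<Sum>i\<le>n. (\<Sum>k\<le>N. (-1) ^ i * ?b i * ((fcoef (G 0) k)\<^sup>2 * sqnorm k * newton_basis \<delta> B i (lam k))))
        = (\<Sum>k\<le>N. (fcoef (G 0) k)\<^sup>2 * sqnorm k * (\<Sum>i\<le>n. (-1) ^ i * ?b i * newton_basis \<delta> B i (lam k)))"
      by (subst sum.swap) (simp add: sum_distrib_left mult_ac)
    finally show ?thesis unfolding B1 newton_expansion[OF \<delta>] .
  qed
  have "(\<Sum>k\<le>N. ?t k) = (\<Sum>k\<le>m. ?t k) + (\<Sum>k\<in>{m<..m + n}. ?t k) + (\<Sum>k\<in>{m + n<..N}. ?t k)"
  proof -
    have "{..N} = ({..m} \<union> {m<..m + n}) \<union> {m + n<..N}" using N by auto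
    then have "(\<Sum>k\<le>N. ?t k) = (\<Sum>k\<in>{..m} \<union> {m<..m + n}. ?t k) + (\<Sum>k\<in>{m + n<..N}. ?t k)"
      by (simp only:) (rule sum.union_disjoint; auto)
    also have "(\<Sum>k\<in>{..m} \<union> {m<..m + n}. ?t k) = (\<Sum>k\<le>m. ?t k) + (\<Sum>k\<in>{m<..m + n}. ?t k)"
      by (rule sum.union_disjoint) auto
    finally show ?thesis .
  qed
  moreover have "(\<Sum>k\<in>{m<..m + n}. ?t k) = 0"
    using spectral_factor_zero[OF \<delta>, of m _ n] unfolding B1 by (intro sum.neutral) auto
  ultimately have D: "D = (\<Sum>k\<in>{m + n<..N}. ?t k) + R"
    unfolding D_def split by simp
  have t: "(-1) ^ n * ?t k = (fcoef (G 0) k)\<^sup>2 * (sqnorm k * ((-1) ^ n * ?P k))" for k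
    by (simp add: mult_ac)
  have Ppos: "0 < sqnorm k * ((-1) ^ n * ?P k)" if "k \<in> {m + n<..N}" for k
  proof (rule mult_pos_pos[OF sqnorm_pos])
    show "0 < (-1) ^ n * ?P k"
      using spectral_factor_sign[OF \<delta>, of m n k] that unfolding B1 by simp
  qed
  have tn: "0 \<le> (-1) ^ n * ?t k" if "k \<in> {m + n<..N}" for k
    unfolding t by (rule mult_nonneg_nonneg[OF zero_le_power2 less_imp_le[OF Ppos[OF that]]])
  have D': "(-1) ^ n * D = (\<Sum>k\<in>{m + n<..N}. (-1) ^ n * ?t k) + (-1) ^ n * R"
    unfolding D by (simp add: distrib_left sum_distrib_left)
  have sum0: "0 \<le> (\<Sum>k\<in>{m + n<..N}. (-1) ^ n * ?t k)" using tn by (rule sum_nonneg)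
  have R0: "0 \<le> ?b n / 2 * energy (rest G N) n" using b[of n] energy_nonneg[of "rest G N" n] by simp
  show "0 \<le> (-1) ^ n * D" using sum0 R0 R unfolding D' by linarith
  show "D = 0 \<longleftrightarrow> (\<exists>r. degree r \<le> m + n \<and> (\<forall>x\<in>J. G 0 x = poly r x))"
  proof
    assume "D = 0"
    then have "(-1) ^ n * D = 0" by simp
    \<comment> \<open>Both parts of \<open>D'\<close> are nonnegative, so both vanish. The first
      annihilates the coefficients with index in \<open>{m + n<..N}\<close>; the second makes the
      remainder zero, so that \<open>G 0\<close> equals its projection on \<open>J\<close>.\<close>
    then have "(\<Sum>k\<in>{m + n<..N}. (-1) ^ n * ?t k) = 0" and "?b n / 2 * energy (rest G N) n = 0"
      using D' sum0 R0 R by linarith+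
    then have c0: "fcoef (G 0) k = 0" if "k \<in> {m + n<..N}" for k
    proof -
      have "(-1) ^ n * ?t k = 0"
        using \<open>(\<Sum>k\<in>{m + n<..N}. (-1) ^ n * ?t k) = 0\<close> sum_nonneg_eq_0_iff[of "{m + n<..N}" "\<lambda>k. (-1) ^ n * ?t k"] tn that
        by blast
      then have "(fcoef (G 0) k)\<^sup>2 = 0 \<or> sqnorm k * ((-1) ^ n * ?P k) = 0"
        unfolding t by (rule mult_eq_0_iff[THEN iffD1])
      then show ?thesis using order_less_imp_not_eq2[OF Ppos[OF that]] by (simp only: zero_eq_power2 simp_thms)
    qed
    have "energy (rest G N) n = 0" using \<open>?b n / 2 * energy (rest G N) n = 0\<close> b[of n] by simp
    then have "energy (rest G N) 0 = 0" using low energy_nonneg[of "rest G N" 0] by simp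
    then have "rest G N 0 x = 0" if "x \<in> J" for x
      using zero_of_integral_zero[OF ac_deriv_continuous[OF rest_ac[OF ac n top n]] _ _ that, of N]
        rest_square_integrable[OF ac n top, of 0 N] by (simp add: energy_def)
    then have "\<forall>x\<in>J. G 0 x = poly (proj (G 0) N) x" by simp
    moreover have "degree (proj (G 0) N) \<le> m + n"
      unfolding proj_def
    proof (rule degree_sum_le)
      fix k assume "k \<in> {..N}"
      then show "degree (smult (fcoef (G 0) k) (p k)) \<le> m + n"
        using c0[of k] p_degree[of k] by (cases "k \<le> m + n") auto
    qed simp
    ultimately show "\<exists>r. degree r \<le> m + n \<and> (\<forall>x\<in>J. G 0 x = poly r x)" by blast
  next
    assume "\<exists>r. degree r \<le> m + n \<and> (\<forall>x\<in>J. G 0 x = poly r x)"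
    then obtain r where r: "degree r \<le> m + n" "\<And>x. x \<in> J \<Longrightarrow> G 0 x = poly r x" by blast
    obtain f where f: "r = (\<Sum>k\<le>m + n. smult (f k) (p k))" by (rule eigenpoly_span[OF \<delta> B r(1)])
    have "fcoef (G 0) k = fcoef (poly r) k" for k
    proof -
      have eq: "G 0 x * poly (p k) x * w x = poly r x * poly (p k) x * w x" for x
        using r(2)[of x] w_zero[of x] by (cases "x \<in> J") auto
      show ?thesis unfolding fcoef_def by (simp only: eq)
    qed
    then have c: "fcoef (G 0) k = (if k \<le> m + n then f k else 0)" for k
      unfolding f fcoef_proj .
    \<comment> \<open>\<open>N\<close> is at least \<open>m + n\<close>, so the projection
      reproduces \<open>r\<close> and the remainder vanishes on \<open>J\<close>.\<close>
    have "proj (G 0) N = r"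
      unfolding proj_def f c
      by (rule sum.mono_neutral_cong_right) (use N in auto)
    then have z: "rest G N 0 x = 0" if "x \<in> J" for x using r(2)[OF that] by simp
    have "R = 0"
      unfolding R_def using rest_energy_zero[OF ac n top z] by (intro sum.neutral) auto
    moreover have "(\<Sum>k\<in>{m + n<..N}. ?t k) = 0" by (intro sum.neutral) (auto simp: c)
    ultimately show "D = 0" unfolding D by simp
  qed
qed

text \<open>The \<open>k\<close>-th derivative of the monic \<open>p k\<close> is the constant
  \<open>fact k\<close>, so pairing with it leaves the plain integral of \<open>G k\<close>. The
  second identity is the case where the function is \<open>p k\<close> itself, which expresses
  \<open>E[q^k]\<close> through \<open>sqnorm k\<close>.\<close>

lemma top_moment:
  assumes ac: "\<And>i. i < k \<Longrightarrow> ac_deriv J (G i) (G (Suc i))"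
    and top: "integrable lborel (\<lambda>x. G k x * (q x ^ k * w x))"
  shows "fact k * (LINT x|lborel. G k x * (q x ^ k * w x)) = newton_basis \<delta> B k (lam k) * (fcoef (G 0) k * sqnorm k)"
    and "(fact k)\<^sup>2 * (LINT x|lborel. q x ^ k * w x) = newton_basis \<delta> B k (lam k) * sqnorm k"
proof -
  have "degree ((pderiv ^^ k) (p k)) = 0"
  proof -
    have "degree ((pderiv ^^ i) (p k)) \<le> k - i" for i
      by (induction i) (auto simp: degree_pderiv p_degree)
    from this[of k] show ?thesis by simp
  qed
  moreover have "coeff ((pderiv ^^ k) (p k)) 0 = fact k"
    using p_lead[of k] by (simp add: coeff_higher_pderiv pochhammer_fact)
  ultimately have const: "poly ((pderiv ^^ k) (p k)) x = fact k" for x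
    by (metis degree_eq_zeroE coeff_pCons_0 poly_pCons poly_0 mult_zero_right add.right_neutral)
  show "fact k * (LINT x|lborel. G k x * (q x ^ k * w x)) = newton_basis \<delta> B k (lam k) * (fcoef (G 0) k * sqnorm k)"
    using eigen_moment_L1[of k G "p k" "lam k", OF ac top p_eigen] fcoef_sqnorm[of "G 0" k] p_degree[of k]
    by (simp add: const mult_ac)
  have "(LINT x|lborel. poly ((pderiv ^^ k) (p k)) x * poly ((pderiv ^^ k) (p k)) x * (q x ^ k * w x))
      = newton_basis \<delta> B k (lam k) * (LINT x|lborel. poly (p k) x * poly (p k) x * w x)"
    by (rule pderiv_chain_eigen[of k "Suc k"]) auto
  then show "(fact k)\<^sup>2 * (LINT x|lborel. q x ^ k * w x) = newton_basis \<delta> B k (lam k) * sqnorm k"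
    by (simp add: const power2_eq_square mult.assoc)
qed

end

section \<open>Integrated Pearson densities\<close>

lemma AE_interval_not_empty:
  assumes "a < b" shows "\<not> (AE x in lborel. x \<notin> {a<..<b :: real})"
proof
  assume "AE x in lborel. x \<notin> {a<..<b}"
  then have "{a<..<b} \<in> null_sets lborel" by (subst (asm) AE_iff_null_sets[symmetric]) auto
  then have "emeasure lborel {a<..<b} = 0" by auto
  then show False using assms by simp
qed

text \<open>\<open>is_support\<close> determines \<open>f\<close> only up to null sets. Outside
  \<open>J\<close> the cumulative integral is empty or total, so \<open>q f = 0\<close> there, and
  stray values of \<open>f\<close> can sit only at the roots of \<open>q\<close>. Inside
  \<open>J\<close> it is strictly positive, which gives the signs of \<open>q\<close> and
  \<open>f\<close>.\<close>

lemma IP_pearson_weight: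
  assumes IP: "IP f \<mu> \<delta> \<beta> \<gamma>" and \<delta>: "\<delta> \<le> 0" and supp: "is_support f J"
  obtains \<alpha> \<omega> where "J = einterval \<alpha> \<omega>"
    and "pearson_weight \<alpha> \<omega> \<delta> \<beta> \<gamma> \<mu> 1 (\<lambda>x. indicator J x * f x)"
    and "finite {x. x \<notin> J \<and> f x \<noteq> 0}"
proof -
  obtain \<alpha> \<omega> where J: "J = einterval \<alpha> \<omega>"
    using supp unfolding is_support_def einterval_def by blast
  have AEJ: "AE x in lborel. (x \<in> J) = (0 < f x)" using supp by (simp add: is_support_def)
  have f: "f \<in> borel_measurable borel" "\<And>x. 0 \<le> f x" "integrable lborel f" "(LINT x|lborel. f x) = 1"
    and tf: "integrable lborel (\<lambda>t. t * f t)" and \<mu>: "\<mu> = (LINT t|lborel. t * f t)"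
    and nz: "\<bar>\<delta>\<bar> + \<bar>\<beta>\<bar> + \<bar>\<gamma>\<bar> > 0"
    and cum: "\<And>x. (LINT t|lborel. indicator {..x} t * ((\<mu> - t) * f t)) = qpoly \<delta> \<beta> \<gamma> x * f x"
    using IP unfolding IP_def is_density_def set_lebesgue_integral_def by auto
  note [measurable] = f(1)
  let ?w = "\<lambda>x. indicator J x * f x"
  have [measurable]: "J \<in> sets borel" unfolding J by measurable
  have fw: "AE x in lborel. f x = ?w x"
    using AEJ
  proof eventually_elim
    case (elim x)
    then show ?case using f(2)[of x] by (auto simp: indicator_def)
  qed
  have int_eq: "(LINT x|lborel. h x * f x) = (LINT x|lborel. h x * ?w x)"
    and integrable_eq: "integrable lborel (\<lambda>x. h x * f x) \<longleftrightarrow> integrable lborel (\<lambda>x. h x * ?w x)"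
    if [measurable]: "h \<in> borel_measurable borel" for h
  proof -
    have "AE x in lborel. h x * f x = h x * ?w x"
      using fw by eventually_elim simp
    then show "(LINT x|lborel. h x * f x) = (LINT x|lborel. h x * ?w x)"
      "integrable lborel (\<lambda>x. h x * f x) \<longleftrightarrow> integrable lborel (\<lambda>x. h x * ?w x)"
      by (intro integral_cong_AE integrable_cong_AE; simp)+
  qed
  have i\<mu>: "integrable lborel (\<lambda>t. (\<mu> - t) * f t)"
    using f(3) tf by (simp add: left_diff_distrib)
  have total: "(LINT t|lborel. (\<mu> - t) * f t) = 0"
    using f(3,4) tf \<mu> by (simp add: left_diff_distrib)
  have cumw: "(LINT t|lborel. indicator {..x} t * ((\<mu> - t) * ?w t)) = qpoly \<delta> \<beta> \<gamma> x * f x" for x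
    using int_eq[of "\<lambda>t. indicator {..x} t * (\<mu> - t)"] cum[of x] by (simp add: mult.assoc)
  have i\<mu>w: "integrable lborel (\<lambda>t. (\<mu> - t) * ?w t)" using integrable_eq[of "\<lambda>t. \<mu> - t"] i\<mu> by simp
  have totalw: "(LINT t|lborel. (\<mu> - t) * ?w t) = 0" using int_eq[of "\<lambda>t. \<mu> - t"] total by simp
  have ivl: "\<alpha> < \<omega>"
  proof (rule ccontr)
    assume "\<not> \<alpha> < \<omega>"
    then have "J = {}" unfolding J einterval_def by (auto dest: less_trans)
    then show False using int_eq[of "\<lambda>_. 1"] f(4) by simp
  qed
  have pos: "0 < qpoly \<delta> \<beta> \<gamma> x * f x" if x: "x \<in> J" for x
  proof -
    obtain a b where ab: "a < x" "x < b" "{a..b} \<subseteq> J"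
      using einterval_nbhd[of x \<alpha> \<omega>] x unfolding J by blast
    have w0: "0 \<le> ?w t" for t using f(2) by simp
    have ind: "integrable lborel (\<lambda>t. indicator S t * ((\<mu> - t) * ?w t))" if "S \<in> sets borel" for S
      using integrable_mult_indicator[OF _ i\<mu>w, of S] that by simp
    show ?thesis
    \<comment> \<open>Up to \<mu> the integrand of the cumulative integral is nonnegative; beyond
      \<mu> the complementary integral is used instead, the total being zero. Positivity is strict
      because \<open>J\<close> contains an interval on the relevant side of
      \<open>x\<close>.\<close>
    proof (cases "x \<le> \<mu>")
      case True
      have nn: "0 \<le> indicator {..x} t * ((\<mu> - t) * ?w t)" for t
        using True w0[of t] by (auto simp: indicator_def)
      have "(LINT t|lborel. indicator {..x} t * ((\<mu> - t) * ?w t)) \<noteq> 0"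
      proof
        assume "(LINT t|lborel. indicator {..x} t * ((\<mu> - t) * ?w t)) = 0"
        then have "AE t in lborel. indicator {..x} t * ((\<mu> - t) * ?w t) = 0"
          using integral_nonneg_eq_0_iff_AE[OF ind[of "{..x}"]] nn by simp
        with AEJ have "AE t in lborel. t \<notin> {a<..<x}"
        proof eventually_elim
          case (elim t)
          show ?case
          proof
            assume t: "t \<in> {a<..<x}"
            then have "t \<in> J" using ab by (intro subsetD[OF ab(3)]) auto
            then show False using elim t True by auto
          qed
        qed
        then show False using AE_interval_not_empty[OF ab(1)] by simp
      qed
      moreover have "0 \<le> (LINT t|lborel. indicator {..x} t * ((\<mu> - t) * ?w t))"
        using nn by (intro integral_nonneg_AE) simp
      ultimately show ?thesis unfolding cumw by linarith
    next
      case False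
      have nn: "0 \<le> indicator {x<..} t * ((t - \<mu>) * ?w t)" for t
        using False w0[of t] by (auto simp: indicator_def)
      have ix: "integrable lborel (\<lambda>t. indicator {x<..} t * ((t - \<mu>) * ?w t))"
        using integrable_minus[OF ind[of "{x<..}"]] by (simp add: algebra_simps)
      have eq: "qpoly \<delta> \<beta> \<gamma> x * f x = (LINT t|lborel. indicator {x<..} t * ((t - \<mu>) * ?w t))"
      proof -
        have "qpoly \<delta> \<beta> \<gamma> x * f x - (LINT t|lborel. indicator {x<..} t * ((t - \<mu>) * ?w t))
            = (LINT t|lborel. indicator {..x} t * ((\<mu> - t) * ?w t) - indicator {x<..} t * ((t - \<mu>) * ?w t))"
          unfolding cumw[symmetric] by (subst Bochner_Integration.integral_diff[OF ind ix]) auto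
        also have "\<dots> = (LINT t|lborel. (\<mu> - t) * ?w t)"
          by (intro Bochner_Integration.integral_cong refl) (auto simp: indicator_def algebra_simps)
        finally show ?thesis using totalw by simp
      qed
      have "(LINT t|lborel. indicator {x<..} t * ((t - \<mu>) * ?w t)) \<noteq> 0"
      proof
        assume "(LINT t|lborel. indicator {x<..} t * ((t - \<mu>) * ?w t)) = 0"
        then have "AE t in lborel. indicator {x<..} t * ((t - \<mu>) * ?w t) = 0"
          using integral_nonneg_eq_0_iff_AE[OF ix] nn by simp
        with AEJ have "AE t in lborel. t \<notin> {x<..<b}"
        proof eventually_elim
          case (elim t)
          show ?case
          proof
            assume t: "t \<in> {x<..<b}"
            then have "t \<in> J" using ab by (intro subsetD[OF ab(3)]) auto
            then show False using elim t False by auto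
          qed
        qed
        then show False using AE_interval_not_empty[OF ab(2)] by simp
      qed
      moreover have "0 \<le> (LINT t|lborel. indicator {x<..} t * ((t - \<mu>) * ?w t))"
        using nn by (intro integral_nonneg_AE) simp
      ultimately show ?thesis unfolding eq by linarith
    qed
  qed
  have posq: "0 < qpoly \<delta> \<beta> \<gamma> x" and posf: "0 < f x" if "x \<in> J" for x
    using pos[OF that] f(2)[of x] by (auto simp: zero_less_mult_iff)
  have pw: "pearson_weight \<alpha> \<omega> \<delta> \<beta> \<gamma> \<mu> 1 ?w"
  proof
    show "integrable lborel ?w" using integrable_eq[of "\<lambda>_. 1"] f(3) by simp
    show "integrable lborel (\<lambda>x. x * ?w x)" using integrable_eq[of "\<lambda>x. x"] tf by simp
    show "(LINT t|lborel. indicator {..x} t * ((\<mu> - 1 * t) * ?w t)) = qpoly \<delta> \<beta> \<gamma> x * ?w x"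
      if "x \<in> einterval \<alpha> \<omega>" for x using cumw[of x] that by (simp add: J)
    show "(LINT t|lborel. (\<mu> - 1 * t) * ?w t) = 0" using totalw by simp
  qed (use ivl \<delta> posq posf in \<open>auto simp: J\<close>)
  have "qpoly \<delta> \<beta> \<gamma> x * f x = 0" if "x \<notin> J" for x
  proof -
    from that consider "ereal x \<le> \<alpha>" | "\<omega> \<le> ereal x" unfolding J einterval_iff by fastforce
    then show ?thesis
    proof cases
      case 1
      then have "\<not> t \<le> x" if "t \<in> J" for t
        using that unfolding J einterval_iff by (auto simp flip: ereal_less_eq(3) dest: order_trans)
      then have "(\<lambda>t. indicator {..x} t * ((\<mu> - t) * ?w t)) = (\<lambda>t. 0)" by (auto simp: indicator_def)
      then show ?thesis using cumw[of x] by simp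
    next
      case 2
      then have "t \<le> x" if "t \<in> J" for t
        using that unfolding J einterval_iff by (auto simp flip: ereal_less_eq(3) dest: order_trans[OF less_imp_le])
      then have "(\<lambda>t. indicator {..x} t * ((\<mu> - t) * ?w t)) = (\<lambda>t. (\<mu> - t) * ?w t)" by (auto simp: indicator_def)
      then show ?thesis using cumw[of x] totalw by simp
    qed
  qed
  then have "{x. x \<notin> J \<and> f x \<noteq> 0} \<subseteq> {x. poly [:\<gamma>, \<beta>, \<delta>:] x = 0}"
    unfolding poly_qpoly by auto
  moreover have "finite {x. poly [:\<gamma>, \<beta>, \<delta>:] x = 0}"
    using nz by (intro poly_roots_finite) auto
  ultimately have "finite {x. x \<notin> J \<and> f x \<noteq> 0}" by (rule finite_subset)
  then show ?thesis using that J pw by blast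
qed

lemma deriv_chain_ac_deriv:
  assumes "deriv_chain (einterval \<alpha> \<omega>) l g G" "k < l"
  shows "ac_deriv (einterval \<alpha> \<omega>) (G k) (G (Suc k))"
proof -
  let ?J = "einterval \<alpha> \<omega>"
  have D: "(G k has_real_derivative G (Suc k) x) (at x)" if "Suc k < l" "x \<in> ?J" for k x
    using assms(1) that unfolding deriv_chain_def by simp
  have last: "ac_deriv ?J (G (l - 1)) (G l)"
    using assms(1) unfolding deriv_chain_def ac_deriv_def set_integrable_def set_lebesgue_integral_def by simp
  have cont: "continuous_on ?J (G k)" if "k < l" for k
  proof (cases "Suc k < l")
    case True
    then show ?thesis using D by (auto intro!: continuous_at_imp_continuous_on DERIV_isCont)
  next
    case False
    then have "k = l - 1" using that by simp
    then show ?thesis using ac_deriv_continuous[OF last] by simp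
  qed
  show ?thesis
  proof (cases "Suc k < l")
    case True
    then show ?thesis by (intro ac_deriv_C1 D cont)
  next
    case False
    then have "Suc k = l" using assms(2) by simp
    then show ?thesis using last by auto
  qed
qed

theorem theorem2p1:
  fixes f g :: "real \<Rightarrow> real" and G :: "nat \<Rightarrow> real \<Rightarrow> real"
    and \<mu> \<delta> \<beta> \<gamma> :: real and J :: "real set" and m n :: nat
  assumes "IP f \<mu> \<delta> \<beta> \<gamma>" and "\<delta> \<le> 0"
    and "is_support f J"
    and "n \<noteq> 0"
    and "Hclass f \<delta> \<beta> \<gamma> J m n g G"
  shows "(\<forall>i\<in>{1..m}. coef_a f \<delta> \<beta> \<gamma> m n i > 0) \<and> (\<forall>i\<in>{1..n}. coef_b \<delta> m n i > 0)
    \<and> (-1) ^ n * (varg f g - Smn f \<delta> \<beta> \<gamma> m n G) \<ge> 0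
    \<and> (Smn f \<delta> \<beta> \<gamma> m n G = varg f g \<longleftrightarrow>
         (\<exists>p :: real poly. degree p \<le> m + n \<and> (\<forall>x\<in>J. g x = poly p x)))"
proof -
  obtain \<alpha> \<omega> where J: "J = einterval \<alpha> \<omega>"
    and pw: "pearson_weight \<alpha> \<omega> \<delta> \<beta> \<gamma> \<mu> 1 (\<lambda>x. indicator J x * f x)"
    and fin: "finite {x. x \<notin> J \<and> f x \<noteq> 0}"
    by (rule IP_pearson_weight[OF assms(1-3)])
  define w where "w x = indicator J x * f x" for x
  interpret pearson_weight \<alpha> \<omega> \<delta> \<beta> \<gamma> \<mu> 1 w
    using pw unfolding w_def .
  have n: "0 < n" using assms(4) by simp
  have off: "h x * f x = h x * w x" if "x \<notin> {x. x \<notin> J \<and> f x \<noteq> 0}" for h :: "real \<Rightarrow> real" and x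
    using that by (auto simp: w_def indicator_def)
  \<comment> \<open>Stated for arbitrary \<open>h\<close>, since \<open>g\<close> and the
    \<open>G i\<close> need not be measurable outside \<open>J\<close>. Changing an integrand on a
    countable set requires no measurability, which is why the exceptional set was shown to be finite
    and not merely null.\<close>
  have expect_w: "expect f h = (LINT x|lborel. h x * w x)" for h
    unfolding expect_def
    by (rule integral_discrete_difference[OF countable_finite[OF fin]]) (use off in auto)
  have integrable_w: "integrable lborel (\<lambda>x. h x * f x) \<longleftrightarrow> integrable lborel (\<lambda>x. h x * w x)" for h
    by (rule integrable_discrete_difference[OF countable_finite[OF fin]]) (use off in auto)
  have mass: "(LINT x|lborel. w x) = 1"
    using expect_w[of "\<lambda>_. 1"] assms(1) by (simp add: expect_def IP_def is_density_def)
  have chain: "deriv_chain (einterval \<alpha> \<omega>) (max m n) g G"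
    using assms(5) unfolding Hclass_def J by simp
  have ac: "ac_deriv (einterval \<alpha> \<omega>) (G i) (G (Suc i))" if "i < max m n" for i
    by (rule deriv_chain_ac_deriv[OF chain that])
  have acn: "ac_deriv (einterval \<alpha> \<omega>) (G i) (G (Suc i))" if "i < n" for i
    using ac that by simp
  have top: "integrable lborel (\<lambda>x. (G n x)\<^sup>2 * (q x ^ n * w x))"
    using assms(5) integrable_w[of "\<lambda>x. q x ^ n * (G n x)\<^sup>2"] unfolding Hclass_def by (simp add: mult_ac)
  have G0: "g x = G 0 x" if "x \<in> J" for x
    using chain that unfolding deriv_chain_def J by simp
  have gw: "g x * w x = G 0 x * w x" for x
    using G0[of x] by (cases "x \<in> J") (auto simp: w_def)
  let ?P = "\<lambda>k. \<Prod>j\<in>{m + 1..m + n}. (1 - lam k / lam j)"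
  let ?t = "\<lambda>k. (fcoef (G 0) k)\<^sup>2 * sqnorm k * ?P k"
  have Eq: "0 < (LINT x|lborel. q x ^ i * w x)" for i
  proof -
    interpret W: pearson_weight \<alpha> \<omega> \<delta> \<beta> \<gamma> "\<mu> + real i * \<beta>" "1 - 2 * real i * \<delta>" "\<lambda>x. q x ^ i * w x"
      by (rule iterated_weight)
    show ?thesis using W.poly_sq_integral_pos[of 1] by simp
  qed
  have eq: "expect f (\<lambda>x. q x ^ i) = (LINT x|lborel. q x ^ i * w x)" for i by (rule expect_w)
  have a_term: "coef_a f \<delta> \<beta> \<gamma> m n i * (expect f (\<lambda>x. q x ^ i * G i x))\<^sup>2 = ?t i" if i: "i \<in> {1..m}" for i
  proof -
    have int: "integrable lborel (\<lambda>x. G i x * (q x ^ i * w x))"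
    \<comment> \<open>Up to order \<open>n\<close> integrability follows from square integrability;
      beyond it is part of \<open>Hclass\<close>.\<close>
    proof (cases "i \<le> n")
      case True
      interpret W: pearson_weight \<alpha> \<omega> \<delta> \<beta> \<gamma> "\<mu> + real i * \<beta>" "1 - 2 * real i * \<delta>" "\<lambda>x. q x ^ i * w x"
        by (rule iterated_weight)
      show ?thesis
        using W.integrable_power_times_w[OF chain_square_integrable[OF acn top True]
          chain_measurable[of n G i, OF acn n True], of 0] by simp
    next
      case False
      then show ?thesis
        using assms(5) i integrable_w[of "\<lambda>x. q x ^ i * G i x"] unfolding Hclass_def by (simp add: mult_ac)
    qed
    have ac': "ac_deriv (einterval \<alpha> \<omega>) (G s) (G (Suc s))" if "s < i" for s
      using ac that i by simp
    define E where "E = (LINT x|lborel. G i x * (q x ^ i * w x))"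
    define Q where "Q = (LINT x|lborel. q x ^ i * w x)"
    define W where "W = newton_basis \<delta> 1 i (lam i)"
    define e where "e = sqnorm i"
    define d where "d = fcoef (G 0) i"
    have 1: "fact i * E = W * (d * e)" "(fact i)\<^sup>2 * Q = W * e"
      using top_moment[OF ac' int] by (simp_all add: E_def Q_def W_def e_def d_def)
    have "(fact i)\<^sup>2 * E\<^sup>2 = (W * (d * e))\<^sup>2" using 1(1) by (metis power_mult_distrib)
    also have "\<dots> = (W * e) * (W * (d\<^sup>2 * e))" by (simp add: power2_eq_square)
    also have "\<dots> = (fact i)\<^sup>2 * (Q * W * (d\<^sup>2 * e))" unfolding 1(2)[symmetric] by simp
    \<comment> \<open>The factorial is eliminated between the two identities of
      \<open>top_moment\<close>; the factor \<open>Q * W\<close> is then absorbed by the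
      normalisation of \<open>coef_a\<close>.\<close>
    finally have E2: "E\<^sup>2 = Q * W * (d\<^sup>2 * e)" by simp
    have P: "coef_a f \<delta> \<beta> \<gamma> m n i * W * Q = ?P i"
      using coef_a_newton[OF \<delta>, of i m n f \<beta> \<gamma>] i n Eq[of i] unfolding eq W_def Q_def by simp
    have "expect f (\<lambda>x. q x ^ i * G i x) = E" unfolding expect_w E_def by (simp add: mult_ac)
    then have "coef_a f \<delta> \<beta> \<gamma> m n i * (expect f (\<lambda>x. q x ^ i * G i x))\<^sup>2 = (coef_a f \<delta> \<beta> \<gamma> m n i * W * Q) * (d\<^sup>2 * e)"
      unfolding E2[symmetric] by (simp add: E2)
    then show ?thesis unfolding P d_def e_def by (simp add: mult_ac)
  qed
  have p0: "poly (p 0) x = 1" for x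
    using p_degree[of 0] p_lead[of 0] by (metis degree_eq_zeroE coeff_pCons_0 poly_pCons poly_0 mult_zero_right add.right_neutral)
  have sq0: "sqnorm 0 = 1" using mass by (simp add: p0)
  have mean: "expect f g = fcoef (G 0) 0"
    unfolding expect_w fcoef_def sq0 gw by (simp add: p0)
  have e0: "integrable lborel (\<lambda>x. (G 0 x)\<^sup>2 * w x)"
    using chain_square_integrable[OF acn top, of 0] by simp
  have g0: "integrable lborel (\<lambda>x. G 0 x * w x)"
    using cross_integrable[OF acn n top, of 0 1] by simp
  \<comment> \<open>\<open>?t 0\<close> is the squared mean: \<open>lam 0 = 0\<close> makes the
    product 1, and \<open>sqnorm 0 = 1\<close>. So index 0, absent from the sum of the
    \<open>a_i\<close>, accounts for the difference between second moment and variance.\<close>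
  have var: "varg f g = energy G 0 - ?t 0"
  proof -
    let ?c = "fcoef (G 0) 0"
    have "(g x - ?c)\<^sup>2 * w x = (G 0 x)\<^sup>2 * w x - 2 * ?c * (G 0 x * w x) + ?c\<^sup>2 * w x" for x
      using G0[of x] by (cases "x \<in> J") (auto simp: w_def power2_eq_square algebra_simps)
    then have "varg f g = (LINT x|lborel. (G 0 x)\<^sup>2 * w x - 2 * ?c * (G 0 x * w x) + ?c\<^sup>2 * w x)"
      unfolding varg_def mean unfolding expect_w by simp
    also have "\<dots> = energy G 0 - 2 * ?c * (LINT x|lborel. G 0 x * w x) + ?c\<^sup>2"
      using e0 g0 w_int mass by (simp add: energy_def)
    also have "(LINT x|lborel. G 0 x * w x) = ?c" using mean expect_w[of g] gw by simp
    finally show ?thesis using sq0 by (simp add: power2_eq_square)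
  qed
  have energy: "expect f (\<lambda>x. q x ^ i * (G i x)\<^sup>2) = energy G i" for i
    unfolding expect_w energy_def by (simp add: mult_ac)
  have S: "varg f g - Smn f \<delta> \<beta> \<gamma> m n G
      = (\<Sum>i\<le>n. (-1) ^ i * coef_b \<delta> m n i * energy G i) - (\<Sum>k\<le>m. ?t k)"
  proof -
    have shift: "(\<Sum>i\<le>k. h i) = h 0 + (\<Sum>i=1..k. h i)" for h :: "nat \<Rightarrow> real" and k
      by (simp add: sum.atLeast_Suc_atMost atMost_atLeast0)
    have "(\<Sum>i=1..n. (-1) ^ (i - 1) * coef_b \<delta> m n i * expect f (\<lambda>x. q x ^ i * (G i x)\<^sup>2))
        = - (\<Sum>i=1..n. (-1) ^ i * coef_b \<delta> m n i * energy G i)"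
      unfolding sum_negf[symmetric]
    proof (intro sum.cong refl)
      fix i assume "i \<in> {1..n}"
      then obtain k where "i = Suc k" by (cases i) auto
      then show "(-1) ^ (i - 1) * coef_b \<delta> m n i * expect f (\<lambda>x. q x ^ i * (G i x)\<^sup>2)
          = - ((-1) ^ i * coef_b \<delta> m n i * energy G i)" unfolding energy by simp
    qed
    moreover have "(\<Sum>i=1..m. coef_a f \<delta> \<beta> \<gamma> m n i * (expect f (\<lambda>x. q x ^ i * G i x))\<^sup>2) = (\<Sum>k=1..m. ?t k)"
      by (intro sum.cong refl a_term)
    ultimately have "Smn f \<delta> \<beta> \<gamma> m n G = (\<Sum>k=1..m. ?t k) - (\<Sum>i=1..n. (-1) ^ i * coef_b \<delta> m n i * energy G i)"
      unfolding Smn_def by simp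
    then show ?thesis
      unfolding var shift[of _ n] shift[of _ m] by simp
  qed
  note main = energy_sum_bound[OF refl acn n top, of m]
  have pa: "\<forall>i\<in>{1..m}. coef_a f \<delta> \<beta> \<gamma> m n i > 0"
  proof
    fix i assume i: "i \<in> {1..m}"
    then have "0 < real (m choose i)" "0 < ffac (real (m + n)) i"
      using ffac_pos[of i "m + n"] by (auto simp: zero_less_binomial)
    then show "coef_a f \<delta> \<beta> \<gamma> m n i > 0"
      unfolding coef_a_def eq by (intro divide_pos_pos mult_pos_pos Eq prod_one_minus_pos \<delta>)
  qed
  have pb: "\<forall>i\<in>{1..n}. coef_b \<delta> m n i > 0" using coef_b_pos[OF \<delta>] by simp
  have ge: "(-1) ^ n * (varg f g - Smn f \<delta> \<beta> \<gamma> m n G) \<ge> 0" unfolding S using main(1) by simp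
  have "Smn f \<delta> \<beta> \<gamma> m n G = varg f g \<longleftrightarrow> varg f g - Smn f \<delta> \<beta> \<gamma> m n G = 0" by auto
  also have "\<dots> \<longleftrightarrow> (\<exists>p :: real poly. degree p \<le> m + n \<and> (\<forall>x\<in>J. G 0 x = poly p x))"
    unfolding S J by (rule main(2))
  also have "\<dots> \<longleftrightarrow> (\<exists>p :: real poly. degree p \<le> m + n \<and> (\<forall>x\<in>J. g x = poly p x))"
    using G0 by simp
  finally show ?thesis using pa pb ge by blast
qed

end
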